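(* Let $X$ be a separable Banach space containing no copy of $\ell_1$ and having the bounded tree property. Then $X$ is isomorphic to a subspace of $c_0$.
   Context: Trees: let $\mathcal F\mathbb N$ be the set of all finite subsets of $\mathbb N$, partially ordered by: $a\le b$ iff, writing $a=\{n_1<\dots<n_k\}$ and $b=\{m_1<\dots<m_l\}$, we have $k\le l$ and $m_i=n_i$ for $1\le i\le k$ (i.e. $a$ is an initial segment of $b$). $b$ is a successor of $a$ if $a\le b$ and $|b|=|a|+1$; $a+$ denotes the collection of successors of $a$ (for an assignment on $S$, the successors in $S$); for $a\neq\emptyset$, $a-$ is the unique predecessor of $a$. A full tree is a set $S\subset\mathcal F\mathbb N$ such that (1) $\emptyset\in S$; (2) each $a\in S$ has infinitely many successors in $S$; (3) if $\emptyset\ne a\in S$ then $a-\in S$. A full subtree of $S$ is a full tree $T\subset S$. A branch of $S$ is a sequence $\beta=\{a_n\}_{n=0}^\infty$ in $S$ with $a_0=\emptyset$ and $a_{n+1}$ a successor of $a_n$ for all $n\ge0$. A tree-map in a vector space $V$ is a map $a\mapsto x_a\in V$ defined on a full tree $S$ with $x_\emptyset=0$ and such that for every branch $\beta$ of $S$ the set $\{a\in\beta: x_a\ne0\}$ is finite. A tree-map $(x_a)_{a\in S}$ in $X$ is weakly null if for every $a\in S$ the family $\{x_b\}_{b\in a+}$ is a weakly null sequence. $X$ has the bounded tree property with constant $\sigma>0$ if every weakly null tree-map $(x_a)_{a\in S}$ in $X$ with $\|x_a\|\le\sigma$ for all $a\in S$ has a full subtree $T$ such that $\big\|\sum_{a\in\beta}x_a\big\|\le1$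 for every branch $\beta$ of $T$. $X$ has the bounded tree property if this holds for some $\sigma>0$. Subspaces are closed; isomorphic means linearly homeomorphic; "no copy of $\ell_1$" means no closed subspace isomorphic to $\ell_1$. *)

theory Defs
  imports "HOL-Analysis.Analysis"
begin

text \<open>Meant for linear subspaces \<open>Y\<close> and \<open>Z\<close>. Only the values of the map on \<open>Y\<close> matter.\<close>

definition linearly_homeomorphic ::
    "'a::real_normed_vector set \<Rightarrow> 'b::real_normed_vector set \<Rightarrow> bool" where
  "linearly_homeomorphic Y Z \<longleftrightarrow>
     (\<exists>f g. homeomorphism Y Z f g \<and>
        (\<forall>u\<in>Y. \<forall>v\<in>Y. f (u + v) = f u + f v) \<and> (\<forall>c. \<forall>u\<in>Y. f (c *\<^sub>R u) = c *\<^sub>R f u))"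

definition closed_subspace :: "'a::real_normed_vector set \<Rightarrow> bool" where
  "closed_subspace Y \<longleftrightarrow> subspace Y \<and> closed Y"

text \<open>
  As \<open>nat\<close> is discrete, \<open>nat \<Rightarrow>\<^sub>C real\<close> is the space of all bounded real sequences with the
  supremum norm. Its subspace \<open>c\<^sub>0\<close> is closed, so being closed in \<open>c\<^sub>0\<close> and being closed in the
  ambient space mean the same for subsets of \<open>c\<^sub>0\<close>.
\<close>

definition c0 :: "(nat \<Rightarrow>\<^sub>C real) set" where
  "c0 = {f. apply_bcontfun f \<longlonglongrightarrow> 0}"

lemma subspace_c0: "subspace c0"
  unfolding subspace_def c0_def
  by (auto simp: zero_bcontfun.rep_eq plus_bcontfun.rep_eq scaleR_bcontfun.rep_eq
      intro: tendsto_add_zero tendsto_mult_right_zero)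

typedef ell1 = "{f :: nat \<Rightarrow> real. summable (\<lambda>n. \<bar>f n\<bar>)}"
  morphisms ell1_nth Abs_ell1
  by (rule exI[of _ "\<lambda>_. 0"]) simp

setup_lifting type_definition_ell1

lemma summable_abs_add:
  fixes f g :: "nat \<Rightarrow> real"
  assumes "summable (\<lambda>n. \<bar>f n\<bar>)" and "summable (\<lambda>n. \<bar>g n\<bar>)"
  shows "summable (\<lambda>n. \<bar>f n + g n\<bar>)"
  by (rule summable_comparison_test[OF _ summable_add[OF assms]]) (auto intro!: exI[of _ 0])

lemma summable_abs_diff:
  fixes f g :: "nat \<Rightarrow> real"
  assumes "summable (\<lambda>n. \<bar>f n\<bar>)" and "summable (\<lambda>n. \<bar>g n\<bar>)"
  shows "summable (\<lambda>n. \<bar>f n - g n\<bar>)"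
  using summable_abs_add[of f "\<lambda>n. - g n"] assms by simp

instantiation ell1 :: real_normed_vector
begin

lift_definition zero_ell1 :: ell1 is "\<lambda>_. 0" by simp
lift_definition plus_ell1 :: "ell1 \<Rightarrow> ell1 \<Rightarrow> ell1" is "\<lambda>f g n. f n + g n"
  by (rule summable_abs_add)
lift_definition uminus_ell1 :: "ell1 \<Rightarrow> ell1" is "\<lambda>f n. - f n" by simp
lift_definition minus_ell1 :: "ell1 \<Rightarrow> ell1 \<Rightarrow> ell1" is "\<lambda>f g n. f n - g n"
  by (rule summable_abs_diff)
lift_definition scaleR_ell1 :: "real \<Rightarrow> ell1 \<Rightarrow> ell1" is "\<lambda>c f n. c * f n"
  by (simp add: abs_mult summable_mult)
lift_definition norm_ell1 :: "ell1 \<Rightarrow> real" is "\<lambda>f. \<Sum>n. \<bar>f n\<bar>" .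
definition sgn_ell1 :: "ell1 \<Rightarrow> ell1" where "sgn_ell1 f = inverse (norm f) *\<^sub>R f"
definition dist_ell1 :: "ell1 \<Rightarrow> ell1 \<Rightarrow> real" where "dist_ell1 f g = norm (f - g)"
definition uniformity_ell1 :: "(ell1 \<times> ell1) filter"
  where "uniformity_ell1 = (INF e\<in>{0<..}. principal {(x, y). dist x y < e})"
definition open_ell1 :: "ell1 set \<Rightarrow> bool"
  where "open_ell1 U \<longleftrightarrow> (\<forall>x\<in>U. \<forall>\<^sub>F (x', y) in uniformity. x' = x \<longrightarrow> y \<in> U)"

instance
proof
  fix f g :: ell1 and c :: real
  show "norm f = 0 \<longleftrightarrow> f = 0"
    by transfer (auto simp: suminf_eq_zero_iff fun_eq_iff)
  show "norm (f + g) \<le> norm f + norm g"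
  proof transfer
    fix f g :: "nat \<Rightarrow> real"
    assume s: "summable (\<lambda>n. \<bar>f n\<bar>)" "summable (\<lambda>n. \<bar>g n\<bar>)"
    have "summable (\<lambda>n. \<bar>f n + g n\<bar>)"
      by (rule summable_abs_add[OF s])
    then have "(\<Sum>n. \<bar>f n + g n\<bar>) \<le> (\<Sum>n. \<bar>f n\<bar> + \<bar>g n\<bar>)"
      by (intro suminf_le summable_add s) auto
    then show "(\<Sum>n. \<bar>f n + g n\<bar>) \<le> (\<Sum>n. \<bar>f n\<bar>) + (\<Sum>n. \<bar>g n\<bar>)"
      by (simp add: suminf_add[OF s])
  qed
  show "norm (c *\<^sub>R f) = \<bar>c\<bar> * norm f"
    by transfer (simp add: abs_mult suminf_mult)
qed (simp_all add: sgn_ell1_def dist_ell1_def uniformity_ell1_def open_ell1_def,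
     (transfer, simp add: algebra_simps fun_eq_iff)+)

end

definition initial_segment :: "nat set \<Rightarrow> nat set \<Rightarrow> bool" where
  "initial_segment a b \<longleftrightarrow> finite a \<and> finite b \<and> card a \<le> card b \<and>
     (\<forall>i<card a. sorted_list_of_set b ! i = sorted_list_of_set a ! i)"

definition is_successor :: "nat set \<Rightarrow> nat set \<Rightarrow> bool" where
  "is_successor b a \<longleftrightarrow> initial_segment a b \<and> card b = card a + 1"

definition successors :: "nat set set \<Rightarrow> nat set \<Rightarrow> nat set set" where
  "successors S a = {b \<in> S. is_successor b a}"

definition predecessor :: "nat set \<Rightarrow> nat set" where
  "predecessor b = (THE a. is_successor b a)"

definition full_tree :: "nat set set \<Rightarrow> bool" where
  "full_tree S \<longleftrightarrow> (\<forall>a\<in>S. finite a) \<and> {} \<in> S \<and>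
     (\<forall>a\<in>S. infinite (successors S a)) \<and>
     (\<forall>a\<in>S. a \<noteq> {} \<longrightarrow> predecessor a \<in> S)"

definition full_subtree :: "nat set set \<Rightarrow> nat set set \<Rightarrow> bool" where
  "full_subtree T S \<longleftrightarrow> full_tree T \<and> T \<subseteq> S"

definition branch :: "nat set set \<Rightarrow> (nat \<Rightarrow> nat set) \<Rightarrow> bool" where
  "branch S \<beta> \<longleftrightarrow> \<beta> 0 = {} \<and> (\<forall>n. \<beta> n \<in> S \<and> is_successor (\<beta> (Suc n)) (\<beta> n))"

lemma is_successor_iff:
  "is_successor b a \<longleftrightarrow> finite a \<and> (\<exists>m. (\<forall>n\<in>a. n < m) \<and> b = insert m a)"
proof
  assume "is_successor b a"
  then have fin: "finite a" "finite b" and card: "card b = Suc (card a)"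
    and nth: "\<And>i. i < card a \<Longrightarrow> sorted_list_of_set b ! i = sorted_list_of_set a ! i"
    by (auto simp: is_successor_def initial_segment_def)
  let ?l = "sorted_list_of_set b"
  let ?m = "?l ! card a"
  have "take (card a) ?l = sorted_list_of_set a"
    by (rule nth_equalityI) (auto simp: card nth)
  then have l: "?l = sorted_list_of_set a @ [?m]"
    using take_Suc_conv_app_nth[of "card a" ?l] by (simp add: card)
  have "sorted_wrt (<) (sorted_list_of_set a @ [?m])"
    unfolding l[symmetric] by simp
  then have "\<forall>n\<in>a. n < ?m"
    using fin by (auto simp: sorted_wrt_append)
  moreover have "set ?l = insert ?m (set (sorted_list_of_set a))"
    by (subst l) simp
  then have "b = insert ?m a"
    using fin by simp
  ultimately show "finite a \<and> (\<exists>m. (\<forall>n\<in>a. n < m) \<and> b = insert m a)"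
    using fin by blast
next
  assume "finite a \<and> (\<exists>m. (\<forall>n\<in>a. n < m) \<and> b = insert m a)"
  then obtain m where fin: "finite a" and m: "\<forall>n\<in>a. n < m" and b: "b = insert m a"
    by blast
  have notin: "m \<notin> a"
    using m by auto
  have "sorted_list_of_set b = sorted_list_of_set a @ [m]"
    by (rule sorted_list_of_set_unique[THEN iffD1])
       (use fin m notin b in \<open>auto simp: sorted_wrt_append\<close>)
  then show "is_successor b a"
    using fin notin b by (auto simp: is_successor_def initial_segment_def nth_append)
qed

lemma predecessor_eq:
  assumes "is_successor b a"
  shows "predecessor b = a"
proof -
  have "a = b - {Max b}" if ab: "is_successor b a" for a
  proof -
    obtain m where m: "finite a" "\<forall>n\<in>a. n < m" "b = insert m a"
      using ab by (auto simp: is_successor_iff)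
    then have "Max b = m"
      by (intro Max_eqI) (auto simp: less_imp_le)
    with m show ?thesis by auto
  qed
  then show ?thesis
    unfolding predecessor_def using assms by (metis the_equality)
qed

definition weakly_null :: "(nat \<Rightarrow> 'a::real_normed_vector) \<Rightarrow> bool" where
  "weakly_null u \<longleftrightarrow> (\<forall>\<phi> :: 'a \<Rightarrow> real. bounded_linear \<phi> \<longrightarrow> (\<lambda>n. \<phi> (u n)) \<longlonglongrightarrow> 0)"

text \<open>
  Only the values of a tree-map on \<open>S\<close> are ever used.
\<close>

definition tree_map :: "nat set set \<Rightarrow> (nat set \<Rightarrow> 'a::real_vector) \<Rightarrow> bool" where
  "tree_map S x \<longleftrightarrow> full_tree S \<and> x {} = 0 \<and>
     (\<forall>\<beta>. branch S \<beta> \<longrightarrow> finite {a \<in> range \<beta>. x a \<noteq> 0})"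

text \<open>
  The successors of a node form a countably infinite set, and whether they yield a weakly null
  sequence does not depend on the way they are enumerated.
\<close>

definition weakly_null_tree_map :: "nat set set \<Rightarrow> (nat set \<Rightarrow> 'a::real_normed_vector) \<Rightarrow> bool" where
  "weakly_null_tree_map S x \<longleftrightarrow> tree_map S x \<and>
     (\<forall>a\<in>S. \<forall>e. bij_betw e (UNIV :: nat set) (successors S a) \<longrightarrow> weakly_null (\<lambda>n. x (e n)))"

text \<open>
  The sum along a branch is taken over its nodes with nonzero value: there are finitely many of
  these, whereas \<open>sum\<close> over the infinite set \<open>range \<beta>\<close> would be \<open>0\<close> by convention.
\<close>

definition branch_sum :: "(nat set \<Rightarrow> 'a::real_vector) \<Rightarrow> (nat \<Rightarrow> nat set) \<Rightarrow> 'a" where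
  "branch_sum x \<beta> = (\<Sum>a \<in> {a \<in> range \<beta>. x a \<noteq> 0}. x a)"

definition bounded_tree_property_with :: "'a::real_normed_vector itself \<Rightarrow> real \<Rightarrow> bool" where
  "bounded_tree_property_with _ \<sigma> \<longleftrightarrow>
     (\<forall>S (x :: nat set \<Rightarrow> 'a). weakly_null_tree_map S x \<and> (\<forall>a\<in>S. norm (x a) \<le> \<sigma>) \<longrightarrow>
        (\<exists>T. full_subtree T S \<and> (\<forall>\<beta>. branch T \<beta> \<longrightarrow> norm (branch_sum x \<beta>) \<le> 1)))"

definition bounded_tree_property :: "'a::real_normed_vector itself \<Rightarrow> bool" where
  "bounded_tree_property X \<longleftrightarrow> (\<exists>\<sigma>>0. bounded_tree_property_with X \<sigma>)"

end

theory Submission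
  imports Defs
begin

text \<open>
  The vectors \<open>x\<close> such that every weakly null tree with small nodes can be thinned out so that all
  branch sums translated by \<open>x\<close> stay in the unit ball form the unit ball of an equivalent norm \<open>N\<close>;
  hanging trees below the terms of a sequence shows that adding small weakly null vectors
  does not leave this ball. Without copies of \<open>\<ell>\<^sub>1\<close>, Rosenthal's theorem dualises this to
  \<open>liminf N*(f + g n) \<ge> N*(f) + (\<theta>/2) liminf N*(g n)\<close> for weak-star null \<open>g n\<close>, whence the dual is
  separable. Let \<open>E m\<close> and \<open>F k\<close> be increasing finite-dimensional subspaces with dense union in the
  space and in its dual. A functional whose norm hardly grows when passing from \<open>E m\<close> to a much
  larger \<open>E m'\<close> is, up to a small error, a sum of an element of some \<open>F k\<close> and one annihilating
  \<open>E m'\<close>. As the norms on the \<open>E m\<close> are bounded and increasing, this happens again and again, and the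
  dual estimate makes the telescoping sum of the pieces absolutely convergent. The pieces lie near
  finite-dimensional spaces and annihilate larger and larger \<open>E m\<close>, so finite nets for them give a
  norming weak-star null sequence, that is, an embedding into \<open>c\<^sub>0\<close>.
\<close>

text \<open>No basis or finite-dimensional decomposition of the space is given, so nothing projects
  it onto \<open>E m\<close>; the decomposition has to happen in the dual, one functional at a time.
  The obstacle is that the place where a functional \<open>f\<close> splits depends on
  \<open>f\<close>, whereas finite nets must be fixed before \<open>f\<close> is known. Hence the
  blocks: each is so long that every \<open>f\<close> in the dual ball has a flat step somewhere
  inside it, and only the ends of the block, common to all \<open>f\<close>, enter the nets. This
  needs estimates that are uniform in the vectors and functionals involved. They come from
  compactness in \<open>E m\<close> and \<open>F k\<close>; density of the \<open>F k\<close> in the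
  dual is what makes bounded vectors killed by more and more \<open>F k\<close> weakly null. The
  factor 1/2 in \<theta>/2 arises because the weakly null test vectors are differences of two
  vectors of the unit ball. The errors decrease geometrically and are small against \<theta>, so
  that in the final estimate they are absorbed into half of the norm.\<close>

section \<open>Hahn-Banach and finite-dimensional subspaces\<close>

text \<open>Zorn's lemma is applied to graphs of extensions, as subspaces of the product with the
  reals, so that chains are handled by plain unions.\<close>

lemma hahn_banach_seminorm:
  fixes p :: "'a::real_vector \<Rightarrow> real" and f :: "'a \<Rightarrow> real"
  assumes tri: "\<And>x y. p (x + y) \<le> p x + p y" and hom: "\<And>c x. p (c *\<^sub>R x) = \<bar>c\<bar> * p x"
    and V: "subspace V" and lin: "linear f" and le: "\<And>x. x \<in> V \<Longrightarrow> f x \<le> p x"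
  shows "\<exists>g. linear g \<and> (\<forall>x\<in>V. g x = f x) \<and> (\<forall>x. g x \<le> p x)"
proof -
  \<comment> \<open>Members of \<open>A\<close> need not be required to be graphs:
    \<open>p 0 = 0\<close> and closure under negation leave no pair (0, t) with nonzero t below
    \<open>p\<close>, see \<open>uniq\<close>.\<close>
  define A where "A = {G :: ('a \<times> real) set. subspace G \<and> (\<lambda>x. (x, f x)) ` V \<subseteq> G \<and> (\<forall>(x,t)\<in>G. t \<le> p x)}"
  have "subspace ((\<lambda>x. (x, f x)) ` V)"
    by (intro linear_subspace_image V linearI) (auto simp: linear_add[OF lin] linear_scale[OF lin])
  then have A0: "(\<lambda>x. (x, f x)) ` V \<in> A"
    by (auto simp: A_def le)
  have "\<exists>M\<in>A. \<forall>X\<in>A. M \<subseteq> X \<longrightarrow> X = M"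
  proof (rule subset_Zorn_nonempty)
    show "A \<noteq> {}" using A0 by auto
    fix C assume C: "C \<noteq> {}" "subset.chain A C"
    then have CA: "C \<subseteq> A" and ch: "\<And>X Y. X \<in> C \<Longrightarrow> Y \<in> C \<Longrightarrow> X \<subseteq> Y \<or> Y \<subseteq> X"
      by (auto simp: subset_chain_def)
    have "subspace (\<Union>C)"
      unfolding subspace_def
    proof (intro conjI allI ballI)
      show "0 \<in> \<Union>C" using C CA by (auto simp: A_def subspace_def)
      fix x assume "x \<in> \<Union>C"
      then obtain X where X: "X \<in> C" "x \<in> X" by auto
      then show "c *\<^sub>R x \<in> \<Union>C" for c
        using CA by (auto simp: A_def intro!: bexI[of _ X] subspace_scale)
      fix y assume "y \<in> \<Union>C"
      then obtain Y where Y: "Y \<in> C" "y \<in> Y" by auto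
      obtain Z where "Z \<in> C" "x \<in> Z" "y \<in> Z" using ch[OF X(1) Y(1)] X Y by auto
      moreover then have "subspace Z" using CA by (auto simp: A_def)
      ultimately show "x + y \<in> \<Union>C" by (auto intro: subspace_add)
    qed
    then show "\<Union>C \<in> A" using C CA by (fastforce simp: A_def)
  qed
  then obtain M where M: "M \<in> A" and max: "\<And>X. X \<in> A \<Longrightarrow> M \<subseteq> X \<Longrightarrow> X = M" by auto
  have sub: "subspace M" and gr: "(\<lambda>x. (x, f x)) ` V \<subseteq> M" and Mp: "\<And>x t. (x,t) \<in> M \<Longrightarrow> t \<le> p x"
    using M by (auto simp: A_def)
  have Madd: "(x + y, s + t) \<in> M" if "(x,s) \<in> M" "(y,t) \<in> M" for x y s t
    using subspace_add[OF sub that] by simp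
  have Mscale: "(c *\<^sub>R x, c * s) \<in> M" if "(x,s) \<in> M" for x s c
    using subspace_scale[OF sub that, of c] by simp
  have Mneg: "(-x, -s) \<in> M" if "(x,s) \<in> M" for x s
    using Mscale[OF that, of "-1"] by simp
  have M0: "(0,0) \<in> M" using subspace_0[OF sub] by (simp add: zero_prod_def)
  have p0: "p 0 = 0" using hom[of 0 0] by simp
  have uniq: "s = t" if "(x,s) \<in> M" "(x,t) \<in> M" for x s t
  proof -
    have "(0, s - t) \<in> M" "(0, t - s) \<in> M"
      using Madd[OF that(1) Mneg[OF that(2)]] Madd[OF that(2) Mneg[OF that(1)]] by auto
    from this[THEN Mp] p0 show ?thesis by simp
  qed
  have tot: "\<exists>t. (x0,t) \<in> M" for x0
  proof (rule ccontr)
    assume no: "\<not> (\<exists>t. (x0,t) \<in> M)"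
    \<comment> \<open>The value at \<open>x0\<close> may be any number between the lower bounds in
      \<open>L\<close> and the upper bounds in \<open>key\<close>; the supremum of \<open>L\<close>
      is one.\<close>
    define L where "L = {s - p (y - x0) | y s. (y,s) \<in> M}"
    define a where "a = Sup L"
    have key: "s - p (y - x0) \<le> p (x + x0) - t" if "(x,t) \<in> M" "(y,s) \<in> M" for x y s t
      using Mp[OF Madd[OF that]] tri[of "x + x0" "y - x0"] by simp
    have bdd: "bdd_above L"
      unfolding bdd_above_def L_def using key[OF M0] by blast
    have lo: "s - p (y - x0) \<le> a" if "(y,s) \<in> M" for y s
      unfolding a_def by (rule cSup_upper[OF _ bdd]) (use that in \<open>auto simp: L_def\<close>)
    have hi: "a \<le> p (x + x0) - t" if "(x,t) \<in> M" for x t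
      unfolding a_def by (rule cSup_least) (use that key M0 in \<open>auto simp: L_def\<close>)
    define M' where "M' = span (insert (x0,a) M)"
    have M': "(x,t) \<in> M' \<longleftrightarrow> (\<exists>c. (x - c *\<^sub>R x0, t - c * a) \<in> M)" for x t
      unfolding M'_def span_insert by (auto simp: span_eq_iff[THEN iffD2, OF sub])
    \<comment> \<open>By homogeneity only the coefficients 1 and -1 of \<open>x0\<close> matter, and
      these are \<open>hi\<close> and \<open>lo\<close>.\<close>
    have bound: "t + c * a \<le> p (x + c *\<^sub>R x0)" if "(x,t) \<in> M" for x t c
    proof -
      consider "c = 0" | "c > 0" | "c < 0" by linarith
      then show ?thesis
      proof cases
        case 1 then show ?thesis using Mp[OF that] by simp
      next
        case 2
        have "a \<le> p ((1/c) *\<^sub>R x + x0) - (1/c) * t"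
          by (rule hi[OF Mscale[OF that]])
        then have "c * a \<le> c * (p ((1/c) *\<^sub>R x + x0) - (1/c) * t)"
          using 2 by (simp add: mult_left_mono)
        also have "\<dots> = p (c *\<^sub>R ((1/c) *\<^sub>R x + x0)) - t"
          unfolding hom using 2 by (simp add: right_diff_distrib)
        finally show ?thesis using 2 by (simp add: scaleR_add_right)
      next
        case 3
        define d where "d = - c"
        have d: "d > 0" "c = - d" using 3 by (auto simp: d_def)
        have "(1/d) * t - p ((1/d) *\<^sub>R x - x0) \<le> a"
          by (rule lo[OF Mscale[OF that]])
        then have "d * ((1/d) * t - p ((1/d) *\<^sub>R x - x0)) \<le> d * a"
          using d by (intro mult_left_mono) auto
        also have "d * ((1/d) * t - p ((1/d) *\<^sub>R x - x0)) = t - p (d *\<^sub>R ((1/d) *\<^sub>R x - x0))"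
          unfolding hom using d by (simp add: right_diff_distrib)
        also have "d *\<^sub>R ((1/d) *\<^sub>R x - x0) = x + c *\<^sub>R x0"
          using d by (simp add: scaleR_diff_right)
        finally show ?thesis using d by simp
      qed
    qed
    have "M' \<in> A"
      unfolding A_def
    proof (safe)
      show "subspace M'" by (simp add: M'_def)
      show "(x, f x) \<in> M'" if "x \<in> V" for x
        using gr that by (auto simp: M'_def intro: span_base)
      fix x t assume "(x,t) \<in> M'"
      then obtain c where "(x - c *\<^sub>R x0, t - c * a) \<in> M" by (auto simp: M')
      from bound[OF this, of c] show "t \<le> p x" by simp
    qed
    moreover have "M \<subseteq> M'" unfolding M'_def by (auto intro: span_base)
    ultimately have "M' = M" by (rule max)
    moreover have "(x0, a) \<in> M'" unfolding M'_def by (auto intro: span_base)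
    ultimately show False using no by auto
  qed
  define g where "g x = (THE t. (x,t) \<in> M)" for x
  have g: "(x, g x) \<in> M" for x
    unfolding g_def by (rule theI') (use tot uniq in blast)
  have geq: "g x = t" if "(x,t) \<in> M" for x t
    using uniq[OF g that] .
  have "linear g"
    by (rule linearI) (auto intro!: geq Madd Mscale g)
  moreover have "\<forall>x\<in>V. g x = f x" using gr by (auto intro!: geq)
  moreover have "\<forall>x. g x \<le> p x" using Mp[OF g] by auto
  ultimately show ?thesis by blast
qed

text \<open>The claim is relative to \<open>V\<close> so that the induction on \<open>k\<close> can
  pass to the kernel of the last functional in \<open>V\<close>, a subspace of codimension at most
  one.\<close>

lemma vanish_on_kernel_imp_span:
  fixes \<phi> :: "nat \<Rightarrow> ('a::real_normed_vector \<Rightarrow>\<^sub>L real)"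
  assumes "subspace V" and "\<And>v. v \<in> V \<Longrightarrow> (\<And>i. i < k \<Longrightarrow> blinfun_apply (\<phi> i) v = 0) \<Longrightarrow> blinfun_apply g v = 0"
  shows "\<exists>p \<in> span (\<phi> ` {..<k}). \<forall>v\<in>V. blinfun_apply g v = blinfun_apply p v"
  using assms
proof (induction k arbitrary: V)
  case 0
  then show ?case by (intro bexI[of _ 0]) auto
next
  case (Suc k)
  define V' where "V' = V \<inter> {v. blinfun_apply (\<phi> k) v = 0}"
  have V': "subspace V'"
    using Suc.prems(1) by (auto simp: V'_def subspace_def blinfun.add_right blinfun.scaleR_right)
  obtain p where p: "p \<in> span (\<phi> ` {..<k})" and pg: "\<And>v. v \<in> V' \<Longrightarrow> blinfun_apply g v = blinfun_apply p v"
    using Suc.IH[OF V'] Suc.prems(2) by (auto simp: V'_def less_Suc_eq)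
  have mono: "span (\<phi> ` {..<k}) \<subseteq> span (\<phi> ` {..<Suc k})" by (intro span_mono) auto
  show ?case
  proof (cases "\<forall>v\<in>V. blinfun_apply (\<phi> k) v = 0")
    case True
    then have "V' = V" by (auto simp: V'_def)
    then show ?thesis using p pg mono by blast
  next
    case False
    then obtain w where w: "w \<in> V" "blinfun_apply (\<phi> k) w \<noteq> 0" by auto
    \<comment> \<open>With this \<open>c\<close> both sides also agree at \<open>w\<close>, and
      \<open>w\<close> together with \<open>V'\<close> spans \<open>V\<close>.\<close>
    define c where "c = (blinfun_apply g w - blinfun_apply p w) / blinfun_apply (\<phi> k) w"
    show ?thesis
    proof (intro bexI ballI)
      show "p + c *\<^sub>R \<phi> k \<in> span (\<phi> ` {..<Suc k})"
        using p mono by (intro span_add span_scale) (auto intro: span_base)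
      fix v assume v: "v \<in> V"
      define t where "t = blinfun_apply (\<phi> k) v / blinfun_apply (\<phi> k) w"
      have "v - t *\<^sub>R w \<in> V'"
        using v w Suc.prems(1) by (auto simp: V'_def t_def blinfun.diff_right blinfun.scaleR_right intro!: subspace_diff subspace_scale)
      from pg[OF this] have "blinfun_apply g v - blinfun_apply p v = t * (blinfun_apply g w - blinfun_apply p w)"
        by (simp add: blinfun.diff_right blinfun.scaleR_right algebra_simps)
      also have "\<dots> = c * blinfun_apply (\<phi> k) v" using w by (simp add: t_def c_def)
      finally show "blinfun_apply g v = blinfun_apply (p + c *\<^sub>R \<phi> k) v"
        by (simp add: blinfun.add_left blinfun.scaleR_left)
    qed
  qed
qed

text \<open>Induction on the generators: a new generator has positive distance from the old span,
  which bounds its coefficients, so coefficients and remainders are bounded separately.\<close>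

lemma span_finite_bounded_seq:
  fixes S :: "'a::real_normed_vector set"
  assumes "finite S" and "\<And>n. x n \<in> span S" and "\<And>n. norm (x n) \<le> B"
  shows "\<exists>l\<in>span S. \<exists>r. strict_mono (r::nat\<Rightarrow>nat) \<and> (x \<circ> r) \<longlonglongrightarrow> l"
  using assms
proof (induction S arbitrary: x B rule: finite_induct)
  case empty
  then show ?case by (auto simp: o_def intro!: exI[of _ id] strict_mono_id)
next
  case (insert a S)
  show ?case
  proof (cases "a \<in> span S")
    case True
    then have "span (insert a S) = span S" by (rule span_redundant)
    then show ?thesis using insert.IH[of x B] insert.prems by simp
  next
    case False
    \<comment> \<open>The induction hypothesis also shows that \<open>span S\<close> is
      closed.\<close>
    have cl: "a \<notin> closure (span S)"
    proof
      assume "a \<in> closure (span S)"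
      then obtain y where y: "\<And>n. y n \<in> span S" "y \<longlonglongrightarrow> a" by (auto simp: closure_sequential)
      then obtain B' where B': "\<And>n. norm (y n) \<le> B'" using convergent_imp_Bseq[of y] by (auto simp: convergent_def Bseq_def)
      obtain l r where "l \<in> span S" "strict_mono (r::nat\<Rightarrow>nat)" "(y \<circ> r) \<longlonglongrightarrow> l"
        using insert.IH[of y B', OF y(1) B'] by blast
      moreover have "(y \<circ> r) \<longlonglongrightarrow> a" using y(2) \<open>strict_mono r\<close> LIMSEQ_subseq_LIMSEQ by blast
      ultimately show False using False LIMSEQ_unique by blast
    qed
    define d where "d = infdist a (span S)"
    have ne: "span S \<noteq> {}" using span_zero by blast
    have d: "d > 0" unfolding d_def
      using cl in_closure_iff_infdist_zero[OF ne] infdist_nonneg[of a "span S"] by (metis less_eq_real_def)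
    have lower: "\<bar>c\<bar> * d \<le> norm (c *\<^sub>R a + v)" if "v \<in> span S" for c v
    proof (cases "c = 0")
      case False
      have "d \<le> dist a (- (1/c) *\<^sub>R v)" unfolding d_def
        by (rule infdist_le) (use that in \<open>auto intro: span_scale span_neg\<close>)
      also have "\<dots> = norm (a + (1/c) *\<^sub>R v)" by (simp add: dist_norm)
      finally have "\<bar>c\<bar> * d \<le> \<bar>c\<bar> * norm (a + (1/c) *\<^sub>R v)" by (simp add: mult_left_mono)
      also have "\<dots> = norm (c *\<^sub>R (a + (1/c) *\<^sub>R v))" by simp
      finally show ?thesis using False by (simp add: scaleR_add_right)
    qed simp
    have "\<forall>n. \<exists>c. x n - c *\<^sub>R a \<in> span S"
      using insert.prems(1) by (simp add: span_insert)
    then obtain c where c: "\<And>n. x n - c n *\<^sub>R a \<in> span S" by metis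
    have cb: "\<bar>c n\<bar> \<le> B / d" for n
    proof -
      have "\<bar>c n\<bar> * d \<le> norm (x n)" using lower[OF c, of "c n" n] by simp
      then show ?thesis using insert.prems(2)[of n] d by (simp add: field_simps)
    qed
    then have "bounded (range c)" by (auto simp: bounded_iff)
    then obtain l r where r: "strict_mono (r::nat\<Rightarrow>nat)" "(c \<circ> r) \<longlonglongrightarrow> l"
      using bounded_imp_convergent_subsequence by blast
    define y where "y n = x (r n) - c (r n) *\<^sub>R a" for n
    have "norm (y n) \<le> B + B / d * norm a" for n
    proof -
      have "norm (y n) \<le> norm (x (r n)) + norm (c (r n) *\<^sub>R a)" unfolding y_def by (rule norm_triangle_ineq4)
      also have "\<dots> \<le> B + B / d * norm a"
        using add_mono[OF insert.prems(2)[of "r n"] mult_right_mono[OF cb[of "r n"] norm_ge_zero[of a]]] by simp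
      finally show ?thesis .
    qed
    moreover have "y n \<in> span S" for n using c by (simp add: y_def)
    ultimately obtain l' r' where r': "l' \<in> span S" "strict_mono (r'::nat\<Rightarrow>nat)" "(y \<circ> r') \<longlonglongrightarrow> l'"
      using insert.IH[of y] by blast
    have "(\<lambda>n. (c \<circ> r \<circ> r') n *\<^sub>R a + (y \<circ> r') n) \<longlonglongrightarrow> l *\<^sub>R a + l'"
      using LIMSEQ_subseq_LIMSEQ[OF r(2) r'(2)] r'(3) by (intro tendsto_intros)
    moreover have "(\<lambda>n. (c \<circ> r \<circ> r') n *\<^sub>R a + (y \<circ> r') n) = x \<circ> (r \<circ> r')"
      by (auto simp: y_def)
    moreover have "l *\<^sub>R a + l' \<in> span (insert a S)"
      using r'(1) by (auto simp: span_insert intro: exI[of _ l])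
    ultimately show ?thesis using strict_mono_o[OF r(1) r'(2)] by metis
  qed
qed

section \<open>The Nash-Williams partition theorem\<close>

text \<open>A fusion argument. \<open>s\<close> is a stem, and by \<open>her\<close> the property
  \<open>Q s N\<close> depends only on the part of \<open>N\<close> beyond \<open>s\<close> and
  passes to smaller sets. So elements can be fixed one at a time, shrinking the reservoir each time
  for the finitely many stems available.\<close>

lemma diagonal_infinite_subset:
  fixes Q :: "nat set \<Rightarrow> nat set \<Rightarrow> bool"
  assumes ex: "\<And>s M. finite s \<Longrightarrow> infinite M \<Longrightarrow> M \<subseteq> A \<Longrightarrow> \<exists>N\<subseteq>M. infinite N \<and> Q s N"
    and her: "\<And>s M N. finite s \<Longrightarrow> Q s M \<Longrightarrow> N \<subseteq> A \<Longrightarrow> infinite N \<Longrightarrow> {n\<in>N. \<forall>m\<in>s. m < n} \<subseteq> M \<Longrightarrow> Q s N"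
    and A: "infinite A"
  shows "\<exists>N\<subseteq>A. infinite N \<and> (\<forall>s. finite s \<longrightarrow> s \<subseteq> N \<longrightarrow> Q s N)"
proof -
  have ex_fam: "\<exists>N\<subseteq>M. infinite N \<and> (\<forall>s\<in>F. Q s N)"
    if "finite F" "\<forall>s\<in>F. finite s" "infinite M" "M \<subseteq> A" for F M
    using that
  proof (induction F rule: finite_induct)
    case empty then show ?case by auto
  next
    case (insert s F)
    then obtain N where N: "N \<subseteq> M" "infinite N" "\<forall>s\<in>F. Q s N" by auto
    obtain N' where N': "N' \<subseteq> N" "infinite N'" "Q s N'"
      using ex[of s N] N insert.prems by auto
    have "Q t N'" if "t \<in> F" for t
      by (rule her[of t N]) (use that N N' insert.prems in auto)
    then show ?case using N N' by (intro exI[of _ N']) auto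
  qed
  define good where "good F M N \<longleftrightarrow> N \<subseteq> M \<and> infinite N \<and> (\<forall>s. s \<subseteq> F \<longrightarrow> Q s N)" for F M N
  have ex_good: "\<exists>N. good F M N" if "finite F" "infinite M" "M \<subseteq> A" for F M
  proof -
    have "\<forall>s\<in>Pow F. finite s" using that by (auto intro: finite_subset)
    then show ?thesis using ex_fam[of "Pow F" M] that by (auto simp: good_def)
  qed
  \<comment> \<open>A state consists of the elements already fixed and an infinite reservoir for the
    others.\<close>
  define step where "step p = (let M = snd p; n = (LEAST n. n \<in> M); F = insert n (fst p)
      in (F, SOME N. good F {k\<in>M. n < k} N))" for p :: "nat set \<times> nat set"
  obtain M0 where M0: "good {} A M0" using ex_good[of "{}" A] A by auto
  define p where "p i = (step ^^ i) ({}, M0)" for i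
  define F where "F i = fst (p i)" for i
  define M where "M i = snd (p i)" for i
  define e where "e i = (LEAST n. n \<in> M i)" for i
  have F0: "F 0 = {}" and M00: "M 0 = M0" by (auto simp: F_def M_def p_def)
  have FS: "F (Suc i) = insert (e i) (F i)" for i
    by (simp add: F_def p_def step_def Let_def e_def M_def)
  have MS: "M (Suc i) = (SOME N. good (F (Suc i)) {k\<in>M i. e i < k} N)" for i
    by (simp add: F_def p_def step_def Let_def e_def M_def)
  have finF: "finite (F i)" for i by (induction i) (auto simp: F0 FS)
  have gS: "good (F (Suc i)) {k\<in>M i. e i < k} (M (Suc i))" if "infinite (M i)" "M i \<subseteq> A" for i
  proof -
    have "infinite (M i - {..e i})" using that by auto
    also have "M i - {..e i} = {k\<in>M i. e i < k}" by auto
    finally show ?thesis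
      unfolding MS using that by (intro someI_ex[OF ex_good] finF) auto
  qed
  have infM: "infinite (M i) \<and> M i \<subseteq> A" for i
  proof (induction i)
    case 0 then show ?case using M0 by (auto simp: M00 good_def)
  next
    case (Suc i)
    then show ?case using gS[of i] by (auto simp: good_def)
  qed
  note gS = gS[OF conjunct1[OF infM] conjunct2[OF infM]]
  have gQ: "s \<subseteq> F i \<Longrightarrow> Q s (M i)" for i s
    using gS M0 by (cases i) (auto simp: good_def F0 M00)
  have eM: "e i \<in> M i" for i
    unfolding e_def using infM[of i] by (metis LeastI_ex finite.emptyI ex_in_conv)
  have Msub: "M (Suc i) \<subseteq> {k\<in>M i. e i < k}" for i using gS[of i] by (auto simp: good_def)
  have Mdec: "i \<le> j \<Longrightarrow> M j \<subseteq> M i" for i j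
    by (rule lift_Suc_antimono_le[of M]) (use Msub in auto)
  have "e i < e (Suc i)" for i using eM[of "Suc i"] Msub[of i] by auto
  then have sm: "strict_mono e" by (simp add: strict_mono_Suc_iff)
  have Fe: "F i = e ` {..<i}" for i by (induction i) (auto simp: F0 FS lessThan_Suc)
  show ?thesis
  proof (intro exI conjI allI impI)
    show "range e \<subseteq> A" using eM infM by auto
    show inf: "infinite (range e)" using sm by (simp add: range_inj_infinite strict_mono_imp_inj_on)
    fix s assume s: "finite s" "s \<subseteq> range e"
    obtain I where I: "finite I" "s = e ` I" using finite_subset_image[OF s] by auto
    \<comment> \<open>Since \<open>i - 1\<close> lies in \<open>I\<close> unless
      \<open>i = 0\<close>, an element of \<open>range e\<close> beyond \<open>s\<close> has index
      at least \<open>i\<close> and so lies in the reservoir \<open>M i\<close>.\<close>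
    obtain i where i: "I \<subseteq> {..<i}" "i = 0 \<or> i - 1 \<in> I"
    proof (cases "I = {}")
      case True then show ?thesis using that[of 0] by auto
    next
      case False
      have "I \<subseteq> {..<Suc (Max I)}" using Max_ge[OF I(1)] by (auto simp: less_Suc_eq_le)
      then show ?thesis using that[of "Suc (Max I)"] Max_in[OF I(1) False] by auto
    qed
    show "Q s (range e)"
    proof (rule her[of s "M i"])
      show "Q s (M i)" by (rule gQ) (use I i in \<open>auto simp: Fe\<close>)
      show "{n \<in> range e. \<forall>m\<in>s. m < n} \<subseteq> M i"
      proof
        fix n assume "n \<in> {n \<in> range e. \<forall>m\<in>s. m < n}"
        then obtain j where j: "n = e j" "\<forall>m\<in>s. m < e j" by auto
        have "i \<le> j"
          using i(2) j I sm by (cases "i = 0") (auto simp: strict_mono_less)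
        then show "n \<in> M i" using eM[of j] Mdec j by auto
      qed
    qed (use s inf \<open>range e \<subseteq> A\<close> in auto)
  qed
qed

text \<open>\<open>H\<close> encodes the open family of those infinite sets that have an initial segment in \<open>H\<close>.\<close>

lemma ramsey_open:
  fixes H :: "nat set set"
  assumes A: "infinite A"
  shows "\<exists>M\<subseteq>A. infinite M \<and>
    ((\<forall>N\<subseteq>M. infinite N \<longrightarrow> (\<exists>k. N \<inter> {..<k} \<in> H)) \<or> (\<forall>s. finite s \<longrightarrow> s \<subseteq> M \<longrightarrow> s \<notin> H))"
proof -
  define hit where "hit P \<longleftrightarrow> (\<exists>k. P \<inter> {..<k} \<in> H)" for P
  \<comment> \<open>Acceptance and rejection in the sense of Galvin and Prikry. After thinning out,
    every stem is decided, and the two alternatives of the theorem correspond to acceptance and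
    rejection of the empty stem.\<close>
  define acc where "acc M s \<longleftrightarrow> (\<forall>N\<subseteq>M. infinite N \<longrightarrow> (\<forall>n\<in>N. \<forall>m\<in>s. m < n) \<longrightarrow> hit (s \<union> N))" for M s
  define rej where "rej M s \<longleftrightarrow> (\<forall>N\<subseteq>M. infinite N \<longrightarrow> \<not> acc N s)" for M s
  have acc_tail: "acc N s" if "acc M s" "{n\<in>N. \<forall>m\<in>s. m < n} \<subseteq> M" for M N s
    unfolding acc_def
  proof (intro allI impI)
    fix P assume P: "P \<subseteq> N" "infinite P" "\<forall>n\<in>P. \<forall>m\<in>s. m < n"
    then have "P \<subseteq> M" using that(2) by blast
    then show "hit (s \<union> P)" using that(1) P unfolding acc_def by blast
  qed
  have tail_inf: "infinite {n\<in>N. \<forall>m\<in>s. m < n}" if "infinite N" "finite s" for N s :: "nat set"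
  proof -
    have "infinite (N - (\<Union>m\<in>s. {..m}))" using that by (intro Diff_infinite_finite) auto
    also have "N - (\<Union>m\<in>s. {..m}) = {n\<in>N. \<forall>m\<in>s. m < n}" by auto
    finally show ?thesis .
  qed
  have rej_tail: "rej N s" if r: "rej M s" "{n\<in>N. \<forall>m\<in>s. m < n} \<subseteq> M" "finite s" for M N s
    unfolding rej_def
  proof (intro allI impI notI)
    fix P assume P: "P \<subseteq> N" "infinite P" "acc P s"
    let ?P = "{n\<in>P. \<forall>m\<in>s. m < n}"
    have "acc ?P s" by (rule acc_tail[OF P(3)]) auto
    moreover have "infinite ?P" using tail_inf P r by blast
    moreover have "?P \<subseteq> M" using P r by auto
    ultimately show False using r(1) unfolding rej_def by blast
  qed
  have "\<exists>M\<subseteq>A. infinite M \<and> (\<forall>s. finite s \<longrightarrow> s \<subseteq> M \<longrightarrow> acc M s \<or> rej M s)"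
  proof (rule diagonal_infinite_subset[OF _ _ A])
    fix s M :: "nat set" assume "finite s" "infinite M" "M \<subseteq> A"
    then show "\<exists>N\<subseteq>M. infinite N \<and> (acc N s \<or> rej N s)"
      by (cases "rej M s") (auto simp: rej_def)
  next
    fix s M N :: "nat set"
    assume "finite s" "acc M s \<or> rej M s" "{n\<in>N. \<forall>m\<in>s. m < n} \<subseteq> M"
    then show "acc N s \<or> rej N s" using acc_tail rej_tail by blast
  qed
  then obtain M where M: "M \<subseteq> A" "infinite M" and dec: "\<And>s. finite s \<Longrightarrow> s \<subseteq> M \<Longrightarrow> acc M s \<or> rej M s"
    by blast
  show ?thesis
  proof (cases "acc M {}")
    case True
    then show ?thesis using M by (intro exI[of _ M]) (auto simp: acc_def hit_def)
  next
    case False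
    then have rej0: "rej M {}" using dec[of "{}"] by auto
    \<comment> \<open>An infinite set of such \<open>n\<close> would itself accept \<open>s\<close>:
      split the least element off any infinite subset.\<close>
    have fin: "finite {n\<in>M. (\<forall>m\<in>s. m < n) \<and> acc M (insert n s)}" if s: "rej M s" "finite s" for s
    proof (rule ccontr)
      let ?N = "{n\<in>M. (\<forall>m\<in>s. m < n) \<and> acc M (insert n s)}"
      assume inf: "infinite ?N"
      have "acc ?N s"
      proof (rule acc_def[THEN iffD2], intro allI impI)
        fix P assume P: "P \<subseteq> ?N" "infinite P" "\<forall>n\<in>P. \<forall>m\<in>s. m < n"
        define n where "n = (LEAST n. n \<in> P)"
        have n: "n \<in> P" "\<And>k. k \<in> P \<Longrightarrow> n \<le> k"
          unfolding n_def using P(2) by (metis LeastI_ex finite.emptyI ex_in_conv, metis Least_le)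
        have "acc M (insert n s)" using n P by auto
        moreover have "P - {n} \<subseteq> M" "infinite (P - {n})" using P by auto
        moreover have "\<forall>k\<in>P - {n}. \<forall>m\<in>insert n s. m < k"
          using P(3) n by (auto simp: le_neq_implies_less)
        ultimately have "hit (insert n s \<union> (P - {n}))" unfolding acc_def by blast
        also have "insert n s \<union> (P - {n}) = s \<union> P" using n by auto
        finally show "hit (s \<union> P)" .
      qed
      then show False using s inf unfolding rej_def by auto
    qed
    define Q where "Q s N \<longleftrightarrow> (rej M s \<longrightarrow> (\<forall>n\<in>N. (\<forall>m\<in>s. m < n) \<longrightarrow> \<not> acc M (insert n s)))" for s N
    have "\<exists>N\<subseteq>M. infinite N \<and> (\<forall>s. finite s \<longrightarrow> s \<subseteq> N \<longrightarrow> Q s N)"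
    proof (rule diagonal_infinite_subset[where Q = Q, OF _ _ M(2)])
      fix s K :: "nat set" assume s: "finite s" "infinite K" "K \<subseteq> M"
      show "\<exists>N\<subseteq>K. infinite N \<and> Q s N"
      proof (cases "rej M s")
        case True
        have "infinite (K - {n\<in>M. (\<forall>m\<in>s. m < n) \<and> acc M (insert n s)})"
          using fin[OF True] s by (intro Diff_infinite_finite) auto
        moreover have "Q s (K - {n\<in>M. (\<forall>m\<in>s. m < n) \<and> acc M (insert n s)})"
          using s by (auto simp: Q_def)
        ultimately show ?thesis by (meson Diff_subset)
      next
        case False
        then show ?thesis using s by (auto simp: Q_def)
      qed
    next
      fix s K N :: "nat set"
      assume "Q s K" "{n\<in>N. \<forall>m\<in>s. m < n} \<subseteq> K"
      then show "Q s N" unfolding Q_def by blast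
    qed
    then obtain N where N: "N \<subseteq> M" "infinite N"
      and NQ0: "\<forall>s. finite s \<longrightarrow> s \<subseteq> N \<longrightarrow> Q s N" by blast
    have NQ: "\<not> acc M (insert n s)"
      if "finite s" "s \<subseteq> N" "rej M s" "n \<in> N" "\<forall>m\<in>s. m < n" for s n
      using NQ0[rule_format, OF that(1,2)] that(3-5) unfolding Q_def by blast
    have allrej: "s \<subseteq> N \<Longrightarrow> rej M s" if "finite s" for s
      using that
    proof (induction s rule: finite_linorder_max_induct)
      case empty then show ?case using rej0 by simp
    next
      case (insert b s)
      then have "\<not> acc M (insert b s)" using NQ[of s b] by auto
      then show ?case using dec[of "insert b s"] insert N by auto
    qed
    have "s \<notin> H" if s: "finite s" "s \<subseteq> N" for s
    proof
      assume H: "s \<in> H"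
      \<comment> \<open>A stem in \<open>H\<close> is an initial segment of all its continuations,
        so it is accepted, contrary to its rejection.\<close>
      have "acc M s"
        unfolding acc_def
      proof (intro allI impI)
        fix P assume P: "P \<subseteq> M" "infinite P" "\<forall>n\<in>P. \<forall>m\<in>s. m < n"
        have "\<exists>k. (s \<union> P) \<inter> {..<k} = s"
        proof (cases "s = {}")
          case True then show ?thesis by (intro exI[of _ 0]) auto
        next
          case False
          have "x \<in> s" if "x \<in> P" "x \<le> Max s" for x
            using P(3) that Max_in[OF s(1) False] by (meson linorder_not_le)
          then have "(s \<union> P) \<inter> {..<Suc (Max s)} = s"
            using Max_ge[OF s(1)] by (auto simp: less_Suc_eq_le)
          then show ?thesis by blast
        qed
        then show "hit (s \<union> P)" using H unfolding hit_def by metis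
      qed
      then show False using allrej[OF s] M by (auto simp: rej_def)
    qed
    then show ?thesis using N M by (intro exI[of _ N]) auto
  qed
qed

text \<open>There is a limit point \<open>l\<close>, and infinitely many terms stay at distance
  \<open>e\<close> from it; the two levels are put in between. Rational levels leave countably many
  pairs for the diagonal argument in \<open>oscillating_infinite_set\<close>.\<close>

lemma nonconvergent_oscillates:
  fixes X :: "nat \<Rightarrow> real"
  assumes b: "\<And>n. \<bar>X n\<bar> \<le> B" and nc: "\<not> convergent X"
  shows "\<exists>a\<in>\<rat>. \<exists>b\<in>\<rat>. a < b \<and> infinite {n. X n < a} \<and> infinite {n. b < X n}"
proof -
  have "bounded (range X)" using b by (auto simp: bounded_iff)
  then obtain l r where r: "strict_mono (r::nat\<Rightarrow>nat)" "(X \<circ> r) \<longlonglongrightarrow> l"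
    using bounded_imp_convergent_subsequence by blast
  have near: "infinite {n. \<bar>X n - l\<bar> < e}" if "e > 0" for e
  proof -
    have "\<forall>\<^sub>F n in sequentially. \<bar>(X \<circ> r) n - l\<bar> < e"
      using tendstoD[OF r(2) that] by (simp add: dist_real_def)
    then obtain n0 where "\<And>n. n \<ge> n0 \<Longrightarrow> \<bar>X (r n) - l\<bar> < e" by (auto simp: eventually_sequentially)
    then have "r ` {n0..} \<subseteq> {n. \<bar>X n - l\<bar> < e}" by auto
    moreover have "infinite (r ` {n0..})"
      using strict_mono_imp_inj_on[OF r(1)] by (subst finite_image_iff) (auto simp: inj_on_subset infinite_Ici)
    ultimately show ?thesis using finite_subset by blast
  qed
  have "\<not> X \<longlonglongrightarrow> l" using nc by (auto simp: convergent_def)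
  then obtain e where e: "e > 0" "\<not> (\<forall>\<^sub>F n in sequentially. dist (X n) l < e)"
    by (auto simp: tendsto_iff)
  then have inf: "infinite {n. \<not> \<bar>X n - l\<bar> < e}"
    by (simp add: dist_real_def cofinite_eq_sequentially[symmetric] eventually_cofinite)
  have "{n. \<not> \<bar>X n - l\<bar> < e} = {n. l + e \<le> X n} \<union> {n. X n \<le> l - e}" by auto
  then consider "infinite {n. l + e \<le> X n}" | "infinite {n. X n \<le> l - e}" using inf by auto
  then show ?thesis
  proof cases
    case 1
    obtain a where a: "a \<in> \<rat>" "l < a" "a < l + e" using Rats_dense_in_real[of l "l+e"] e by auto
    obtain b where b: "b \<in> \<rat>" "a < b" "b < l + e" using Rats_dense_in_real[of a "l+e"] a by auto
    have "infinite {n. X n < a}"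
      by (rule infinite_super[OF _ near[of "a - l"]]) (use a in auto)
    moreover have "infinite {n. b < X n}"
      by (rule infinite_super[OF _ 1]) (use b in auto)
    ultimately show ?thesis using a b by blast
  next
    case 2
    obtain b where b: "b \<in> \<rat>" "l - e < b" "b < l" using Rats_dense_in_real[of "l-e" l] e by auto
    obtain a where a: "a \<in> \<rat>" "l - e < a" "a < b" using Rats_dense_in_real[of "l-e" b] b by auto
    have "infinite {n. b < X n}"
      by (rule infinite_super[OF _ near[of "l - b"]]) (use b in auto)
    moreover have "infinite {n. X n < a}"
      by (rule infinite_super[OF _ 2]) (use a in auto)
    ultimately show ?thesis using a b by blast
  qed
qed

section \<open>Rosenthal's theorem\<close>

text \<open>Otherwise oscillation across any given pair of rational levels can be removed by
  thinning out, and a diagonal set removes it for all pairs at once; along that set every \<phi>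
  would converge.\<close>

lemma oscillating_infinite_set:
  fixes X :: "'k \<Rightarrow> nat \<Rightarrow> real"
  assumes bd: "\<And>\<phi> n. \<phi> \<in> K \<Longrightarrow> \<bar>X \<phi> n\<bar> \<le> B"
    and nc: "\<And>r. strict_mono (r :: nat \<Rightarrow> nat) \<Longrightarrow> \<exists>\<phi>\<in>K. \<not> convergent (\<lambda>n. X \<phi> (r n))"
  shows "\<exists>a b M. a < b \<and> infinite M \<and>
    (\<forall>N\<subseteq>M. infinite N \<longrightarrow> (\<exists>\<phi>\<in>K. infinite {n\<in>N. X \<phi> n < a} \<and> infinite {n\<in>N. b < X \<phi> n}))"
proof (rule ccontr)
  assume neg: "\<not> ?thesis"
  define osc where "osc a b N \<longleftrightarrow> (\<exists>\<phi>\<in>K. infinite {n\<in>N. X \<phi> n < a} \<and> infinite {n\<in>N. b < X \<phi> n})" for a b N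
  have ex: "\<exists>N\<subseteq>M. infinite N \<and> \<not> osc a b N" if "a < b" "infinite M" for a b M
    using neg that unfolding osc_def by blast
  have osc_mono: "osc a b N" if o: "osc a b M" and "M \<subseteq> N" for a b M N
  proof -
    obtain \<phi> where "\<phi> \<in> K" and i: "infinite {n\<in>M. X \<phi> n < a}" "infinite {n\<in>M. b < X \<phi> n}"
      using o unfolding osc_def by blast
    moreover have "infinite {n\<in>N. X \<phi> n < a}" by (rule infinite_super[OF _ i(1)]) (use that in auto)
    moreover have "infinite {n\<in>N. b < X \<phi> n}" by (rule infinite_super[OF _ i(2)]) (use that in auto)
    ultimately show ?thesis unfolding osc_def by blast
  qed
  define q where "q = from_nat_into (\<rat> \<times> \<rat> :: (real \<times> real) set)"
  have q: "\<exists>i. q i = (a, b)" if "a \<in> \<rat>" "b \<in> \<rat>" for a b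
    unfolding q_def using that by (intro from_nat_into_surj) (auto intro: countable_rat)
  \<comment> \<open>The stem serves only as a counter: its cardinality selects the pair of
    levels.\<close>
  define Q where "Q s N \<longleftrightarrow> (fst (q (card s)) < snd (q (card s)) \<longrightarrow>
      \<not> osc (fst (q (card s))) (snd (q (card s))) {n\<in>N. \<forall>m\<in>s. m < n})" for s N
  have "\<exists>N\<subseteq>UNIV. infinite N \<and> (\<forall>s. finite s \<longrightarrow> s \<subseteq> N \<longrightarrow> Q s N)"
  proof (rule diagonal_infinite_subset[where Q = Q])
    fix s M :: "nat set" assume "finite s" "infinite M"
    show "\<exists>N\<subseteq>M. infinite N \<and> Q s N"
    proof (cases "fst (q (card s)) < snd (q (card s))")
      case True
      obtain N where N: "N \<subseteq> M" "infinite N" "\<not> osc (fst (q (card s))) (snd (q (card s))) N"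
        using ex[OF True \<open>infinite M\<close>] by blast
      then have "Q s N" unfolding Q_def using osc_mono by blast
      then show ?thesis using N by blast
    next
      case False
      then show ?thesis using \<open>infinite M\<close> by (auto simp: Q_def)
    qed
  next
    fix s M N :: "nat set"
    assume "Q s M" "{n\<in>N. \<forall>m\<in>s. m < n} \<subseteq> M"
    then show "Q s N" unfolding Q_def
      using osc_mono[of _ _ "{n\<in>N. \<forall>m\<in>s. m < n}" "{n\<in>M. \<forall>m\<in>s. m < n}"] by blast
  qed simp
  then obtain N where N: "infinite N" and QN: "\<forall>s. finite s \<longrightarrow> s \<subseteq> N \<longrightarrow> Q s N" by blast
  define r where "r = enumerate N"
  have r: "strict_mono r" unfolding r_def using N by (simp add: strict_mono_enumerate)
  have rN: "r n \<in> N" for n unfolding r_def using N by (rule enumerate_in_set)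
  obtain \<phi> where \<phi>: "\<phi> \<in> K" "\<not> convergent (\<lambda>n. X \<phi> (r n))" using nc[OF r] by blast
  obtain a b where ab: "a \<in> \<rat>" "b \<in> \<rat>" "a < b" "infinite {n. X \<phi> (r n) < a}" "infinite {n. b < X \<phi> (r n)}"
    using nonconvergent_oscillates[of "\<lambda>n. X \<phi> (r n)" B] bd \<phi> by blast
  obtain i where i: "q i = (a, b)" using q ab by blast
  define s where "s = r ` {..<i}"
  have s: "finite s" "s \<subseteq> N" "card s = i"
    using rN strict_mono_imp_inj_on[OF r] by (auto simp: s_def card_image)
  have no: "\<not> osc a b {n\<in>N. \<forall>m\<in>s. m < n}"
    using QN s i ab by (auto simp: Q_def)
  have tr: "infinite {n \<in> {n\<in>N. \<forall>m\<in>s. m < n}. P n}" if "infinite {n. P (r n)}" for P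
  proof -
    have "infinite ({n. P (r n)} - {..<i})" using that by (intro Diff_infinite_finite) auto
    then have "infinite (r ` ({n. P (r n)} - {..<i}))"
      using strict_mono_imp_inj_on[OF r] by (subst finite_image_iff) (auto intro: inj_on_subset)
    moreover have "r ` ({n. P (r n)} - {..<i}) \<subseteq> {n \<in> {n\<in>N. \<forall>m\<in>s. m < n}. P n}"
      using rN r by (auto simp: s_def strict_mono_less)
    ultimately show ?thesis using finite_subset by blast
  qed
  have "osc a b {n\<in>N. \<forall>m\<in>s. m < n}"
    unfolding osc_def using \<phi>(1) tr[OF ab(4)] tr[OF ab(5)] by blast
  then show False using no by blast
qed

text \<open>The partition theorem is applied to the finite sets along which no functional alternates
  between the two levels. A functional oscillating on \<open>M\<close> alternates along some
  infinite subset of \<open>M\<close>, which excludes one alternative; the other says that every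
  finite subset of \<open>M\<close> has an alternating functional.\<close>

lemma independent_subsequence:
  fixes X :: "'k \<Rightarrow> nat \<Rightarrow> real"
  assumes bd: "\<And>\<phi> n. \<phi> \<in> K \<Longrightarrow> \<bar>X \<phi> n\<bar> \<le> B"
    and nc: "\<And>r. strict_mono (r :: nat \<Rightarrow> nat) \<Longrightarrow> \<exists>\<phi>\<in>K. \<not> convergent (\<lambda>n. X \<phi> (r n))"
  shows "\<exists>a b r. a < b \<and> strict_mono (r :: nat \<Rightarrow> nat) \<and>
    (\<forall>n P. \<exists>\<phi>\<in>K. \<forall>i<n. (i \<in> P \<longrightarrow> b < X \<phi> (r i)) \<and> (i \<notin> P \<longrightarrow> X \<phi> (r i) < a))"
proof -
  have "\<exists>a b M. a < b \<and> infinite M \<and>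
    (\<forall>N\<subseteq>M. infinite N \<longrightarrow> (\<exists>\<phi>\<in>K. infinite {n\<in>N. X \<phi> n < a} \<and> infinite {n\<in>N. b < X \<phi> n}))"
    by (rule oscillating_infinite_set[OF bd nc])
  then obtain a b A where abA: "a < b \<and> infinite A \<and>
    (\<forall>N\<subseteq>A. infinite N \<longrightarrow> (\<exists>\<phi>\<in>K. infinite {n\<in>N. X \<phi> n < a} \<and> infinite {n\<in>N. b < X \<phi> n}))"
    by (elim exE)
  have ab: "a < b" and A: "infinite A" using abA by auto
  have osc: "\<exists>\<phi>\<in>K. infinite {n\<in>N. X \<phi> n < a} \<and> infinite {n\<in>N. b < X \<phi> n}"
    if "N \<subseteq> A" "infinite N" for N
    using abA that by blast
  define alt where "alt \<phi> s \<longleftrightarrow> (\<forall>n\<in>s. if even (card (s \<inter> {..<n})) then X \<phi> n < a else b < X \<phi> n)" for \<phi> s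
  define H where "H = {s. finite s \<and> (\<forall>\<phi>\<in>K. \<not> alt \<phi> s)}"
  obtain M where M: "M \<subseteq> A" "infinite M" and
    alternative: "(\<forall>N\<subseteq>M. infinite N \<longrightarrow> (\<exists>k. N \<inter> {..<k} \<in> H)) \<or> (\<forall>s. finite s \<longrightarrow> s \<subseteq> M \<longrightarrow> s \<notin> H)"
    using ramsey_open[OF A, of H] by blast
  have noH: "s \<notin> H" if "finite s" "s \<subseteq> M" for s
  proof (rule ccontr)
    assume "\<not> s \<notin> H"
    then have all: "\<exists>k. N \<inter> {..<k} \<in> H" if "N \<subseteq> M" "infinite N" for N
      using alternative that \<open>finite s\<close> \<open>s \<subseteq> M\<close> by blast
    obtain \<phi> where \<phi>: "\<phi> \<in> K" "infinite {n\<in>M. X \<phi> n < a}" "infinite {n\<in>M. b < X \<phi> n}"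
      using osc[OF M] by blast
    define C where "C i n \<longleftrightarrow> n \<in> M \<and> (if even i then X \<phi> n < a else b < X \<phi> n)" for i n :: nat
    have nxt: "\<exists>n>m. C i n" for m i
    proof -
      have "infinite {n. C i n}" using \<phi>(2,3) by (cases "even i") (simp_all add: C_def)
      then show ?thesis by (auto simp: infinite_nat_iff_unbounded)
    qed
    have "\<exists>f. \<forall>i. C i (f i) \<and> f i < f (Suc i)"
      by (rule dependent_nat_choice) (use nxt in blast)+
    then obtain f where f: "\<And>i. C i (f i)" "\<And>i. f i < f (Suc i)" by blast
    have sm: "strict_mono f" using f(2) by (simp add: strict_mono_Suc_iff)
    have "infinite (range f)" using sm by (simp add: range_inj_infinite strict_mono_imp_inj_on)
    moreover have "range f \<subseteq> M" using f(1) by (auto simp: C_def)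
    ultimately obtain k where k: "range f \<inter> {..<k} \<in> H" using all by blast
    have "alt \<phi> (range f \<inter> {..<k})"
      unfolding alt_def
    proof
      fix n assume "n \<in> range f \<inter> {..<k}"
      then obtain i where i: "n = f i" "f i < k" by auto
      have "range f \<inter> {..<k} \<inter> {..<n} = f ` {..<i}"
        using i sm by (auto simp: strict_mono_less) (meson order.strict_trans strict_mono_less)
      then have "card (range f \<inter> {..<k} \<inter> {..<n}) = i"
        using strict_mono_imp_inj_on[OF sm] by (simp add: card_image inj_on_subset)
      then show "if even (card (range f \<inter> {..<k} \<inter> {..<n})) then X \<phi> n < a else b < X \<phi> n"
        using f(1)[of i] i by (simp add: C_def)
    qed
    then show False using k \<phi>(1) by (auto simp: H_def)
  qed
  have altM: "\<exists>\<phi>\<in>K. alt \<phi> s" if "finite s" "s \<subseteq> M" for s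
    using noH[OF that] that by (auto simp: H_def)
  define m where "m = enumerate M"
  have m: "strict_mono m" unfolding m_def using M by (simp add: strict_mono_enumerate)
  have mM: "m n \<in> M" for n unfolding m_def using M by (intro enumerate_in_set)
  have alt_init: "alt \<phi> s \<and> (if even (card s) then X \<phi> k < a else b < X \<phi> k)"
    if "alt \<phi> (insert k s)" "\<forall>j\<in>s. j < k" for \<phi> s k
  proof -
    have "insert k s \<inter> {..<j} = s \<inter> {..<j}" if "j \<in> s" for j
      using that \<open>\<forall>j\<in>s. j < k\<close> by auto
    moreover have "insert k s \<inter> {..<k} = s" using \<open>\<forall>j\<in>s. j < k\<close> by auto
    ultimately show ?thesis using that(1) unfolding alt_def by (metis insertI1 insertI2)
  qed
  \<comment> \<open>Only the elements of \<open>M\<close> with odd index are kept. Those with even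
    index are spare: inserting one flips the parity of the next position, so every prescribed
    pattern on the kept elements occurs inside an alternating one.\<close>
  have pat: "\<exists>s. s \<subseteq> m ` {..<2*n} \<and>
      (\<forall>\<phi>. alt \<phi> s \<longrightarrow> (\<forall>i<n. (i \<in> P \<longrightarrow> b < X \<phi> (m (2*i+1))) \<and> (i \<notin> P \<longrightarrow> X \<phi> (m (2*i+1)) < a)))" for n P
  proof (induction n)
    case 0
    then show ?case by auto
  next
    case (Suc n)
    then obtain s where s: "s \<subseteq> m ` {..<2*n}" and
      sP: "\<And>\<phi> i. alt \<phi> s \<Longrightarrow> i < n \<Longrightarrow> (i \<in> P \<longrightarrow> b < X \<phi> (m (2*i+1))) \<and> (i \<notin> P \<longrightarrow> X \<phi> (m (2*i+1)) < a)"
      by blast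
    have fin: "finite s" using s finite_subset by blast
    have ls: "\<forall>j\<in>s. j < m (2*n)" using s m by (auto simp: strict_mono_less)
    have lt: "m (2*n) < m (2*n+1)" using m by (simp add: strict_mono_less)
    define s' where "s' = (if even (card s) = (n \<notin> P) then s else insert (m (2*n)) s)"
    have s': "s' \<subseteq> m ` {..<2*n+1}" "\<forall>j\<in>s'. j < m (2*n+1)" "even (card s') = (n \<notin> P)"
      using s ls lt fin by (auto simp: s'_def less_Suc_eq)
    have s's: "alt \<phi> s' \<Longrightarrow> alt \<phi> s" for \<phi>
      using alt_init[OF _ ls] by (auto simp: s'_def split: if_splits)
    show ?case
    proof (intro exI[of _ "insert (m (2*n+1)) s'"] conjI allI impI)
      show "insert (m (2*n+1)) s' \<subseteq> m ` {..<2 * Suc n}" using s'(1) by auto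
      fix \<phi> i assume h: "alt \<phi> (insert (m (2*n+1)) s')" "i < Suc n"
      have h': "alt \<phi> s'" "if n \<notin> P then X \<phi> (m (2*n+1)) < a else b < X \<phi> (m (2*n+1))"
        using alt_init[OF h(1) s'(2)] s'(3) by auto
      show "i \<in> P \<Longrightarrow> b < X \<phi> (m (2*i+1))"
        using h' sP[OF s's[OF h'(1)], of i] h(2) by (cases "i = n") auto
      show "i \<notin> P \<Longrightarrow> X \<phi> (m (2*i+1)) < a"
        using h' sP[OF s's[OF h'(1)], of i] h(2) by (cases "i = n") auto
    qed
  qed
  have "strict_mono (\<lambda>i. m (2*i+1))" using m by (auto simp: strict_mono_def)
  moreover have "\<exists>\<phi>\<in>K. \<forall>i<n. (i \<in> P \<longrightarrow> b < X \<phi> (m (2*i+1))) \<and> (i \<notin> P \<longrightarrow> X \<phi> (m (2*i+1)) < a)" for n P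
  proof -
    obtain s where s: "s \<subseteq> m ` {..<2*n}" "\<And>\<phi>. alt \<phi> s \<Longrightarrow> (\<forall>i<n. (i \<in> P \<longrightarrow> b < X \<phi> (m (2*i+1))) \<and> (i \<notin> P \<longrightarrow> X \<phi> (m (2*i+1)) < a))"
      using pat[of n P] by blast
    have "finite s" "s \<subseteq> M" using s(1) mM finite_subset by (blast, auto)
    then obtain \<phi> where "\<phi> \<in> K" "alt \<phi> s" using altM by blast
    then show ?thesis using s(2) by blast
  qed
  ultimately show ?thesis using ab
    by (intro exI[of _ a] exI[of _ b] exI[of _ "\<lambda>i. m (2*i+1)"]) auto
qed

text \<open>Both directions are recorded because a copy of l1 is mapped from the subspace onto
  \<open>ell1\<close>, whereas the embedding into \<open>c0\<close> goes from the space onto its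
  image.\<close>

lemma bounded_below_linear_homeomorphic:
  fixes T :: "'a::real_normed_vector \<Rightarrow> 'b::real_normed_vector"
  assumes T: "bounded_linear T" and c: "c > 0" and lower: "\<And>x. c * norm x \<le> norm (T x)"
  shows "linearly_homeomorphic (UNIV::'a set) (range T)" "linearly_homeomorphic (range T) (UNIV::'a set)"
proof -
  interpret T: bounded_linear T by fact
  have inj: "inj T"
    unfolding T.inj_iff_eq_0
  proof (intro allI impI)
    fix x assume "T x = 0"
    then show "x = 0" using lower[of x] c by (simp add: mult_le_0_iff)
  qed
  have li: "inv T (T x) = x" for x using inj by simp
  have cont: "continuous_on (range T) (inv T)"
  proof (rule continuous_onI)
    fix u e assume u: "u \<in> range T" and e: "0 < (e::real)"
    show "\<exists>d>0. \<forall>x'\<in>range T. dist x' u < d \<longrightarrow> dist (inv T x') (inv T u) \<le> e"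
    proof (intro exI[of _ "c * e"] conjI ballI impI)
      show "0 < c * e" using c e by simp
      fix v assume v: "v \<in> range T" "dist v u < c * e"
      obtain x y where xy: "u = T x" "v = T y" using u v by auto
      have "c * norm (y - x) \<le> norm (T y - T x)" using lower[of "y - x"] by (simp add: T.diff)
      also have "\<dots> < c * e" using v xy by (simp add: dist_norm)
      finally show "dist (inv T v) (inv T u) \<le> e" using c by (simp add: xy li dist_norm)
    qed
  qed
  have hom: "homeomorphism UNIV (range T) T (inv T)"
    unfolding homeomorphism_def
    using cont li by (auto simp: image_image T.continuous_on)
  show "linearly_homeomorphic (UNIV::'a set) (range T)"
    unfolding linearly_homeomorphic_def
    by (rule exI[of _ T], rule exI[of _ "inv T"]) (simp add: hom T.add T.scaleR)
  have "inv T (u + v) = inv T u + inv T v" if uv: "u \<in> range T" "v \<in> range T" for u v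
  proof -
    obtain x y where x: "u = T x" "v = T y" using uv by blast
    have "u + v = T (x + y)" by (simp only: x T.add)
    then show ?thesis by (simp only: x li)
  qed
  moreover have "inv T (k *\<^sub>R u) = k *\<^sub>R inv T u" if u: "u \<in> range T" for u k
  proof -
    obtain x where x: "u = T x" using u by blast
    have "k *\<^sub>R u = T (k *\<^sub>R x)" by (simp only: x T.scaleR)
    then show ?thesis by (simp only: x li)
  qed
  moreover have "homeomorphism (range T) UNIV (inv T) T"
    by (rule homeomorphism_symD[OF hom])
  ultimately show "linearly_homeomorphic (range T) (UNIV::'a set)"
    unfolding linearly_homeomorphic_def by blast
qed

text \<open>The levels \<open>a\<close> and \<open>b\<close> may have the same sign, so one
  functional is not enough. The difference of the functionals for \<open>P\<close> and for its
  complement has values of the right sign and size at least \<open>b - a\<close>; its norm is at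
  most 2, hence the factor 1/2.\<close>

lemma norm_sum_ell1_lower:
  fixes z :: "nat \<Rightarrow> 'a::real_normed_vector"
  assumes ind: "\<And>n P. \<exists>\<phi>. norm \<phi> \<le> 1 \<and> (\<forall>i<n. (i \<in> P \<longrightarrow> b < blinfun_apply \<phi> (z i)) \<and> (i \<notin> P \<longrightarrow> blinfun_apply \<phi> (z i) < a))"
    and ab: "a < b"
  shows "(b - a) / 2 * (\<Sum>i<n. \<bar>c i\<bar>) \<le> norm (\<Sum>i<n. c i *\<^sub>R z i)"
proof -
  define P where "P = {i. c i > 0}"
  obtain \<phi> where \<phi>: "norm \<phi> \<le> 1" "\<And>i. i < n \<Longrightarrow> (i \<in> P \<longrightarrow> b < blinfun_apply \<phi> (z i)) \<and> (i \<notin> P \<longrightarrow> blinfun_apply \<phi> (z i) < a)"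
    using ind[of n P] by blast
  obtain \<psi> where \<psi>: "norm \<psi> \<le> 1" "\<And>i. i < n \<Longrightarrow> (i \<in> -P \<longrightarrow> b < blinfun_apply \<psi> (z i)) \<and> (i \<notin> -P \<longrightarrow> blinfun_apply \<psi> (z i) < a)"
    using ind[of n "-P"] by blast
  have "(b - a) * \<bar>c i\<bar> \<le> c i * blinfun_apply (\<phi> - \<psi>) (z i)" if "i < n" for i
  proof (cases "c i > 0")
    case True
    then have "b - a \<le> blinfun_apply (\<phi> - \<psi>) (z i)"
      using \<phi>(2)[OF that] \<psi>(2)[OF that] by (auto simp: P_def blinfun.diff_left)
    then show ?thesis using True by (simp add: mult.commute mult_left_mono)
  next
    case False
    then have "b - a \<le> - blinfun_apply (\<phi> - \<psi>) (z i)"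
      using \<phi>(2)[OF that] \<psi>(2)[OF that] by (auto simp: P_def blinfun.diff_left)
    from mult_left_mono[OF this, of "- c i"] False show ?thesis by (simp add: mult.commute)
  qed
  then have "(b - a) * (\<Sum>i<n. \<bar>c i\<bar>) \<le> (\<Sum>i<n. c i * blinfun_apply (\<phi> - \<psi>) (z i))"
    unfolding sum_distrib_left by (intro sum_mono) auto
  also have "\<dots> = blinfun_apply (\<phi> - \<psi>) (\<Sum>i<n. c i *\<^sub>R z i)"
    by (simp add: blinfun.sum_right blinfun.scaleR_right)
  also have "\<dots> \<le> norm (\<phi> - \<psi>) * norm (\<Sum>i<n. c i *\<^sub>R z i)"
    using norm_blinfun[of "\<phi> - \<psi>"] by (metis abs_ge_self order_trans real_norm_def)
  also have "\<dots> \<le> 2 * norm (\<Sum>i<n. c i *\<^sub>R z i)"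
    using norm_triangle_ineq4[of \<phi> \<psi>] \<phi>(1) \<psi>(1) by (intro mult_right_mono) auto
  finally show ?thesis by simp
qed

lemma ell1_norm_sums: "(\<lambda>i. \<bar>ell1_nth f i\<bar>) sums norm f"
  by transfer (rule summable_sums)

lemma ell1_partial_le_norm: "(\<Sum>i<n. \<bar>ell1_nth f i\<bar>) \<le> norm f"
  using ell1_norm_sums[of f] by (metis abs_ge_zero sum_le_suminf sums_iff finite_lessThan)

text \<open>By the lower bound, preimages of a convergent sequence form a Cauchy sequence.
  Closedness of the range thus comes down to completeness of \<open>ell1\<close>, which is proved
  here through the coordinates.\<close>

lemma ell1_embedding:
  fixes z :: "nat \<Rightarrow> 'a::banach"
  assumes B: "\<And>i. norm (z i) \<le> B" and c: "c > 0"
    and lower: "\<And>n d. c * (\<Sum>i<n. \<bar>d i\<bar>) \<le> norm (\<Sum>i<n. d i *\<^sub>R z i)"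
  shows "\<exists>Y :: 'a set. closed_subspace Y \<and> linearly_homeomorphic Y (UNIV :: ell1 set)"
proof -
  have B0: "B \<ge> 0" using B[of 0] norm_ge_zero order_trans by blast
  have le: "norm (ell1_nth f i *\<^sub>R z i) \<le> \<bar>ell1_nth f i\<bar> * B" for f i
    using B by (simp add: mult_left_mono)
  have sB: "summable (\<lambda>i. \<bar>ell1_nth f i\<bar> * B)" for f
    using ell1_norm_sums[of f] by (intro summable_mult2) (auto simp: sums_iff)
  have sN: "summable (\<lambda>i. norm (ell1_nth f i *\<^sub>R z i))" for f
    by (rule summable_comparison_test[OF _ sB[of f]]) (use le in auto)
  have s: "summable (\<lambda>i. ell1_nth f i *\<^sub>R z i)" for f
    by (rule summable_norm_cancel[OF sN])
  define T where "T f = (\<Sum>i. ell1_nth f i *\<^sub>R z i)" for f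
  have Tlim: "(\<lambda>n. \<Sum>i<n. ell1_nth f i *\<^sub>R z i) \<longlonglongrightarrow> T f" for f
    unfolding T_def by (rule summable_LIMSEQ[OF s])
  have bl: "bounded_linear T"
  proof (rule bounded_linear_intro)
    show "T (f + g) = T f + T g" for f g
      unfolding T_def by (subst suminf_add[OF s s]) (simp add: plus_ell1.rep_eq scaleR_add_left)
    show "T (r *\<^sub>R f) = r *\<^sub>R T f" for r f
      unfolding T_def suminf_scaleR_right[OF s] by (simp add: scaleR_ell1.rep_eq)
    show "norm (T f) \<le> norm f * B" for f
    proof -
      have "norm (T f) \<le> (\<Sum>i. norm (ell1_nth f i *\<^sub>R z i))" unfolding T_def by (rule summable_norm[OF sN])
      also have "\<dots> \<le> (\<Sum>i. \<bar>ell1_nth f i\<bar> * B)" by (rule suminf_le[OF le sN sB])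
      also have "\<dots> = norm f * B" using sums_mult2[OF ell1_norm_sums[of f], of B] by (simp add: sums_iff)
      finally show ?thesis .
    qed
  qed
  interpret T: bounded_linear T by fact
  have low: "c * norm f \<le> norm (T f)" for f
  proof (rule LIMSEQ_le[OF _ tendsto_norm[OF Tlim]])
    show "(\<lambda>n. c * (\<Sum>i<n. \<bar>ell1_nth f i\<bar>)) \<longlonglongrightarrow> c * norm f"
      using ell1_norm_sums[of f] by (intro tendsto_intros) (simp add: sums_def)
  qed (use lower in auto)
  have "closed (range T)"
    unfolding closed_sequential_limits
  proof (intro allI impI, elim conjE)
    fix x l assume xr: "\<forall>n. x n \<in> range T" and xl: "x \<longlonglongrightarrow> l"
    have "\<forall>n. \<exists>f. x n = T f" using xr by auto
    from choice[OF this] obtain f where f: "\<And>n. x n = T (f n)" by blast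
    have cau: "\<exists>N. \<forall>m\<ge>N. \<forall>n\<ge>N. norm (f m - f n) \<le> e" if e: "e > 0" for e
    proof -
      have "Cauchy x" using xl by (rule LIMSEQ_imp_Cauchy)
      then obtain N where N: "\<And>m n. m \<ge> N \<Longrightarrow> n \<ge> N \<Longrightarrow> norm (x m - x n) < c * e"
        using c e unfolding Cauchy_iff by (meson mult_pos_pos)
      have "norm (f m - f n) \<le> e" if "m \<ge> N" "n \<ge> N" for m n
      proof -
        have "c * norm (f m - f n) \<le> norm (x m - x n)" using low[of "f m - f n"] by (simp add: f T.diff)
        also have "\<dots> \<le> c * e" using N[OF that] by simp
        finally show ?thesis using c by simp
      qed
      then show ?thesis by blast
    qed
    have coord: "\<bar>ell1_nth g i\<bar> \<le> norm g" for g i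
      using ell1_partial_le_norm[of g "Suc i"] by (auto intro: order_trans[OF _ ell1_partial_le_norm[of g "Suc i"]] simp: sum_nonneg)
    have "Cauchy (\<lambda>n. ell1_nth (f n) i)" for i
    proof (rule metric_CauchyI)
      fix e :: real assume "e > 0"
      then obtain N where N: "\<forall>m\<ge>N. \<forall>n\<ge>N. norm (f m - f n) \<le> e/2" using cau[of "e/2"] by auto
      show "\<exists>N. \<forall>m\<ge>N. \<forall>n\<ge>N. dist (ell1_nth (f m) i) (ell1_nth (f n) i) < e"
      proof (intro exI allI impI)
        fix m n assume "m \<ge> N" "n \<ge> N"
        then show "dist (ell1_nth (f m) i) (ell1_nth (f n) i) < e"
          using N \<open>e > 0\<close> coord[of "f m - f n" i] by (force simp: dist_real_def minus_ell1.rep_eq)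
      qed
    qed
    then have "\<forall>i. \<exists>g. (\<lambda>n. ell1_nth (f n) i) \<longlonglongrightarrow> g"
      by (simp add: Cauchy_convergent_iff convergent_def)
    then obtain g where g: "\<And>i. (\<lambda>n. ell1_nth (f n) i) \<longlonglongrightarrow> g i" by metis
    have part: "(\<Sum>i<k. \<bar>ell1_nth (f m) i - g i\<bar>) \<le> e"
      if N: "\<forall>m\<ge>N. \<forall>n\<ge>N. norm (f m - f n) \<le> e" and m: "m \<ge> N" for e N m k
    proof (rule tendsto_upperbound)
      show "(\<lambda>n. \<Sum>i<k. \<bar>ell1_nth (f m) i - ell1_nth (f n) i\<bar>) \<longlonglongrightarrow> (\<Sum>i<k. \<bar>ell1_nth (f m) i - g i\<bar>)"
        by (intro tendsto_intros g)
      have "(\<Sum>i<k. \<bar>ell1_nth (f m) i - ell1_nth (f n) i\<bar>) \<le> e" if "n \<ge> N" for n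
        using ell1_partial_le_norm[of "f m - f n" k] N m that by (force simp: minus_ell1.rep_eq)
      then show "\<forall>\<^sub>F n in sequentially. (\<Sum>i<k. \<bar>ell1_nth (f m) i - ell1_nth (f n) i\<bar>) \<le> e"
        by (auto simp: eventually_sequentially)
    qed simp
    \<comment> \<open>For summability of \<open>g\<close> one index is enough: \<open>g\<close>
      differs from the summable \<open>ell1_nth (f N1)\<close> by a summable sequence.\<close>
    obtain N1 where N1: "\<forall>m\<ge>N1. \<forall>n\<ge>N1. norm (f m - f n) \<le> 1" using cau[of 1] by auto
    have sd: "summable (\<lambda>i. \<bar>ell1_nth (f N1) i - g i\<bar>)"
      by (rule summableI_nonneg_bounded[of _ 1]) (use part[OF N1] in auto)
    have sf: "summable (\<lambda>i. \<bar>ell1_nth f i\<bar>)" for f using ell1_norm_sums[of f] by (simp add: sums_iff)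
    have sg: "summable (\<lambda>i. \<bar>g i\<bar>)"
      using summable_abs_diff[OF sf[of "f N1"] sd] summable_abs_diff[of "ell1_nth (f N1)" "\<lambda>i. ell1_nth (f N1) i - g i"] sf sd by simp
    define h where "h = Abs_ell1 g"
    have h: "ell1_nth h = g" unfolding h_def using sg by (simp add: Abs_ell1_inverse)
    have "f \<longlonglongrightarrow> h"
    proof (rule LIMSEQ_I)
      fix e :: real assume e: "e > 0"
      obtain N where N: "\<forall>m\<ge>N. \<forall>n\<ge>N. norm (f m - f n) \<le> e/2" using cau[of "e/2"] e by auto
      have "norm (f m - h) \<le> e/2" if "m \<ge> N" for m
      proof (rule tendsto_upperbound)
        show "(\<lambda>k. \<Sum>i<k. \<bar>ell1_nth (f m - h) i\<bar>) \<longlonglongrightarrow> norm (f m - h)"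
          using ell1_norm_sums[of "f m - h"] by (simp add: sums_def)
        show "\<forall>\<^sub>F k in sequentially. (\<Sum>i<k. \<bar>ell1_nth (f m - h) i\<bar>) \<le> e/2"
          using part[OF N that] by (simp add: minus_ell1.rep_eq h)
      qed simp
      then show "\<exists>N. \<forall>m\<ge>N. norm (f m - h) < e" using e by (intro exI[of _ N]) fastforce
    qed
    then have "(\<lambda>n. T (f n)) \<longlonglongrightarrow> T h" by (rule T.tendsto)
    then have "x \<longlonglongrightarrow> T h" by (simp flip: f)
    then show "l \<in> range T" using xl LIMSEQ_unique by blast
  qed
  moreover have "subspace (range T)"
    using linear_subspace_image[OF T.linear_axioms, of UNIV] by simp
  ultimately show ?thesis
    using bounded_below_linear_homeomorphic(2)[OF bl c low] by (auto simp: closed_subspace_def)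
qed

text \<open>If every subsequence diverges along some functional, rescaling puts that functional into
  the unit ball \<open>K\<close>. Independence over \<open>K\<close> then gives the lower estimate
  that spans a copy of l1.\<close>

lemma weakly_cauchy_subsequence:
  fixes y :: "nat \<Rightarrow> 'a::banach"
  assumes no_ell1: "\<not> (\<exists>Y :: 'a set. closed_subspace Y \<and> linearly_homeomorphic Y (UNIV :: ell1 set))"
    and B: "\<And>n. norm (y n) \<le> B"
  shows "\<exists>r. strict_mono (r :: nat \<Rightarrow> nat) \<and> (\<forall>\<phi> :: 'a \<Rightarrow>\<^sub>L real. convergent (\<lambda>n. blinfun_apply \<phi> (y (r n))))"
proof (rule ccontr)
  assume neg: "\<not> ?thesis"
  define K where "K = {\<phi> :: 'a \<Rightarrow>\<^sub>L real. norm \<phi> \<le> 1}"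
  have "\<exists>\<phi>\<in>K. \<not> convergent (\<lambda>n. blinfun_apply \<phi> (y (r n)))" if r: "strict_mono r" for r :: "nat \<Rightarrow> nat"
  proof -
    obtain \<phi> :: "'a \<Rightarrow>\<^sub>L real" where \<phi>: "\<not> convergent (\<lambda>n. blinfun_apply \<phi> (y (r n)))" using neg r by blast
    have "\<phi> \<noteq> 0" using \<phi> by (auto simp: convergent_const)
    then have "norm \<phi> > 0" by simp
    have "\<not> convergent (\<lambda>n. blinfun_apply ((1 / norm \<phi>) *\<^sub>R \<phi>) (y (r n)))"
    proof
      assume "convergent (\<lambda>n. blinfun_apply ((1 / norm \<phi>) *\<^sub>R \<phi>) (y (r n)))"
      then have "convergent (\<lambda>n. norm \<phi> * blinfun_apply ((1 / norm \<phi>) *\<^sub>R \<phi>) (y (r n)))"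
        by (intro convergent_mult convergent_const)
      then show False using \<phi> \<open>norm \<phi> > 0\<close> by (simp add: blinfun.scaleR_left)
    qed
    moreover have "(1 / norm \<phi>) *\<^sub>R \<phi> \<in> K" using \<open>norm \<phi> > 0\<close> by (simp add: K_def)
    ultimately show ?thesis by blast
  qed
  moreover have "\<bar>blinfun_apply \<phi> (y n)\<bar> \<le> B" if "\<phi> \<in> K" for \<phi> n
  proof -
    have "\<bar>blinfun_apply \<phi> (y n)\<bar> \<le> norm \<phi> * norm (y n)" using norm_blinfun[of \<phi> "y n"] by simp
    also have "\<dots> \<le> 1 * B" using that B by (intro mult_mono) (auto simp: K_def)
    finally show ?thesis by simp
  qed
  ultimately have "\<exists>a b r. a < b \<and> strict_mono (r :: nat \<Rightarrow> nat) \<and>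
    (\<forall>n P. \<exists>\<phi>\<in>K. \<forall>i<n. (i \<in> P \<longrightarrow> b < blinfun_apply \<phi> (y (r i))) \<and> (i \<notin> P \<longrightarrow> blinfun_apply \<phi> (y (r i)) < a))"
    by (intro independent_subsequence[where X = "\<lambda>\<phi> n. blinfun_apply \<phi> (y n)"])
  then obtain a b and r :: "nat \<Rightarrow> nat" where ab: "a < b" and
    ind: "\<forall>n P. \<exists>\<phi>\<in>K. \<forall>i<n. (i \<in> P \<longrightarrow> b < blinfun_apply \<phi> (y (r i))) \<and> (i \<notin> P \<longrightarrow> blinfun_apply \<phi> (y (r i)) < a)"
    by blast
  have "(b - a) / 2 * (\<Sum>i<n. \<bar>d i\<bar>) \<le> norm (\<Sum>i<n. d i *\<^sub>R y (r i))" for n d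
    by (rule norm_sum_ell1_lower[where a = a and b = b]) (use ind ab in \<open>auto simp: K_def\<close>)
  with no_ell1 ell1_embedding[of "\<lambda>i. y (r i)" B "(b - a) / 2"] B ab show False by auto
qed

section \<open>Renorming by the bounded tree property\<close>

lemma finite_full_tree: "full_tree S \<Longrightarrow> a \<in> S \<Longrightarrow> finite a"
  by (simp add: full_tree_def)

lemma empty_in_full_tree: "full_tree S \<Longrightarrow> {} \<in> S"
  by (simp add: full_tree_def)

lemma is_successor_remove_Max:
  assumes "finite b" "b \<noteq> {}"
  shows "is_successor b (b - {Max b})"
  unfolding is_successor_iff
proof (intro conjI exI[of _ "Max b"] ballI)
  fix n assume "n \<in> b - {Max b}"
  then show "n < Max b" using Max_ge[OF assms(1), of n] by (auto simp: le_less)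
qed (use assms Max_in in auto)

lemma predecessor_remove_Max:
  assumes "finite b" "b \<noteq> {}"
  shows "predecessor b = b - {Max b}" "is_successor b (predecessor b)"
  using is_successor_remove_Max[OF assms] predecessor_eq by auto

lemma is_successor_nonempty: "is_successor b a \<Longrightarrow> b \<noteq> {}"
  by (auto simp: is_successor_iff)

lemma branch_mono: "branch T \<beta> \<Longrightarrow> T \<subseteq> S \<Longrightarrow> branch S \<beta>"
  by (auto simp: branch_def)

lemma full_tree_has_branch:
  assumes "full_tree T"
  shows "\<exists>\<beta>. branch T \<beta>"
proof -
  have nxt: "\<exists>b. b \<in> T \<and> is_successor b a" if a: "a \<in> T" for a
  proof -
    have "infinite (successors T a)" using assms a by (auto simp: full_tree_def)
    then have "successors T a \<noteq> {}" by auto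
    then show ?thesis by (auto simp: successors_def)
  qed
  have "\<exists>\<beta>. \<forall>n. (\<beta> n \<in> T \<and> (n = 0 \<longrightarrow> \<beta> n = {})) \<and> is_successor (\<beta> (Suc n)) (\<beta> n)"
  proof (rule dependent_nat_choice)
    show "\<exists>a. a \<in> T \<and> (0 = (0::nat) \<longrightarrow> a = {})" using empty_in_full_tree[OF assms] by auto
  qed (use nxt in blast)
  then show ?thesis by (auto simp: branch_def)
qed

lemma full_tree_finite_sets: "full_tree {a :: nat set. finite a}"
  unfolding full_tree_def
proof (intro conjI ballI impI)
  fix a :: "nat set" assume "a \<in> {a. finite a}"
  then have fin: "finite a" by simp
  obtain k where k: "\<forall>n\<in>a. n < k" using finite_nat_set_iff_bounded fin by blast
  have "(\<lambda>m. insert m a) ` {k..} \<subseteq> successors {a. finite a} a"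
  proof (intro image_subsetI)
    fix m assume "m \<in> {k..}"
    then have "\<forall>n\<in>a. n < m" using k by auto
    then show "insert m a \<in> successors {a. finite a} a"
      using fin unfolding successors_def is_successor_iff by blast
  qed
  moreover have "inj_on (\<lambda>m. insert m a) {k..}"
    using k by (auto simp: inj_on_def) (metis insertE insertI1 leD)
  then have "infinite ((\<lambda>m. insert m a) ` {k..})"
    by (simp add: finite_image_iff infinite_Ici)
  ultimately show "infinite (successors {a. finite a} a)" using finite_subset by blast
  show "predecessor a \<in> {a. finite a}" if "a \<noteq> {}"
    using predecessor_remove_Max(1)[OF fin that] fin by simp
qed auto

lemma successors_enumeration:
  assumes "infinite (successors S a)"
  shows "\<exists>e. bij_betw e (UNIV :: nat set) (successors S a)"
proof -
  have "successors S a \<subseteq> range (\<lambda>m. insert m a)"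
    by (auto simp: successors_def is_successor_iff)
  then have "countable (successors S a)" by (rule countable_subset) auto
  then show ?thesis using assms bij_betw_from_nat_into by blast
qed

text \<open>This removes the enumeration from weak nullness of the successors and leaves a
  finiteness condition that subtrees visibly inherit.\<close>

lemma tendsto_zero_iff_finite:
  fixes f :: "'b \<Rightarrow> real"
  assumes e: "bij_betw e (UNIV :: nat set) C"
  shows "(\<lambda>n. f (e n)) \<longlonglongrightarrow> 0 \<longleftrightarrow> (\<forall>\<epsilon>>0. finite {b\<in>C. \<epsilon> \<le> \<bar>f b\<bar>})"
proof -
  have "e ` {n. \<epsilon> \<le> \<bar>f (e n)\<bar>} = {b\<in>C. \<epsilon> \<le> \<bar>f b\<bar>}" for \<epsilon>
    using bij_betw_imp_surj_on[OF e] by auto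
  moreover have "inj_on e {n. \<epsilon> \<le> \<bar>f (e n)\<bar>}" for \<epsilon>
    using bij_betw_imp_inj_on[OF e] by (rule inj_on_subset) auto
  ultimately have "finite {n. \<epsilon> \<le> \<bar>f (e n)\<bar>} \<longleftrightarrow> finite {b\<in>C. \<epsilon> \<le> \<bar>f b\<bar>}" for \<epsilon>
    by (metis finite_image_iff)
  then show ?thesis
    by (simp add: tendsto_iff cofinite_eq_sequentially[symmetric] eventually_cofinite not_less)
qed

lemma weakly_null_tree_map_iff:
  fixes x :: "nat set \<Rightarrow> 'a::real_normed_vector"
  shows "weakly_null_tree_map S x \<longleftrightarrow> tree_map S x \<and>
    (\<forall>a\<in>S. \<forall>\<phi> :: 'a \<Rightarrow> real. bounded_linear \<phi> \<longrightarrow> (\<forall>\<epsilon>>0. finite {b\<in>successors S a. \<epsilon> \<le> \<bar>\<phi> (x b)\<bar>}))"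
proof -
  have "(\<forall>e. bij_betw e (UNIV :: nat set) (successors S a) \<longrightarrow> weakly_null (\<lambda>n. x (e n))) \<longleftrightarrow>
      (\<forall>\<phi> :: 'a \<Rightarrow> real. bounded_linear \<phi> \<longrightarrow> (\<forall>\<epsilon>>0. finite {b\<in>successors S a. \<epsilon> \<le> \<bar>\<phi> (x b)\<bar>}))"
    (is "?L a \<longleftrightarrow> ?R a") if S: "full_tree S" "a \<in> S" for a
  proof -
    have "infinite (successors S a)" using S by (simp add: full_tree_def)
    then obtain e0 where e0: "bij_betw e0 (UNIV :: nat set) (successors S a)"
      using successors_enumeration by blast
    note key = tendsto_zero_iff_finite[where C = "successors S a" and f = "\<lambda>b. \<phi> (x b)" for \<phi> :: "'a \<Rightarrow> real"]
    show ?thesis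
    proof
      assume L: "?L a"
      show "?R a"
      proof (intro allI impI)
        fix \<phi> :: "'a \<Rightarrow> real" and \<epsilon> :: real
        assume "bounded_linear \<phi>" and \<epsilon>: "0 < \<epsilon>"
        then have "(\<lambda>n. \<phi> (x (e0 n))) \<longlonglongrightarrow> 0"
          using L e0 by (simp add: weakly_null_def)
        then show "finite {b \<in> successors S a. \<epsilon> \<le> \<bar>\<phi> (x b)\<bar>}"
          using key[OF e0] \<epsilon> by simp
      qed
    next
      assume R: "?R a"
      show "?L a"
        unfolding weakly_null_def
      proof (intro allI impI)
        fix e :: "nat \<Rightarrow> nat set" and \<phi> :: "'a \<Rightarrow> real"
        assume "bij_betw e UNIV (successors S a)" "bounded_linear \<phi>"
        then show "(\<lambda>n. \<phi> (x (e n))) \<longlonglongrightarrow> 0" using key R by simp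
      qed
    qed
  qed
  then show ?thesis unfolding weakly_null_tree_map_def tree_map_def by meson
qed

lemma weakly_null_tree_map_subtree:
  assumes "weakly_null_tree_map S x" "full_subtree T S"
  shows "weakly_null_tree_map T x"
  unfolding weakly_null_tree_map_iff
proof (intro conjI ballI allI impI)
  have TS: "T \<subseteq> S" and T: "full_tree T" using assms(2) by (auto simp: full_subtree_def)
  show "tree_map T x"
    using assms(1) T branch_mono[OF _ TS] by (auto simp: weakly_null_tree_map_def tree_map_def)
  fix a and \<phi> :: "'a \<Rightarrow> real" and \<epsilon> :: real
  assume "a \<in> T" "bounded_linear \<phi>" "\<epsilon> > 0"
  then have "finite {b\<in>successors S a. \<epsilon> \<le> \<bar>\<phi> (x b)\<bar>}"
    using assms(1) TS by (auto simp: weakly_null_tree_map_iff)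
  then show "finite {b\<in>successors T a. \<epsilon> \<le> \<bar>\<phi> (x b)\<bar>}"
    by (rule finite_subset[rotated]) (use TS in \<open>auto simp: successors_def\<close>)
qed

lemma weakly_null_tree_map_scaleR:
  assumes "weakly_null_tree_map S x"
  shows "weakly_null_tree_map S (\<lambda>a. c *\<^sub>R x a)"
  unfolding weakly_null_tree_map_iff
proof (intro conjI ballI allI impI)
  show "tree_map S (\<lambda>a. c *\<^sub>R x a)"
    unfolding tree_map_def
  proof (intro conjI allI impI)
    fix \<beta> assume "branch S \<beta>"
    then have "finite {a \<in> range \<beta>. x a \<noteq> 0}"
      using assms by (simp add: weakly_null_tree_map_def tree_map_def)
    then show "finite {a \<in> range \<beta>. c *\<^sub>R x a \<noteq> 0}" by (rule rev_finite_subset) auto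
  qed (use assms in \<open>simp_all add: weakly_null_tree_map_def tree_map_def\<close>)
  fix a and \<phi> :: "'a \<Rightarrow> real" and \<epsilon> :: real
  assume h: "a \<in> S" "bounded_linear \<phi>" "\<epsilon> > 0"
  have "bounded_linear (\<lambda>v. \<phi> (c *\<^sub>R v))"
    using bounded_linear_compose[OF h(2) bounded_linear_scaleR_right] by simp
  then show "finite {b\<in>successors S a. \<epsilon> \<le> \<bar>\<phi> (c *\<^sub>R x b)\<bar>}"
    using assms h unfolding weakly_null_tree_map_iff by blast
qed

lemma branch_sum_scaleR: "branch_sum (\<lambda>a. c *\<^sub>R x a) \<beta> = c *\<^sub>R branch_sum x \<beta>"
  by (cases "c = 0") (auto simp: branch_sum_def scaleR_right.sum)

text \<open>\<open>graft n b\<close> is the node that \<open>b\<close> becomes when its tree is hung below the node \<open>{n}\<close>.\<close>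

definition graft :: "nat \<Rightarrow> nat set \<Rightarrow> nat set" where
  "graft n b = insert n ((+) (Suc n) ` b)"

definition graft_root :: "nat set \<Rightarrow> nat" where
  "graft_root a = (LEAST n. n \<in> a)"

definition graft_node :: "nat set \<Rightarrow> nat set" where
  "graft_node a = {i. Suc (graft_root a) + i \<in> a}"

lemma graft_nonempty [simp]: "graft n b \<noteq> {}"
  by (simp add: graft_def)

lemma finite_graft [simp]: "finite (graft n b) \<longleftrightarrow> finite b"
  unfolding graft_def by (simp, subst finite_image_iff) (auto simp: inj_on_def)

lemma graft_root_graft [simp]: "graft_root (graft n b) = n"
  unfolding graft_root_def graft_def by (rule Least_equality) auto

lemma graft_node_graft [simp]: "graft_node (graft n b) = b"
  unfolding graft_node_def graft_root_graft by (auto simp: graft_def)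

lemma graft_inject [simp]: "graft n b = graft m c \<longleftrightarrow> n = m \<and> b = c"
  by (metis graft_root_graft graft_node_graft)

lemma is_successor_empty_iff: "is_successor a {} \<longleftrightarrow> (\<exists>n. a = graft n {})"
  by (auto simp: is_successor_iff graft_def)

text \<open>The shift by \<open>Suc n\<close> keeps the order of the elements of \<open>b\<close>
  and puts all of them above \<open>n\<close>, so every end extension of \<open>graft n b\<close>
  comes from one of \<open>b\<close>.\<close>

lemma is_successor_graft_iff: "is_successor a (graft n b) \<longleftrightarrow> (\<exists>c. a = graft n c \<and> is_successor c b)"
proof
  assume "is_successor a (graft n b)"
  then obtain m where m: "finite b" "\<forall>k\<in>graft n b. k < m" "a = insert m (graft n b)"
    by (auto simp: is_successor_iff)
  then have nm: "n < m" by (auto simp: graft_def)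
  define j where "j = m - Suc n"
  have j: "m = Suc n + j" using nm by (simp add: j_def)
  have "a = graft n (insert j b)" using m by (auto simp: graft_def j)
  moreover have "is_successor (insert j b) b" using m by (auto simp: is_successor_iff graft_def j)
  ultimately show "\<exists>c. a = graft n c \<and> is_successor c b" by blast
next
  assume "\<exists>c. a = graft n c \<and> is_successor c b"
  then obtain m where "finite b" "\<forall>k\<in>b. k < m" "a = graft n (insert m b)"
    by (auto simp: is_successor_iff)
  then show "is_successor a (graft n b)"
    by (auto simp: is_successor_iff graft_def intro!: exI[of _ "Suc n + m"])
qed

lemma predecessor_graft:
  assumes "finite b" "b \<noteq> {}"
  shows "predecessor (graft n b) = graft n (predecessor b)"
  using predecessor_remove_Max(2)[OF assms] by (intro predecessor_eq) (auto simp: is_successor_graft_iff)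

section \<open>Hanging a sequence of trees below one root\<close>

definition grafted_tree :: "(nat \<Rightarrow> nat set set) \<Rightarrow> nat set set" where
  "grafted_tree S = insert {} (\<Union>n. graft n ` S n)"

text \<open>A tree-map vanishes at its root, so the place of the root of the tree number
  \<open>n\<close>, which becomes the node \<open>{n}\<close>, is free to carry
  \<open>y n\<close>.\<close>

definition grafted_map :: "(nat \<Rightarrow> 'a::real_vector) \<Rightarrow> (nat \<Rightarrow> nat set \<Rightarrow> 'a) \<Rightarrow> nat set \<Rightarrow> 'a" where
  "grafted_map y z a = (if a = {} then 0 else if graft_node a = {} then y (graft_root a)
     else z (graft_root a) (graft_node a))"

lemma grafted_map_simps [simp]:
  "grafted_map y z {} = 0" "grafted_map y z (graft n {}) = y n"
  "b \<noteq> {} \<Longrightarrow> grafted_map y z (graft n b) = z n b"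
  by (simp_all add: grafted_map_def)

lemma graft_in_grafted_tree [simp]: "graft n b \<in> grafted_tree S \<longleftrightarrow> b \<in> S n"
  by (auto simp: grafted_tree_def)

lemma empty_in_grafted_tree [simp]: "{} \<in> grafted_tree S"
  by (simp add: grafted_tree_def)

lemma successors_grafted_empty:
  assumes "\<And>n. {} \<in> S n"
  shows "successors (grafted_tree S) {} = range (\<lambda>n. graft n {})"
  using assms by (auto simp: successors_def is_successor_empty_iff)

lemma successors_grafted_graft: "successors (grafted_tree S) (graft n b) = graft n ` successors (S n) b"
  by (auto simp: successors_def is_successor_graft_iff)

lemma full_tree_grafted:
  assumes S: "\<And>n. full_tree (S n)"
  shows "full_tree (grafted_tree S)"
  unfolding full_tree_def
proof (intro conjI ballI impI)
  note e = empty_in_full_tree[OF S]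
  fix a assume a: "a \<in> grafted_tree S"
  then consider "a = {}" | n b where "a = graft n b" "b \<in> S n" by (auto simp: grafted_tree_def)
  note cs = this
  show "finite a" using cs finite_full_tree[OF S] by cases auto
  show "infinite (successors (grafted_tree S) a)"
    using cs
  proof cases
    case 1
    then show ?thesis
      by (auto simp: successors_grafted_empty[OF e] inj_def intro!: range_inj_infinite)
  next
    case (2 n b)
    then have "infinite (successors (S n) b)" using S by (auto simp: full_tree_def)
    then show ?thesis using 2 by (simp add: successors_grafted_graft finite_image_iff inj_on_def)
  qed
  show "predecessor a \<in> grafted_tree S" if "a \<noteq> {}"
    using cs
  proof cases
    case (2 n b)
    show ?thesis
    proof (cases "b = {}")
      case True
      then have "predecessor a = {}" using 2 by (intro predecessor_eq) (auto simp: is_successor_empty_iff)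
      then show ?thesis by simp
    next
      case False
      then show ?thesis using 2 S predecessor_graft[of b n] finite_full_tree[OF S, of b n]
        by (auto simp: full_tree_def)
    qed
  qed (use that in simp)
qed simp

lemma branch_grafted:
  assumes "branch (grafted_tree S) \<beta>"
  obtains n \<gamma> where "branch (S n) \<gamma>" "\<And>k. \<beta> (Suc k) = graft n (\<gamma> k)" "\<beta> 0 = {}"
proof -
  have \<beta>: "\<beta> 0 = {}" "\<And>k. \<beta> k \<in> grafted_tree S" "\<And>k. is_successor (\<beta> (Suc k)) (\<beta> k)"
    using assms by (auto simp: branch_def)
  obtain n where n: "\<beta> (Suc 0) = graft n {}" using \<beta>(3)[of 0] \<beta>(1) by (auto simp: is_successor_empty_iff)
  define \<gamma> where "\<gamma> k = graft_node (\<beta> (Suc k))" for k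
  have g: "\<beta> (Suc k) = graft n (\<gamma> k)" for k
  proof (induction k)
    case 0 then show ?case by (simp add: \<gamma>_def n)
  next
    case (Suc k)
    then have "is_successor (\<beta> (Suc (Suc k))) (graft n (\<gamma> k))" using \<beta>(3)[of "Suc k"] by simp
    then obtain c where "\<beta> (Suc (Suc k)) = graft n c" by (auto simp: is_successor_graft_iff)
    then show ?case by (simp add: \<gamma>_def)
  qed
  have "branch (S n) \<gamma>"
    unfolding branch_def
  proof (intro conjI allI)
    show "\<gamma> 0 = {}" by (simp add: \<gamma>_def n)
    show "\<gamma> k \<in> S n" for k using \<beta>(2)[of "Suc k"] g[of k] by simp
    show "is_successor (\<gamma> (Suc k)) (\<gamma> k)" for k
      using \<beta>(3)[of "Suc k"] g[of k] g[of "Suc k"] by (auto simp: is_successor_graft_iff)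
  qed
  then show thesis using that g \<beta>(1) by blast
qed

lemma weakly_null_tree_map_grafted:
  fixes y :: "nat \<Rightarrow> 'a::real_normed_vector"
  assumes z: "\<And>n. weakly_null_tree_map (S n) (z n)" and y: "weakly_null y"
  shows "weakly_null_tree_map (grafted_tree S) (grafted_map y z)"
  unfolding weakly_null_tree_map_iff tree_map_def
proof (intro conjI ballI allI impI)
  have S: "full_tree (S n)" for n using z by (auto simp: weakly_null_tree_map_def tree_map_def)
  note e = empty_in_full_tree[OF S]
  show "full_tree (grafted_tree S)" by (rule full_tree_grafted[OF S])
  show "grafted_map y z {} = 0" by simp
  show "finite {a \<in> range \<beta>. grafted_map y z a \<noteq> 0}" if \<beta>: "branch (grafted_tree S) \<beta>" for \<beta>
  proof -
    obtain n \<gamma> where \<gamma>: "branch (S n) \<gamma>" "\<And>k. \<beta> (Suc k) = graft n (\<gamma> k)" "\<beta> 0 = {}"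
      using branch_grafted[OF \<beta>] by blast
    have "{a \<in> range \<beta>. grafted_map y z a \<noteq> 0} \<subseteq> insert (graft n {}) (graft n ` {b\<in>range \<gamma>. z n b \<noteq> 0})"
    proof
      fix a assume "a \<in> {a \<in> range \<beta>. grafted_map y z a \<noteq> 0}"
      then obtain k where k: "a = \<beta> k" "grafted_map y z (\<beta> k) \<noteq> 0" by auto
      then obtain j where "k = Suc j" using \<gamma>(3) by (cases k) auto
      then show "a \<in> insert (graft n {}) (graft n ` {b\<in>range \<gamma>. z n b \<noteq> 0})"
        using k \<gamma>(2)[of j] by (cases "\<gamma> j = {}") auto
    qed
    moreover have "finite {b\<in>range \<gamma>. z n b \<noteq> 0}"
      using z \<gamma>(1) by (auto simp: weakly_null_tree_map_def tree_map_def)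
    ultimately show ?thesis by (meson finite.insertI finite_imageI finite_subset)
  qed
  fix a and \<phi> :: "'a \<Rightarrow> real" and \<epsilon> :: real
  assume h: "a \<in> grafted_tree S" "bounded_linear \<phi>" "\<epsilon> > 0"
  then consider "a = {}" | n b where "a = graft n b" "b \<in> S n" by (auto simp: grafted_tree_def)
  then show "finite {b \<in> successors (grafted_tree S) a. \<epsilon> \<le> \<bar>\<phi> (grafted_map y z b)\<bar>}"
  proof cases
    case 1
    have "(\<lambda>n. \<phi> (y n)) \<longlonglongrightarrow> 0" using y h by (auto simp: weakly_null_def)
    then have "finite {n. \<epsilon> \<le> \<bar>\<phi> (y n)\<bar>}"
      using tendsto_zero_iff_finite[of id UNIV "\<lambda>n. \<phi> (y n)"] h by simp
    then have "finite ((\<lambda>n. graft n {}) ` {n. \<epsilon> \<le> \<bar>\<phi> (y n)\<bar>})" by simp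
    then show ?thesis by (rule rev_finite_subset) (auto simp: 1 successors_grafted_empty[OF e])
  next
    case (2 n b)
    then have "finite {c\<in>successors (S n) b. \<epsilon> \<le> \<bar>\<phi> (z n c)\<bar>}"
      using z h unfolding weakly_null_tree_map_iff by blast
    then have "finite (graft n ` {c\<in>successors (S n) b. \<epsilon> \<le> \<bar>\<phi> (z n c)\<bar>})" by simp
    moreover have "grafted_map y z (graft n c) = z n c" if "is_successor c b" for c
      using is_successor_nonempty[OF that] by simp
    ultimately show ?thesis
      by (elim rev_finite_subset) (auto simp: 2 is_successor_graft_iff successors_def)
  qed
qed

lemma full_tree_grafted_section:
  assumes T: "full_subtree T (grafted_tree S)" and S: "full_tree (S n)" and n: "graft n {} \<in> T"
  shows "full_subtree {b. graft n b \<in> T} (S n)"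
proof -
  let ?T = "{b. graft n b \<in> T}"
  have TS: "T \<subseteq> grafted_tree S" and fT: "full_tree T" using T by (auto simp: full_subtree_def)
  have sub: "?T \<subseteq> S n" using TS by (auto dest: subsetD)
  have "full_tree ?T"
    unfolding full_tree_def
  proof (intro conjI ballI impI)
    show "{} \<in> ?T" using n by simp
    fix b assume b: "b \<in> ?T"
    then show fb: "finite b" using finite_full_tree[OF fT] by force
    have "successors T (graft n b) = graft n ` successors ?T b"
      by (auto simp: successors_def is_successor_graft_iff)
    moreover have "infinite (successors T (graft n b))" using fT b by (auto simp: full_tree_def)
    ultimately show "infinite (successors ?T b)" by auto
    assume "b \<noteq> {}"
    then show "predecessor b \<in> ?T"
      using fT b predecessor_graft[OF fb, of n] by (fastforce simp: full_tree_def)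
  qed
  then show ?thesis using sub by (simp add: full_subtree_def)
qed

lemma branch_sum_grafted:
  assumes fin: "finite {b\<in>range \<gamma>. z n b \<noteq> 0}" and z0: "z n {} = 0" and \<gamma>0: "\<gamma> 0 = {}"
    and \<beta>: "\<And>k. \<beta> (Suc k) = graft n (\<gamma> k)" "\<beta> 0 = {}"
  shows "branch_sum (grafted_map y z) \<beta> = y n + branch_sum (z n) \<gamma>"
proof -
  let ?F = "{b\<in>range \<gamma>. z n b \<noteq> 0}"
  let ?g = "grafted_map y z"
  have F: "{} \<notin> ?F" using z0 by simp
  have r: "a \<in> range \<beta> \<longleftrightarrow> a = {} \<or> (\<exists>k. a = graft n (\<gamma> k))" for a
    using \<beta> by (metis not0_implies_Suc rangeE rangeI)
  have "branch_sum ?g \<beta> = sum ?g (insert (graft n {}) (graft n ` ?F))"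
    unfolding branch_sum_def
  proof (rule sum.mono_neutral_left)
    show "finite (insert (graft n {}) (graft n ` ?F))" using fin by simp
    show "{a \<in> range \<beta>. ?g a \<noteq> 0} \<subseteq> insert (graft n {}) (graft n ` ?F)"
    proof
      fix a assume "a \<in> {a \<in> range \<beta>. ?g a \<noteq> 0}"
      then obtain k where "a = graft n (\<gamma> k)" "?g a \<noteq> 0" by (auto simp: r)
      then show "a \<in> insert (graft n {}) (graft n ` ?F)" by (cases "\<gamma> k = {}") auto
    qed
    have "insert (graft n {}) (graft n ` ?F) \<subseteq> range \<beta>"
      using r[of "graft n {}"] \<gamma>0 by (auto simp: r)
    then show "\<forall>i\<in>insert (graft n {}) (graft n ` ?F) - {a \<in> range \<beta>. ?g a \<noteq> 0}. ?g i = 0" by auto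
  qed
  also have "\<dots> = ?g (graft n {}) + sum ?g (graft n ` ?F)"
    using fin F by (subst sum.insert) auto
  also have "sum ?g (graft n ` ?F) = (\<Sum>b\<in>?F. ?g (graft n b))"
    by (subst sum.reindex) (auto simp: inj_on_def)
  also have "\<dots> = (\<Sum>b\<in>?F. z n b)"
  proof (intro sum.cong refl)
    fix b assume "b \<in> ?F"
    then have "b \<noteq> {}" using F by metis
    then show "?g (graft n b) = z n b" by simp
  qed
  finally show ?thesis by (simp add: branch_sum_def)
qed

section \<open>The convex set behind the new norm\<close>

definition tree_bounded_set :: "real \<Rightarrow> 'a::real_normed_vector set" where
  "tree_bounded_set \<sigma> = {x. \<forall>S z. weakly_null_tree_map S z \<longrightarrow> (\<forall>a\<in>S. norm (z a) \<le> \<sigma>) \<longrightarrow>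
     (\<exists>T. full_subtree T S \<and> (\<forall>\<beta>. branch T \<beta> \<longrightarrow> norm (x + branch_sum z \<beta>) \<le> 1))}"

lemma tree_bounded_setD:
  assumes "x \<in> tree_bounded_set \<sigma>" "weakly_null_tree_map S z" "\<And>a. a \<in> S \<Longrightarrow> norm (z a) \<le> \<sigma>"
  obtains T where "full_subtree T S" "\<And>\<beta>. branch T \<beta> \<Longrightarrow> norm (x + branch_sum z \<beta>) \<le> 1"
  using assms unfolding tree_bounded_set_def by blast

text \<open>If every \<open>x + y n\<close> had a bad tree \<open>S n\<close>, these trees could be
  hung below nodes carrying the \<open>y n\<close>. A good subtree for \<open>x\<close> contains
  some \<open>{n}\<close>, and its part below that node would be a good subtree of
  \<open>S n\<close> for \<open>x + y n\<close>.\<close>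

lemma tree_bounded_set_add_weakly_null:
  fixes y :: "nat \<Rightarrow> 'a::real_normed_vector"
  assumes x: "x \<in> tree_bounded_set \<sigma>" and y: "weakly_null y" "\<And>n. norm (y n) \<le> \<sigma>" and \<sigma>: "\<sigma> \<ge> 0"
  shows "\<exists>n. x + y n \<in> tree_bounded_set \<sigma>"
proof (rule ccontr)
  assume "\<not> ?thesis"
  then have "\<forall>n. \<exists>S z. weakly_null_tree_map S z \<and> (\<forall>a\<in>S. norm (z a) \<le> \<sigma>) \<and>
      \<not> (\<exists>T. full_subtree T S \<and> (\<forall>\<beta>. branch T \<beta> \<longrightarrow> norm (x + y n + branch_sum z \<beta>) \<le> 1))"
    by (simp add: tree_bounded_set_def)
  then obtain S z where
    z: "\<And>n. weakly_null_tree_map (S n) (z n)" and zb: "\<And>n a. a \<in> S n \<Longrightarrow> norm (z n a) \<le> \<sigma>" and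
    bad: "\<And>n. \<not> (\<exists>T. full_subtree T (S n) \<and> (\<forall>\<beta>. branch T \<beta> \<longrightarrow> norm (x + y n + branch_sum (z n) \<beta>) \<le> 1))"
    by metis
  have S: "full_tree (S n)" and z0: "z n {} = 0" for n
    using z[of n] by (auto simp: weakly_null_tree_map_def tree_map_def)
  have "norm (grafted_map y z a) \<le> \<sigma>" if a: "a \<in> grafted_tree S" for a
  proof -
    consider "a = {}" | n b where "a = graft n b" "b \<in> S n" using a by (auto simp: grafted_tree_def)
    then show ?thesis
    proof cases
      case (2 n b)
      then show ?thesis using y(2)[of n] zb[of b n] by (cases "b = {}") auto
    qed (use \<sigma> in simp)
  qed
  then obtain T where T: "full_subtree T (grafted_tree S)"
    and TB: "\<And>\<beta>. branch T \<beta> \<Longrightarrow> norm (x + branch_sum (grafted_map y z) \<beta>) \<le> 1"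
    using tree_bounded_setD[OF x weakly_null_tree_map_grafted[of S z y, OF z y(1)]] by blast
  have fT: "full_tree T" using T by (simp add: full_subtree_def)
  have "infinite (successors T {})" using fT by (auto simp: full_tree_def)
  then have "successors T {} \<noteq> {}" by auto
  then obtain n where n: "graft n {} \<in> T" by (auto simp: successors_def is_successor_empty_iff)
  have "norm (x + y n + branch_sum (z n) \<gamma>) \<le> 1" if \<gamma>: "branch {b. graft n b \<in> T} \<gamma>" for \<gamma>
  proof -
    define \<beta> where "\<beta> k = (case k of 0 \<Rightarrow> {} | Suc k \<Rightarrow> graft n (\<gamma> k))" for k
    have \<gamma>0: "\<gamma> 0 = {}" using \<gamma> by (simp add: branch_def)
    have "branch T \<beta>"
      unfolding branch_def
    proof (intro conjI allI)
      show "\<beta> 0 = {}" by (simp add: \<beta>_def)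
      fix k
      show "\<beta> k \<in> T" using \<gamma> empty_in_full_tree[OF fT] by (cases k) (auto simp: \<beta>_def branch_def)
      show "is_successor (\<beta> (Suc k)) (\<beta> k)"
        using \<gamma> \<gamma>0 by (cases k) (auto simp: \<beta>_def branch_def is_successor_graft_iff is_successor_empty_iff)
    qed
    moreover have "finite {b\<in>range \<gamma>. z n b \<noteq> 0}"
      using branch_mono[OF \<gamma>] full_tree_grafted_section[OF T S n] z[of n]
      by (auto simp: full_subtree_def weakly_null_tree_map_def tree_map_def)
    then have "branch_sum (grafted_map y z) \<beta> = y n + branch_sum (z n) \<gamma>"
      by (rule branch_sum_grafted[where z = z and \<gamma> = \<gamma> and n = n, OF _ z0 \<gamma>0]) (auto simp: \<beta>_def)
    ultimately show ?thesis using TB[of \<beta>] by (simp add: add.assoc)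
  qed
  then show False using bad[of n] full_tree_grafted_section[OF T S n] by blast
qed

text \<open>Test with the zero tree-map, whose branch sums leave \<open>x\<close> unchanged.\<close>

lemma tree_bounded_set_subset_ball:
  assumes x: "x \<in> tree_bounded_set \<sigma>" and \<sigma>: "\<sigma> \<ge> 0"
  shows "norm x \<le> 1"
proof -
  have "weakly_null_tree_map {a :: nat set. finite a} (\<lambda>_. 0 :: 'a)"
    using full_tree_finite_sets
    by (auto simp: weakly_null_tree_map_def tree_map_def weakly_null_def linear_simps)
  then obtain T where T: "full_subtree T {a. finite a}" "\<And>\<beta>. branch T \<beta> \<Longrightarrow> norm (x + branch_sum (\<lambda>_. 0) \<beta>) \<le> 1"
    using tree_bounded_setD[OF x] \<sigma> by (metis norm_zero)
  obtain \<beta> where "branch T \<beta>" using T(1) full_tree_has_branch by (auto simp: full_subtree_def)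
  then show ?thesis using T(2)[of \<beta>] by (simp add: branch_sum_def)
qed

text \<open>The nodes are halved so that the tree property, applied to the doubled tree, leaves
  branch sums of norm at most 1/2 and the other half is free for \<open>x\<close>.\<close>

lemma ball_subset_tree_bounded_set:
  assumes btp: "bounded_tree_property_with TYPE('a::real_normed_vector) \<sigma>" and x: "norm (x :: 'a) \<le> 1/2"
  shows "x \<in> tree_bounded_set (\<sigma> / 2)"
  unfolding tree_bounded_set_def
proof (intro CollectI allI impI)
  fix S and z :: "nat set \<Rightarrow> 'a"
  assume z: "weakly_null_tree_map S z" "\<forall>a\<in>S. norm (z a) \<le> \<sigma> / 2"
  have "weakly_null_tree_map S (\<lambda>a. 2 *\<^sub>R z a)" "\<forall>a\<in>S. norm (2 *\<^sub>R z a) \<le> \<sigma>"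
    using weakly_null_tree_map_scaleR[OF z(1)] z(2) by auto
  then obtain T where T: "full_subtree T S" "\<forall>\<beta>. branch T \<beta> \<longrightarrow> norm (branch_sum (\<lambda>a. 2 *\<^sub>R z a) \<beta>) \<le> 1"
    using btp unfolding bounded_tree_property_with_def by blast
  have "norm (x + branch_sum z \<beta>) \<le> 1" if "branch T \<beta>" for \<beta>
    using T(2) that x norm_triangle_ineq[of x "branch_sum z \<beta>"] by (fastforce simp: branch_sum_scaleR)
  then show "\<exists>T. full_subtree T S \<and> (\<forall>\<beta>. branch T \<beta> \<longrightarrow> norm (x + branch_sum z \<beta>) \<le> 1)"
    using T(1) by blast
qed

lemma tree_bounded_set_uminus:
  assumes "x \<in> tree_bounded_set \<sigma>"
  shows "- x \<in> tree_bounded_set \<sigma>"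
  unfolding tree_bounded_set_def
proof (intro CollectI allI impI)
  fix S and z :: "nat set \<Rightarrow> 'a"
  assume z: "weakly_null_tree_map S z" "\<forall>a\<in>S. norm (z a) \<le> \<sigma>"
  obtain T where T: "full_subtree T S" "\<And>\<beta>. branch T \<beta> \<Longrightarrow> norm (x + branch_sum (\<lambda>a. (-1) *\<^sub>R z a) \<beta>) \<le> 1"
    using tree_bounded_setD[OF assms weakly_null_tree_map_scaleR[OF z(1), of "-1"]] z(2) by auto
  have "norm (- x + branch_sum z \<beta>) \<le> 1" if "branch T \<beta>" for \<beta>
    using T(2)[OF that] by (simp add: branch_sum_scaleR[of "-1", simplified] norm_minus_commute)
  then show "\<exists>T. full_subtree T S \<and> (\<forall>\<beta>. branch T \<beta> \<longrightarrow> norm (- x + branch_sum z \<beta>) \<le> 1)"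
    using T(1) by blast
qed

text \<open>One subtree has to serve both points: the tree is thinned out for \<open>x\<close>, and
  the resulting subtree once more for \<open>y\<close>.\<close>

lemma convex_tree_bounded_set: "convex (tree_bounded_set \<sigma>)"
proof (rule convexI)
  fix x y :: 'a and s t :: real
  assume x: "x \<in> tree_bounded_set \<sigma>" and y: "y \<in> tree_bounded_set \<sigma>" and st: "0 \<le> s" "0 \<le> t" "s + t = 1"
  show "s *\<^sub>R x + t *\<^sub>R y \<in> tree_bounded_set \<sigma>"
    unfolding tree_bounded_set_def
  proof (intro CollectI allI impI)
    fix S and z :: "nat set \<Rightarrow> 'a"
    assume z: "weakly_null_tree_map S z" "\<forall>a\<in>S. norm (z a) \<le> \<sigma>"
    obtain T where T: "full_subtree T S" "\<And>\<beta>. branch T \<beta> \<Longrightarrow> norm (x + branch_sum z \<beta>) \<le> 1"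
      using tree_bounded_setD[OF x z(1)] z(2) by auto
    obtain U where U: "full_subtree U T" "\<And>\<beta>. branch U \<beta> \<Longrightarrow> norm (y + branch_sum z \<beta>) \<le> 1"
      using tree_bounded_setD[OF y weakly_null_tree_map_subtree[OF z(1) T(1)]] z(2) T(1)
      by (auto simp: full_subtree_def subset_iff)
    have "norm (s *\<^sub>R x + t *\<^sub>R y + branch_sum z \<beta>) \<le> 1" if \<beta>: "branch U \<beta>" for \<beta>
    proof -
      let ?b = "branch_sum z \<beta>"
      have "s *\<^sub>R x + t *\<^sub>R y + ?b = s *\<^sub>R (x + ?b) + t *\<^sub>R (y + ?b)"
        using st(3) by (simp add: scaleR_add_right algebra_simps flip: scaleR_add_left)
      also have "norm \<dots> \<le> s * norm (x + ?b) + t * norm (y + ?b)"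
        using st by (intro order_trans[OF norm_triangle_ineq]) simp
      also have "\<dots> \<le> s * 1 + t * 1"
        using T(2) U(2)[OF \<beta>] branch_mono[OF \<beta>] U(1) st
        by (intro add_mono mult_left_mono) (auto simp: full_subtree_def)
      finally show ?thesis using st by simp
    qed
    moreover have "full_subtree U S" using T(1) U(1) by (auto simp: full_subtree_def)
    ultimately show "\<exists>T. full_subtree T S \<and> (\<forall>\<beta>. branch T \<beta> \<longrightarrow> norm (s *\<^sub>R x + t *\<^sub>R y + branch_sum z \<beta>) \<le> 1)"
      by blast
  qed
qed

text \<open>The Minkowski functional of \<open>A\<close>. As \<open>A\<close> need not be closed,
  its relation to the unit ball of \<open>N\<close> is expressed by two inclusions, one with the
  open and one with the closed ball.\<close>

lemma gauge_is_norm: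
  fixes A :: "'a::real_normed_vector set"
  assumes conv: "convex A" and sym: "\<And>x. x \<in> A \<Longrightarrow> - x \<in> A"
    and inner: "\<And>x. norm x \<le> 1/2 \<Longrightarrow> x \<in> A" and outer: "\<And>x. x \<in> A \<Longrightarrow> norm x \<le> 1"
  obtains N :: "'a \<Rightarrow> real" where
    "\<And>x y. N (x + y) \<le> N x + N y" "\<And>c x. N (c *\<^sub>R x) = \<bar>c\<bar> * N x"
    "\<And>x. norm x \<le> N x" "\<And>x. N x \<le> 2 * norm x"
    "\<And>x. N x < 1 \<Longrightarrow> x \<in> A" "\<And>x. x \<in> A \<Longrightarrow> N x \<le> 1"
proof -
  define T where "T x = {t. t > 0 \<and> (1/t) *\<^sub>R x \<in> A}" for x
  define N where "N x = Inf (T x)" for x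
  have big: "t \<in> T x" if "t > 2 * norm x" for t x
  proof -
    have t: "t > 0" using that norm_ge_zero[of x] by linarith
    have "norm ((1/t) *\<^sub>R x) \<le> 1/2" using that t by (simp add: field_simps)
    then show ?thesis using inner t by (simp add: T_def)
  qed
  have ne: "T x \<noteq> {}" for x using big[of x "2 * norm x + 1"] by auto
  have lower: "norm x \<le> t" if "t \<in> T x" for t x
    using outer[of "(1/t) *\<^sub>R x"] that by (auto simp: T_def field_simps)
  have bdd: "bdd_below (T x)" for x using lower[of _ x] by (auto simp: bdd_below_def)
  have Nle: "N x \<le> t" if "t \<in> T x" for t x unfolding N_def by (rule cInf_lower[OF that bdd])
  have Nge: "c \<le> N x" if "\<And>t. t \<in> T x \<Longrightarrow> c \<le> t" for c x
    unfolding N_def by (rule cInf_greatest[OF ne that])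
  have norm_le: "norm x \<le> N x" for x by (rule Nge[OF lower])
  have le_norm: "N x \<le> 2 * norm x" for x
    by (rule dense_ge) (use Nle[OF big] in auto)
  have zero: "0 \<in> A" by (rule inner) simp
  have scale: "c *\<^sub>R x \<in> A" if "x \<in> A" "0 \<le> c" "c \<le> 1" for x c
    using convexD[OF conv that(1) zero, of c "1 - c"] that by simp
  have up: "s \<in> T x" if s: "N x < s" for s x
  proof -
    obtain t where t: "t \<in> T x" "t < s" using s cInf_lessD[OF ne] unfolding N_def by blast
    have "(t/s) *\<^sub>R ((1/t) *\<^sub>R x) \<in> A" by (rule scale) (use t in \<open>auto simp: T_def\<close>)
    then show ?thesis using t by (simp add: T_def)
  qed
  have tri: "N (x + y) \<le> N x + N y" for x y
  proof (rule field_le_epsilon)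
    fix e :: real assume e: "e > 0"
    define s where "s = N x + e/2"
    define t where "t = N y + e/2"
    have s: "s \<in> T x" and t: "t \<in> T y" unfolding s_def t_def by (rule up, use e in simp)+
    then have st: "s > 0" "t > 0" by (auto simp: T_def)
    have "(s/(s+t)) *\<^sub>R ((1/s) *\<^sub>R x) + (t/(s+t)) *\<^sub>R ((1/t) *\<^sub>R y) \<in> A"
      by (rule convexD[OF conv]) (use s t st in \<open>auto simp: T_def simp flip: add_divide_distrib\<close>)
    also have "(s/(s+t)) *\<^sub>R ((1/s) *\<^sub>R x) + (t/(s+t)) *\<^sub>R ((1/t) *\<^sub>R y) = (1/(s+t)) *\<^sub>R (x + y)"
      using st by (simp add: scaleR_add_right)
    finally have "s + t \<in> T (x + y)" using st by (simp add: T_def)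
    then show "N (x + y) \<le> N x + N y + e" using Nle by (fastforce simp: s_def t_def)
  qed
  have pos: "N (c *\<^sub>R x) \<le> c * N x" if c: "c > 0" for c x
  proof -
    have "N (c *\<^sub>R x) / c \<le> N x"
    proof (rule Nge)
      fix t assume "t \<in> T x"
      then have "c * t \<in> T (c *\<^sub>R x)" using c by (simp add: T_def)
      from Nle[OF this] show "N (c *\<^sub>R x) / c \<le> t" using c by (simp add: field_simps)
    qed
    then show ?thesis using c by (simp add: field_simps)
  qed
  have pos_eq: "N (c *\<^sub>R x) = c * N x" if c: "c > 0" for c x
    using pos[OF c, of x] pos[of "1/c" "c *\<^sub>R x"] c by (simp add: field_simps)
  have neg: "N (- x) = N x" for x
  proof -
    have "T (- x) = T x" using sym[of "(1/_) *\<^sub>R x"] sym[of "- ((1/_) *\<^sub>R x)"] by (auto simp: T_def)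
    then show ?thesis by (simp add: N_def)
  qed
  have hom: "N (c *\<^sub>R x) = \<bar>c\<bar> * N x" for c x
  proof -
    consider "c = 0" | "c > 0" | "c < 0" by linarith
    then show ?thesis
    proof cases
      case 1
      then show ?thesis using le_norm[of 0] norm_le[of 0] by simp
    next
      case 3
      then show ?thesis using pos_eq[of "- c" x] neg[of "c *\<^sub>R x"] by simp
    qed (simp add: pos_eq)
  qed
  show thesis
  proof (rule that[OF tri hom norm_le le_norm])
    show "x \<in> A" if "N x < 1" for x using up[OF that] by (simp add: T_def)
    show "N x \<le> 1" if "x \<in> A" for x by (rule Nle) (use that in \<open>simp add: T_def\<close>)
  qed
qed

lemma bounded_tree_property_renorming:
  assumes "bounded_tree_property TYPE('a::real_normed_vector)"
  obtains N :: "'a::real_normed_vector \<Rightarrow> real" and \<theta> :: real where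
    "\<And>x y. N (x + y) \<le> N x + N y" "\<And>c x. N (c *\<^sub>R x) = \<bar>c\<bar> * N x"
    "\<And>x. norm x \<le> N x" "\<And>x. N x \<le> 2 * norm x" "0 < \<theta>" "\<theta> \<le> 1"
    "\<And>x y. N x < 1 \<Longrightarrow> weakly_null y \<Longrightarrow> (\<And>n. N (y n) \<le> \<theta>) \<Longrightarrow> \<exists>n. N (x + y n) \<le> 1"
proof -
  obtain \<sigma> where \<sigma>: "\<sigma> > 0" "bounded_tree_property_with TYPE('a) \<sigma>"
    using assms by (auto simp: bounded_tree_property_def)
  let ?A = "tree_bounded_set (\<sigma>/2) :: 'a set"
  obtain N :: "'a \<Rightarrow> real" where N: "\<And>x y. N (x + y) \<le> N x + N y" "\<And>c x. N (c *\<^sub>R x) = \<bar>c\<bar> * N x"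
    "\<And>x. norm x \<le> N x" "\<And>x. N x \<le> 2 * norm x"
    "\<And>x. N x < 1 \<Longrightarrow> x \<in> ?A" "\<And>x. x \<in> ?A \<Longrightarrow> N x \<le> 1"
    by (rule gauge_is_norm[OF convex_tree_bounded_set tree_bounded_set_uminus])
       (use ball_subset_tree_bounded_set[OF \<sigma>(2)] tree_bounded_set_subset_ball[of _ "\<sigma>/2"] \<sigma>(1) in auto)
  show thesis
  \<comment> \<open>A bound on \<open>N\<close> also bounds the norm, so half of the tree constant
    can be kept; the cap at 1 allows factors \<theta> to be dropped in later estimates.\<close>
  proof (rule that[OF N(1-4), of "min 1 (\<sigma>/2)"])
    fix x and y :: "nat \<Rightarrow> 'a"
    assume h: "N x < 1" "weakly_null y" "\<And>n. N (y n) \<le> min 1 (\<sigma>/2)"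
    have "norm (y n) \<le> \<sigma>/2" for n using N(3)[of "y n"] h(3)[of n] by simp
    then show "\<exists>n. N (x + y n) \<le> 1"
      using tree_bounded_set_add_weakly_null[OF N(5)[OF h(1)] h(2)] N(6) \<sigma>(1) by fastforce
  qed (use \<sigma> in auto)
qed

section \<open>The dual norm and separability of the dual\<close>

text \<open>What renorming, Rosenthal's theorem and separability contribute to the rest of the
  proof. The condition \<open>weakly_null_add\<close> promises a single index, but it can be applied
  to any tail of the sequence.\<close>

locale asymptotic_c0_norm =
  fixes N :: "'a::banach \<Rightarrow> real" and \<theta> :: real and xs :: "nat \<Rightarrow> 'a"
  assumes N_triangle: "\<And>x y. N (x + y) \<le> N x + N y" and N_scaleR: "\<And>c x. N (c *\<^sub>R x) = \<bar>c\<bar> * N x"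
    and norm_le_N: "\<And>x. norm x \<le> N x" and N_le_norm: "\<And>x. N x \<le> 2 * norm x"
    and theta: "0 < \<theta>" "\<theta> \<le> 1"
    and weakly_null_add: "\<And>x y. N x < 1 \<Longrightarrow> weakly_null y \<Longrightarrow> (\<And>n. N (y n) \<le> \<theta>) \<Longrightarrow> \<exists>n. N (x + y n) \<le> 1"
    and weakly_cauchy: "\<And>y B. (\<And>n. norm (y n) \<le> B) \<Longrightarrow>
      \<exists>r. strict_mono (r :: nat \<Rightarrow> nat) \<and> (\<forall>\<phi> :: 'a \<Rightarrow>\<^sub>L real. convergent (\<lambda>n. blinfun_apply \<phi> (y (r n))))"
    and xs_dense: "closure (range xs) = UNIV"
begin

lemma N_zero [simp]: "N 0 = 0"
  using N_scaleR[of 0 0] by simp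

lemma N_nonneg [simp]: "0 \<le> N x"
  using norm_le_N[of x] norm_ge_zero[of x] by linarith

lemma N_uminus [simp]: "N (- x) = N x"
  using N_scaleR[of "-1" x] by simp

lemma N_diff: "N (x - y) \<le> N x + N y"
  using N_triangle[of x "- y"] by simp

lemma N_eq_0_iff [simp]: "N x = 0 \<longleftrightarrow> x = 0"
  using norm_le_N[of x] by auto

text \<open>The norm dual to \<open>N\<close>, kept as a separate function because
  \<open>norm\<close> on this type is dual to the original norm. The ball of \<open>N\<close> is
  symmetric, so no absolute value is taken.\<close>

definition dn :: "('a \<Rightarrow>\<^sub>L real) \<Rightarrow> real" where
  "dn f = (SUP x\<in>{x. N x \<le> 1}. blinfun_apply f x)"

lemma blinfun_le_norm: "N x \<le> 1 \<Longrightarrow> blinfun_apply f x \<le> norm f"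
proof -
  assume "N x \<le> 1"
  then have "norm f * norm x \<le> norm f * 1" using norm_le_N[of x] by (intro mult_left_mono) auto
  then show ?thesis using norm_blinfun[of f x] by simp
qed

lemma dn_upper: "N x \<le> 1 \<Longrightarrow> blinfun_apply f x \<le> dn f"
  unfolding dn_def by (rule cSUP_upper) (use blinfun_le_norm in \<open>auto simp: bdd_above_def\<close>)

lemma dn_least: "(\<And>x. N x \<le> 1 \<Longrightarrow> blinfun_apply f x \<le> c) \<Longrightarrow> dn f \<le> c"
  unfolding dn_def by (rule cSUP_least) (auto intro: exI[of _ 0])

lemma dn_nonneg [simp]: "0 \<le> dn f"
  using dn_upper[of 0 f] by simp

lemma dn_apply: "blinfun_apply f x \<le> dn f * N x"
proof (cases "x = 0")
  case False
  then have p: "N x > 0" using N_nonneg[of x] N_eq_0_iff[of x] by linarith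
  have "blinfun_apply f ((1 / N x) *\<^sub>R x) \<le> dn f"
    by (rule dn_upper) (use p in \<open>simp add: N_scaleR\<close>)
  then show ?thesis using p by (simp add: blinfun.scaleR_right field_simps)
qed simp

lemma dn_abs_apply: "\<bar>blinfun_apply f x\<bar> \<le> dn f * N x"
  using dn_apply[of f x] dn_apply[of f "- x"] by (simp add: blinfun.minus_right abs_le_iff)

lemma dn_triangle: "dn (f + g) \<le> dn f + dn g"
  by (rule dn_least) (simp add: blinfun.add_left add_mono dn_upper)

lemma dn_zero [simp]: "dn 0 = 0"
  by (intro antisym dn_least) simp_all

lemma dn_scaleR_le: "dn (c *\<^sub>R f) \<le> \<bar>c\<bar> * dn f"
proof (rule dn_least)
  fix x assume x: "N x \<le> 1"
  have "c * blinfun_apply f x \<le> \<bar>c\<bar> * \<bar>blinfun_apply f x\<bar>" by (simp flip: abs_mult)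
  also have "\<dots> \<le> \<bar>c\<bar> * (dn f * N x)" by (intro mult_left_mono dn_abs_apply) simp
  also have "\<dots> \<le> \<bar>c\<bar> * (dn f * 1)" using x by (intro mult_left_mono) simp_all
  finally show "blinfun_apply (c *\<^sub>R f) x \<le> \<bar>c\<bar> * dn f" by (simp add: blinfun.scaleR_left)
qed

lemma dn_scaleR: "dn (c *\<^sub>R f) = \<bar>c\<bar> * dn f"
proof (cases "c = 0")
  case False
  have "dn f \<le> \<bar>1/c\<bar> * dn (c *\<^sub>R f)" using dn_scaleR_le[of "1/c" "c *\<^sub>R f"] False by simp
  then have "\<bar>c\<bar> * dn f \<le> dn (c *\<^sub>R f)" using False by (simp add: field_simps)
  then show ?thesis using dn_scaleR_le[of c f] by simp
qed simp

lemma dn_uminus [simp]: "dn (- f) = dn f"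
  using dn_scaleR[of "-1" f] by simp

lemma dn_diff: "dn (f - g) \<le> dn f + dn g"
  using dn_triangle[of f "- g"] by simp

lemma dn_minus_commute: "dn (f - g) = dn (g - f)"
  using dn_uminus[of "f - g"] by simp

lemma dn_diff_triangle: "dn (f - h) \<le> dn (f - g) + dn (g - h)"
  using dn_triangle[of "f - g" "g - h"] by simp

lemma dn_le_norm: "dn f \<le> norm f"
  by (rule dn_least) (rule blinfun_le_norm)

lemma norm_le_dn: "norm f \<le> 2 * dn f"
proof (rule norm_blinfun_bound)
  fix x
  have "\<bar>blinfun_apply f x\<bar> \<le> dn f * N x" by (rule dn_abs_apply)
  also have "\<dots> \<le> dn f * (2 * norm x)" by (intro mult_left_mono N_le_norm) simp
  finally show "norm (blinfun_apply f x) \<le> 2 * dn f * norm x" by simp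
qed simp

text \<open>The strict bound on \<open>N x\<close> is the point, since
  \<open>weakly_null_add\<close> accepts only vectors of the open ball. A nearly norming vector of
  the closed ball is shrunk slightly.\<close>

lemma dn_approx:
  assumes "e > 0"
  shows "\<exists>x. N x < 1 \<and> dn f - e < blinfun_apply f x"
proof -
  have "\<exists>x\<in>{x. N x \<le> 1}. dn f - e/2 < blinfun_apply f x"
  proof (rule ccontr)
    assume "\<not> ?thesis"
    then have "dn f \<le> dn f - e/2" by (intro dn_least) (auto simp: not_less)
    then show False using assms by simp
  qed
  then obtain x where x: "N x \<le> 1" "dn f - e/2 < blinfun_apply f x" by auto
  \<comment> \<open>Shrinking by the factor \<open>1 - d\<close> costs at most e/2 of the value at
    \<open>x\<close>.\<close>
  define d where "d = min (1/2) (e / (2 * (\<bar>blinfun_apply f x\<bar> + 1)))"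
  have d: "0 < d" "d \<le> 1/2" unfolding d_def using assms by (simp, intro min.cobounded1)
  have "d * blinfun_apply f x \<le> d * (\<bar>blinfun_apply f x\<bar> + 1)" using d by (intro mult_left_mono) auto
  also have "\<dots> \<le> (e / (2 * (\<bar>blinfun_apply f x\<bar> + 1))) * (\<bar>blinfun_apply f x\<bar> + 1)"
    by (intro mult_right_mono) (auto simp: d_def)
  also have "\<dots> = e/2" by (simp add: divide_simps)
  finally have "d * blinfun_apply f x \<le> e/2" .
  then have "dn f - e < blinfun_apply f ((1 - d) *\<^sub>R x)"
    using x by (simp add: blinfun.scaleR_right left_diff_distrib)
  moreover have "N ((1 - d) *\<^sub>R x) < 1"
  proof -
    have "N ((1 - d) *\<^sub>R x) = (1 - d) * N x" using d by (simp add: N_scaleR)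
    also have "\<dots> \<le> (1 - d) * 1" using x d by (intro mult_left_mono) auto
    finally show ?thesis using d by simp
  qed
  ultimately show ?thesis by blast
qed

text \<open>
  The dual form of the asymptotic \<open>c\<^sub>0\<close> property. The vectors norming the \<open>g n\<close> become weakly
  null after passing to a weakly Cauchy subsequence and subtracting.
\<close>

lemma dn_add_weakstar_null:
  assumes g: "\<And>x. (\<lambda>n. blinfun_apply (g n) x) \<longlonglongrightarrow> 0" and e: "e > 0"
  shows "\<exists>n. dn f + \<theta>/2 * dn (g n) - e \<le> dn (f + g n)"
proof -
  have "\<forall>n. \<exists>y. N y < 1 \<and> dn (g n) - e/4 < blinfun_apply (g n) y"
    using dn_approx[of "e/4"] e by simp
  then obtain y where y: "\<And>n. N (y n) < 1" "\<And>n. dn (g n) - e/4 < blinfun_apply (g n) (y n)" by metis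
  have "norm (y n) \<le> 1" for n using norm_le_N[of "y n"] y(1)[of n] by simp
  then obtain r where r: "strict_mono (r :: nat \<Rightarrow> nat)"
    and rc: "\<And>\<phi> :: 'a \<Rightarrow>\<^sub>L real. convergent (\<lambda>n. blinfun_apply \<phi> (y (r n)))"
    using weakly_cauchy[of y 1] by blast
  define h where "h n = g (r n)" for n
  define v where "v n = y (r n)" for n
  have h0: "(\<lambda>n. blinfun_apply (h n) x) \<longlonglongrightarrow> 0" for x
    using LIMSEQ_subseq_LIMSEQ[OF g r] by (simp add: h_def o_def)
  have "\<exists>l\<ge>n. \<bar>blinfun_apply (h l) (v n)\<bar> < e/4" for n
  proof -
    have "\<forall>\<^sub>F l in sequentially. \<bar>blinfun_apply (h l) (v n)\<bar> < e/4"
      using tendstoD[OF h0, of "e/4"] e by (simp add: dist_real_def)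
    then obtain l0 where "\<forall>l\<ge>l0. \<bar>blinfun_apply (h l) (v n)\<bar> < e/4" by (auto simp: eventually_sequentially)
    then show ?thesis by (intro exI[of _ "max l0 n"]) auto
  qed
  \<comment> \<open>The functional \<open>h (l n)\<close> is taken so far out that it nearly
    vanishes at \<open>v n\<close>; on \<open>v (l n) - v n\<close> it then still nearly attains its
    norm.\<close>
  then obtain l where l: "\<And>n. l n \<ge> n" "\<And>n. \<bar>blinfun_apply (h (l n)) (v n)\<bar> < e/4" by metis
  have ltop: "filterlim l sequentially sequentially"
    by (rule filterlim_at_top_mono[OF filterlim_ident]) (use l in auto)
  \<comment> \<open>The difference of two vectors of the unit ball has \<open>N\<close> at most 2,
    so this scaling brings it down to \<theta>.\<close>
  define z where "z n = (\<theta>/2) *\<^sub>R (v (l n) - v n)" for n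
  have z0: "(\<lambda>n. blinfun_apply \<phi> (z n)) \<longlonglongrightarrow> 0" for \<phi> :: "'a \<Rightarrow>\<^sub>L real"
  proof -
    obtain c where c: "(\<lambda>n. blinfun_apply \<phi> (v n)) \<longlonglongrightarrow> c" using rc[of \<phi>] by (auto simp: convergent_def v_def)
    have "(\<lambda>n. \<theta>/2 * (blinfun_apply \<phi> (v (l n)) - blinfun_apply \<phi> (v n))) \<longlonglongrightarrow> \<theta>/2 * (c - c)"
      by (intro tendsto_intros c filterlim_compose[OF c ltop])
    then show ?thesis by (simp add: z_def blinfun.diff_right blinfun.scaleR_right)
  qed
  obtain u where u: "N u < 1" "dn f - e/4 < blinfun_apply f u" using dn_approx[of "e/4" f] e by auto
  have "\<forall>\<^sub>F n in sequentially. \<bar>blinfun_apply f (z n)\<bar> < e/4"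
    using tendstoD[OF z0, of "e/4"] e by (simp add: dist_real_def)
  moreover have "\<forall>\<^sub>F n in sequentially. \<bar>blinfun_apply (h (l n)) u\<bar> < e/4"
    using tendstoD[OF filterlim_compose[OF h0 ltop], of "e/4"] e by (simp add: dist_real_def)
  ultimately have "\<forall>\<^sub>F n in sequentially. \<bar>blinfun_apply f (z n)\<bar> < e/4 \<and> \<bar>blinfun_apply (h (l n)) u\<bar> < e/4"
    by (rule eventually_conj)
  then obtain n0 where n0: "\<And>n. n \<ge> n0 \<Longrightarrow> \<bar>blinfun_apply f (z n)\<bar> < e/4 \<and> \<bar>blinfun_apply (h (l n)) u\<bar> < e/4"
    by (auto simp: eventually_sequentially)
  \<comment> \<open>There is no control over the index that \<open>weakly_null_add\<close> yields;
    dropping the first \<open>n0\<close> terms makes the error terms small at every remaining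
    one.\<close>
  have "weakly_null (\<lambda>n. z (n + n0))"
    unfolding weakly_null_def
  proof (intro allI impI)
    fix \<phi> :: "'a \<Rightarrow> real" assume "bounded_linear \<phi>"
    then show "(\<lambda>n. \<phi> (z (n + n0))) \<longlonglongrightarrow> 0"
      using LIMSEQ_ignore_initial_segment[OF z0[of "Blinfun \<phi>"], of n0] by (simp add: bounded_linear_Blinfun_apply)
  qed
  moreover have "N (z (n + n0)) \<le> \<theta>" for n
  proof -
    have "N (v (l (n + n0)) - v (n + n0)) \<le> 2"
      using N_diff[of "v (l (n + n0))" "v (n + n0)"] y(1)[of "r (l (n + n0))"] y(1)[of "r (n + n0)"] by (simp add: v_def)
    then have "\<theta>/2 * N (v (l (n + n0)) - v (n + n0)) \<le> \<theta>/2 * 2" using theta by (intro mult_left_mono) auto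
    then show ?thesis using theta by (simp add: z_def N_scaleR)
  qed
  ultimately obtain n' where "N (u + z (n' + n0)) \<le> 1" using weakly_null_add[OF u(1)] by blast
  then obtain n where n: "n \<ge> n0" "N (u + z n) \<le> 1" using le_add2 by blast
  let ?h = "h (l n)"
  have "blinfun_apply (f + ?h) (u + z n) \<le> dn (f + ?h)" by (rule dn_upper[OF n(2)])
  moreover have "blinfun_apply (f + ?h) (u + z n) = blinfun_apply f u + blinfun_apply f (z n) + blinfun_apply ?h u
      + \<theta>/2 * (blinfun_apply ?h (v (l n)) - blinfun_apply ?h (v n))"
    by (simp add: z_def blinfun.add_left blinfun.add_right blinfun.diff_right blinfun.scaleR_right algebra_simps)
  moreover have "\<theta>/2 * dn ?h - e/4 \<le> \<theta>/2 * (blinfun_apply ?h (v (l n)) - blinfun_apply ?h (v n))"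
  proof -
    have "\<theta> * e \<le> 1 * e" using theta e by (intro mult_right_mono) auto
    then have "\<theta>/2 * dn ?h - e/4 \<le> \<theta>/2 * (dn ?h - e/2)" by (simp add: right_diff_distrib)
    also have "\<dots> \<le> \<theta>/2 * (blinfun_apply ?h (v (l n)) - blinfun_apply ?h (v n))"
      using y(2)[of "r (l n)"] l(2)[of n] theta by (intro mult_left_mono) (simp_all add: h_def v_def)
    finally show ?thesis .
  qed
  moreover have "- (e/4) < blinfun_apply f (z n)" "- (e/4) < blinfun_apply ?h u"
    using n0[OF n(1)] by auto
  ultimately have "dn f + \<theta>/2 * dn ?h - e \<le> dn (f + ?h)"
    using u(2) by linarith
  then show ?thesis unfolding h_def by blast
qed

lemma pointwise_null_if_dense:
  assumes B: "\<And>n. dn (g n) \<le> B" and g: "\<And>i. (\<lambda>n. blinfun_apply (g n) (xs i)) \<longlonglongrightarrow> 0"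
  shows "(\<lambda>n. blinfun_apply (g n) x) \<longlonglongrightarrow> 0"
proof (rule LIMSEQ_I)
  fix e :: real assume e: "e > 0"
  have B0: "B \<ge> 0" using B[of 0] dn_nonneg order_trans by blast
  define d where "d = e / (4 * (B + 1))"
  have d: "d > 0" using e B0 by (simp add: d_def)
  have "x \<in> closure (range xs)" using xs_dense by simp
  then obtain i where i: "dist (xs i) x < d" using d by (auto simp: closure_approachable)
  have "N (x - xs i) \<le> 2 * d" using N_le_norm[of "x - xs i"] i by (simp add: dist_norm norm_minus_commute)
  then have "B * N (x - xs i) \<le> B * (2 * d)" using B0 by (intro mult_left_mono) auto
  also have "\<dots> \<le> (B + 1) * (2 * d)" using d by (intro mult_right_mono) auto
  also have "\<dots> = e/2" using B0 by (simp add: d_def field_simps)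
  finally have small: "B * N (x - xs i) \<le> e/2" .
  obtain n0 where n0: "\<And>n. n \<ge> n0 \<Longrightarrow> \<bar>blinfun_apply (g n) (xs i)\<bar> < e/2"
    using LIMSEQ_D[OF g[of i], of "e/2"] e by auto
  have "\<bar>blinfun_apply (g n) x\<bar> < e" if "n \<ge> n0" for n
  proof -
    have "\<bar>blinfun_apply (g n) (x - xs i)\<bar> \<le> dn (g n) * N (x - xs i)" by (rule dn_abs_apply)
    also have "\<dots> \<le> B * N (x - xs i)" by (intro mult_right_mono B) simp
    finally show ?thesis using n0[OF that] small by (simp add: blinfun.diff_right)
  qed
  then show "\<exists>n0. \<forall>n\<ge>n0. norm (blinfun_apply (g n) x - 0) < e" by auto
qed

text \<open>
  An uncountable separated set has weak-star condensation points inside itself; at one whose norm is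
  nearly maximal, the lower estimate for \<open>f + g n\<close> is contradictory.
\<close>

lemma countable_separated:
  assumes R: "\<And>f. f \<in> A \<Longrightarrow> dn f \<le> R" and e: "e > 0"
    and sep: "\<And>f g. f \<in> A \<Longrightarrow> g \<in> A \<Longrightarrow> f \<noteq> g \<Longrightarrow> e \<le> dn (f - g)"
  shows "countable A"
proof (rule ccontr)
  assume unc: "\<not> countable A"
  \<comment> \<open>The values on the dense sequence live in a second countable product space, and
    on bounded sets their convergence is weak-star convergence.\<close>
  define E where "E f = (\<lambda>i. blinfun_apply f (xs i))" for f :: "'a \<Rightarrow>\<^sub>L real"
  obtain \<B> :: "(nat \<Rightarrow> real) set set" where \<B>: "countable \<B>" "topological_basis \<B>"
    using ex_countable_basis by blast
  \<comment> \<open>The points that are not condensation points of \<open>A\<close>; a countable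
    basis makes this set countable, so removing it keeps all others condensation points.\<close>
  define A0 where "A0 = (\<Union>U\<in>{U\<in>\<B>. countable (E -` U \<inter> A)}. E -` U \<inter> A)"
  have A0: "countable A0" unfolding A0_def using \<B>(1) by (intro countable_UN) auto
  define A' where "A' = A - A0"
  have "\<not> countable A'" using uncountable_minus_countable[OF unc A0] by (simp add: A'_def)
  then have ne: "A' \<noteq> {}" by auto
  have cond: "\<exists>g\<in>A'. g \<noteq> f \<and> E g \<in> V" if f: "f \<in> A'" and V: "open V" "E f \<in> V" for f V
  proof -
    obtain U where U: "U \<in> \<B>" "E f \<in> U" "U \<subseteq> V" using topological_basisE[OF \<B>(2) V] by blast
    have "\<not> countable (E -` U \<inter> A)" using f U by (auto simp: A'_def A0_def)
    then have "\<not> countable ((E -` U \<inter> A) - (A0 \<union> {f}))"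
      using A0 by (intro uncountable_minus_countable) auto
    then have "(E -` U \<inter> A) - (A0 \<union> {f}) \<noteq> {}" by (metis countable_empty)
    then show ?thesis using U(3) by (auto simp: A'_def)
  qed
  \<comment> \<open>The supremum runs over \<open>A'\<close>, so that it also bounds the neighbours
    \<open>h n\<close>, which are found inside \<open>A'\<close>.\<close>
  define s where "s = (SUP f\<in>A'. dn f)"
  have bdd: "bdd_above (dn ` A')" using R by (auto simp: bdd_above_def A'_def)
  \<comment> \<open>The gain \<theta>/2 * e becomes 4 * \<delta>, against one \<delta> lost in the
    choice of \<open>f\<close> and one in the dual estimate.\<close>
  define \<delta> where "\<delta> = \<theta> * e / 8"
  have \<delta>: "\<delta> > 0" using theta e by (simp add: \<delta>_def)
  obtain f where f: "f \<in> A'" "s - \<delta> < dn f"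
    using less_cSUP_iff[OF ne bdd, of "s - \<delta>"] \<delta> by (auto simp: s_def)
  define V where "V n = (\<Inter>i<n. {h :: nat \<Rightarrow> real. dist (h i) (E f i) < 1 / real (Suc n)})" for n
  have "open (V n)" for n
    unfolding V_def by (intro open_INT finite_lessThan ballI open_Collect_less continuous_intros continuous_on_product_coordinates)
  moreover have "E f \<in> V n" for n by (simp add: V_def)
  ultimately have "\<forall>n. \<exists>g\<in>A'. g \<noteq> f \<and> E g \<in> V n" using cond[OF f(1)] by blast
  then obtain h where h: "\<And>n. h n \<in> A'" "\<And>n. h n \<noteq> f" "\<And>n. E (h n) \<in> V n" by metis
  define g where "g n = h n - f" for n
  have coord: "(\<lambda>n. blinfun_apply (g n) (xs i)) \<longlonglongrightarrow> 0" for i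
  proof (rule Lim_null_comparison)
    show "\<forall>\<^sub>F n in sequentially. norm (blinfun_apply (g n) (xs i)) \<le> 1 / real (Suc n)"
      unfolding eventually_sequentially
    proof (intro exI[of _ "Suc i"] allI impI)
      fix n assume "Suc i \<le> n"
      then have "dist (E (h n) i) (E f i) < 1 / real (Suc n)" using h(3)[of n] by (auto simp: V_def)
      then show "norm (blinfun_apply (g n) (xs i)) \<le> 1 / real (Suc n)"
        by (simp add: E_def g_def blinfun.diff_left dist_real_def)
    qed
    show "(\<lambda>n. 1 / real (Suc n)) \<longlonglongrightarrow> 0" by (rule LIMSEQ_Suc[OF lim_1_over_n])
  qed
  have "dn (g n) \<le> R + R" for n
    using dn_diff[of "h n" f] R[of "h n"] R[of f] h(1)[of n] f(1) by (auto simp: g_def A'_def)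
  then have "(\<lambda>n. blinfun_apply (g n) x) \<longlonglongrightarrow> 0" for x
    by (rule pointwise_null_if_dense[OF _ coord])
  then obtain n where n: "dn f + \<theta>/2 * dn (g n) - \<delta> \<le> dn (f + g n)"
    using dn_add_weakstar_null[of g \<delta> f] \<delta> by blast
  have "e \<le> dn (g n)" using sep[of "h n" f] h(1,2)[of n] f(1) by (auto simp: g_def A'_def)
  then have "\<theta>/2 * e \<le> \<theta>/2 * dn (g n)" using theta by (intro mult_left_mono) auto
  moreover have "dn (f + g n) \<le> s"
    unfolding s_def using cSUP_upper[OF h(1) bdd, of n] by (simp add: g_def)
  moreover have "\<theta>/2 * e = 4 * \<delta>" by (simp add: \<delta>_def)
  ultimately show False using n f(2) \<delta> by simp
qed

text \<open>A maximal separated set is a net of the same radius. The nets for the radii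
  \<open>1 / real (Suc n)\<close> together are dense, and countable by
  \<open>countable_separated\<close>.\<close>

lemma dual_separable: "\<exists>\<phi> :: nat \<Rightarrow> 'a \<Rightarrow>\<^sub>L real. \<forall>f. \<forall>e>0. \<exists>i. dn (f - \<phi> i) < e"
proof -
  define sepd where "sepd e A \<longleftrightarrow> (\<forall>f\<in>A. \<forall>g\<in>A. f \<noteq> g \<longrightarrow> e \<le> dn (f - g))" for e and A :: "('a \<Rightarrow>\<^sub>L real) set"
  have "\<exists>M. sepd e M \<and> (\<forall>f. f \<in> M \<or> (\<exists>g\<in>M. dn (f - g) < e))" for e
  proof -
    have "\<exists>M\<in>Collect (sepd e). \<forall>X\<in>Collect (sepd e). M \<subseteq> X \<longrightarrow> X = M"
    proof (rule subset_Zorn_nonempty)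
      show "Collect (sepd e) \<noteq> {}" by (auto simp: sepd_def intro: exI[of _ "{}"])
      fix C assume C: "subset.chain (Collect (sepd e)) C"
      have "e \<le> dn (f - g)" if "X \<in> C" "f \<in> X" "Y \<in> C" "g \<in> Y" "f \<noteq> g" for f g X Y
      proof -
        have "X \<subseteq> Y \<or> Y \<subseteq> X" "sepd e X" "sepd e Y" using C that by (auto simp: subset_chain_def)
        then show ?thesis using that unfolding sepd_def by blast
      qed
      then show "\<Union>C \<in> Collect (sepd e)" unfolding sepd_def by blast
    qed
    then obtain M where M: "sepd e M" and max: "\<And>X. sepd e X \<Longrightarrow> M \<subseteq> X \<Longrightarrow> X = M" by auto
    have "\<exists>g\<in>M. dn (f - g) < e" if "f \<notin> M" for f
    proof (rule ccontr)
      assume "\<not> ?thesis"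
      then have "sepd e (insert f M)" using M dn_minus_commute[of f] by (auto simp: sepd_def not_less)
      then show False using max[of "insert f M"] that by auto
    qed
    then show ?thesis using M by blast
  qed
  then obtain M where M: "\<And>e. sepd e (M e)" "\<And>e f. f \<in> M e \<or> (\<exists>g\<in>M e. dn (f - g) < e)" by metis
  have "countable (M e)" if "e > 0" for e
  proof -
    \<comment> \<open>Slicing by the norm supplies the bound required by
      \<open>countable_separated\<close>.\<close>
    have "M e = (\<Union>n::nat. {f\<in>M e. dn f \<le> real n})" using real_arch_simple by auto
    moreover have "countable (\<Union>n::nat. {f\<in>M e. dn f \<le> real n})"
    proof (intro countable_UN)
      show "countable {f\<in>M e. dn f \<le> real n}" for n
        by (rule countable_separated[of _ "real n" e]) (use M(1)[of e] that in \<open>auto simp: sepd_def\<close>)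
    qed simp
    ultimately show ?thesis by simp
  qed
  then have cD: "countable (\<Union>n. M (1 / real (Suc n)))" by (intro countable_UN) auto
  have dense: "\<exists>g\<in>(\<Union>n. M (1 / real (Suc n))). dn (f - g) < e" if e: "e > 0" for f e
  proof -
    obtain n where n: "1 / real (Suc n) < e" using e by (metis nat_approx_posE)
    show ?thesis using M(2)[of f "1 / real (Suc n)"]
    proof
      assume "f \<in> M (1 / real (Suc n))"
      then show ?thesis using e by (intro bexI[of _ f]) auto
    next
      assume "\<exists>g\<in>M (1 / real (Suc n)). dn (f - g) < 1 / real (Suc n)"
      then show ?thesis using n by force
    qed
  qed
  have ne: "(\<Union>n. M (1 / real (Suc n))) \<noteq> {}" using dense[of 1 0] by auto
  show ?thesis
  proof (intro exI[of _ "from_nat_into (\<Union>n. M (1 / real (Suc n)))"] allI impI)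
    fix f and e :: real assume "e > 0"
    then obtain g where "g \<in> (\<Union>n. M (1 / real (Suc n)))" "dn (f - g) < e" using dense by blast
    then show "\<exists>i. dn (f - from_nat_into (\<Union>n. M (1 / real (Suc n))) i) < e"
      using from_nat_into_surj[OF cD] by metis
  qed
qed

end

section \<open>Splitting functionals\<close>

locale asymptotic_c0_frame = asymptotic_c0_norm +
  fixes \<phi> :: "nat \<Rightarrow> ('a \<Rightarrow>\<^sub>L real)"
  assumes \<phi>_dense: "\<And>f e. e > 0 \<Longrightarrow> \<exists>i. dn (f - \<phi> i) < e"
begin

section \<open>Finite-dimensional subspaces and uniform estimates\<close>

definition E :: "nat \<Rightarrow> 'a set" where
  "E m = span (xs ` {..<m})"

definition F :: "nat \<Rightarrow> ('a \<Rightarrow>\<^sub>L real) set" where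
  "F k = span (\<phi> ` {..<k})"

definition annE :: "nat \<Rightarrow> ('a \<Rightarrow>\<^sub>L real) set" where
  "annE m = {q. \<forall>u\<in>E m. blinfun_apply q u = 0}"

lemma subspace_E [simp]: "subspace (E m)" by (simp add: E_def)
lemma subspace_F [simp]: "subspace (F k)" by (simp add: F_def)

lemma E_mono: "m \<le> n \<Longrightarrow> E m \<subseteq> E n" unfolding E_def by (intro span_mono) auto
lemma F_mono: "m \<le> n \<Longrightarrow> F m \<subseteq> F n" unfolding F_def by (intro span_mono) auto
lemma annE_antimono: "m \<le> n \<Longrightarrow> annE n \<subseteq> annE m" using E_mono by (auto simp: annE_def)
lemma annE_0 [simp]: "annE 0 = UNIV" by (auto simp: annE_def E_def)

lemma subspace_annE [simp]: "subspace (annE m)"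
  by (auto simp: subspace_def annE_def blinfun.add_left blinfun.scaleR_left)

lemma xs_in_E: "i < m \<Longrightarrow> xs i \<in> E m" unfolding E_def by (auto intro: span_base)

text \<open>Every functional is close to some \<open>\<phi> i\<close>, which vanishes at all but
  finitely many \<open>y n\<close>.\<close>

lemma weakly_null_if_eventually_annihilated:
  assumes y: "\<And>n. N (y n) \<le> B" and \<phi>0: "\<And>n i. i < n \<Longrightarrow> blinfun_apply (\<phi> i) (y n) = 0"
  shows "weakly_null y"
  unfolding weakly_null_def
proof (intro allI impI)
  fix \<psi> :: "'a \<Rightarrow> real" assume "bounded_linear \<psi>"
  then have g: "blinfun_apply (Blinfun \<psi>) = \<psi>" by (rule bounded_linear_Blinfun_apply)
  have B0: "B \<ge> 0" using y[of 0] N_nonneg order_trans by blast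
  show "(\<lambda>n. \<psi> (y n)) \<longlonglongrightarrow> 0"
  proof (rule LIMSEQ_I)
    fix e :: real assume e: "e > 0"
    obtain i where i: "dn (Blinfun \<psi> - \<phi> i) < e / (B + 1)" using \<phi>_dense[of "e / (B+1)"] e B0 by auto
    have "norm (\<psi> (y n) - 0) < e" if "n \<ge> Suc i" for n
    proof -
      have "\<bar>\<psi> (y n)\<bar> = \<bar>blinfun_apply (Blinfun \<psi> - \<phi> i) (y n)\<bar>"
        using \<phi>0[of i n] that by (simp add: g blinfun.diff_left)
      also have "\<dots> \<le> dn (Blinfun \<psi> - \<phi> i) * N (y n)" by (rule dn_abs_apply)
      also have "\<dots> \<le> e / (B + 1) * B" using i y B0 e by (intro mult_mono) auto
      also have "\<dots> < e" using e B0 by (simp add: field_simps)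
      finally show ?thesis by simp
    qed
    then show "\<exists>n0. \<forall>n\<ge>n0. norm (\<psi> (y n) - 0) < e" by blast
  qed
qed

text \<open>Otherwise there are bad pairs for every \<open>k\<close>. A subsequence of the
  \<open>u k\<close> converges in norm to some \<open>l\<close>, as \<open>E m\<close> is
  finite-dimensional, and the \<open>y k\<close> are weakly null, as more and more of the dense
  \<open>\<phi> i\<close> vanish on them. Then \<open>weakly_null_add\<close> at a multiple of
  \<open>l\<close> is contradicted.\<close>

lemma asymptotic_c0_uniform:
  assumes e: "e > 0"
  shows "\<exists>k. \<forall>u\<in>E m. \<forall>y. N u \<le> 1 \<longrightarrow> N y \<le> \<theta> \<longrightarrow> (\<forall>i<k. blinfun_apply (\<phi> i) y = 0) \<longrightarrow> N (u + y) \<le> 1 + e"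
proof (rule ccontr)
  assume "\<not> ?thesis"
  then have "\<forall>k. \<exists>u y. u \<in> E m \<and> N u \<le> 1 \<and> N y \<le> \<theta> \<and> (\<forall>i<k. blinfun_apply (\<phi> i) y = 0) \<and> 1 + e < N (u + y)"
    by (simp add: not_le) blast
  then obtain u y where u: "\<And>k. u k \<in> E m" "\<And>k. N (u k) \<le> 1" and y: "\<And>k. N (y k) \<le> \<theta>"
    "\<And>k i. i < k \<Longrightarrow> blinfun_apply (\<phi> i) (y k) = 0" and big: "\<And>k. 1 + e < N (u k + y k)"
    by metis
  have "norm (u k) \<le> 1" for k using norm_le_N[of "u k"] u(2)[of k] by simp
  then obtain l r where l: "strict_mono (r :: nat \<Rightarrow> nat)" "(u \<circ> r) \<longlonglongrightarrow> l"
    using span_finite_bounded_seq[of "xs ` {..<m}" u 1] u(1) by (auto simp: E_def)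
  have near: "\<exists>n0. \<forall>n\<ge>n0. N (u (r n) - l) < d" if d: "d > 0" for d
  proof -
    obtain n0 where "\<forall>n\<ge>n0. norm ((u \<circ> r) n - l) < d/2" using LIMSEQ_D[OF l(2), of "d/2"] d by auto
    then show ?thesis using N_le_norm[of "u (r _) - l"] by (intro exI[of _ n0]) (smt (verit) comp_apply field_sum_of_halves)
  qed
  have Nl: "N l \<le> 1"
  proof (rule field_le_epsilon)
    fix d :: real assume "d > 0"
    then obtain n where "N (u (r n) - l) < d" using near by blast
    moreover have "N l \<le> N (u (r n)) + N (u (r n) - l)" using N_diff[of "u (r n)" "u (r n) - l"] by simp
    ultimately show "N l \<le> 1 + d" using u(2)[of "r n"] by simp
  qed
  \<comment> \<open>Scaling by \<open>c\<close> moves \<open>l\<close> into the open ball and, when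
    undone, leaves the bound 1 + e/2; the other e/2 pays for the distance from
    \<open>u (r n)\<close> to \<open>l\<close>.\<close>
  define c where "c = 1 / (1 + e/2)"
  have c: "0 < c" "c < 1" "c * (1 + e/2) = 1" using e by (auto simp: c_def field_simps)
  obtain n0 where n0: "\<And>n. n \<ge> n0 \<Longrightarrow> N (u (r n) - l) < e/2" using near[of "e/2"] e by auto
  have "c * N l \<le> c * 1" using Nl c by (intro mult_left_mono) auto
  moreover have "N (c *\<^sub>R l) = c * N l" using c by (simp add: N_scaleR)
  ultimately have "N (c *\<^sub>R l) < 1" using c(2) by linarith
  moreover have small: "N (c *\<^sub>R y k) \<le> \<theta>" for k
  proof -
    have "c * N (y k) \<le> 1 * N (y k)" using c by (intro mult_right_mono) auto
    then show ?thesis using c y(1)[of k] by (simp add: N_scaleR)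
  qed
  moreover have "weakly_null (\<lambda>n. c *\<^sub>R y (r (n + n0)))"
  proof (rule weakly_null_if_eventually_annihilated[OF small])
    fix n i :: nat assume "i < n"
    then have "i < r (n + n0)" using seq_suble[OF l(1), of "n + n0"] by simp
    then show "blinfun_apply (\<phi> i) (c *\<^sub>R y (r (n + n0))) = 0" using y(2) by (simp add: blinfun.scaleR_right)
  qed
  ultimately obtain n where "N (c *\<^sub>R l + c *\<^sub>R y (r (n + n0))) \<le> 1"
    using weakly_null_add[of "c *\<^sub>R l" "\<lambda>n. c *\<^sub>R y (r (n + n0))"] by blast
  then have "c * N (l + y (r (n + n0))) \<le> c * (1 + e/2)"
    using c N_scaleR[of c "l + y (r (n + n0))"] by (simp add: scaleR_add_right)
  then have "N (l + y (r (n + n0))) \<le> 1 + e/2" using c(1) by (rule mult_left_le_imp_le)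
  moreover have "u (r (n + n0)) + y (r (n + n0)) = (u (r (n + n0)) - l) + (l + y (r (n + n0)))" by simp
  then have "N (u (r (n + n0)) + y (r (n + n0))) \<le> N (u (r (n + n0)) - l) + N (l + y (r (n + n0)))"
    by (metis N_triangle)
  ultimately show False using big[of "r (n + n0)"] n0[of "n + n0"] by simp
qed

text \<open>The dual counterpart of \<open>asymptotic_c0_uniform\<close>. Normalised counterexamples
  have first parts that converge along a subsequence, by finite dimension, and weak-star null second
  parts, so \<open>dn_add_weakstar_null\<close> fails at the limit.\<close>

lemma dual_asymptotic_l1_uniform:
  assumes e: "e > 0"
  shows "\<exists>m. \<forall>p\<in>F k. \<forall>q\<in>annE m. dn p + \<theta>/2 * dn q - e * (dn p + dn q) \<le> dn (p + q)"
proof (rule ccontr)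
  assume "\<not> ?thesis"
  then have "\<forall>m. \<exists>p q. p \<in> F k \<and> q \<in> annE m \<and> dn (p + q) < dn p + \<theta>/2 * dn q - e * (dn p + dn q)"
    by (simp add: not_le) blast
  then obtain p q where p: "\<And>m. p m \<in> F k" and q: "\<And>m. q m \<in> annE m"
    and bad: "\<And>m. dn (p m + q m) < dn (p m) + \<theta>/2 * dn (q m) - e * (dn (p m) + dn (q m))"
    by metis
  \<comment> \<open>Both sides are homogeneous in the pair, thanks to the form of the error term, so
    the sum of the two norms may be normalised to 1.\<close>
  define c where "c m = 1 / (dn (p m) + dn (q m))" for m
  have pos: "dn (p m) + dn (q m) > 0" for m
  proof (rule ccontr)
    assume "\<not> ?thesis"
    then have "dn (p m) = 0" "dn (q m) = 0"
      using dn_nonneg[of "p m"] dn_nonneg[of "q m"] by linarith+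
    then show False using bad[of m] dn_nonneg[of "p m + q m"] by simp
  qed
  have c: "c m > 0" for m using pos[of m] by (simp add: c_def)
  define P where "P m = c m *\<^sub>R p m" for m
  define Q where "Q m = c m *\<^sub>R q m" for m
  have sum1: "dn (P m) + dn (Q m) = 1" for m
    using pos[of m] c[of m] by (simp add: P_def Q_def dn_scaleR c_def flip: add_divide_distrib)
  have P: "P m \<in> F k" for m unfolding P_def by (intro subspace_scale p) simp
  have Q: "Q m \<in> annE m" for m unfolding Q_def by (intro subspace_scale q) simp
  have BAD: "dn (P m + Q m) < dn (P m) + \<theta>/2 * dn (Q m) - e" for m
  proof -
    have "dn (P m + Q m) = c m * dn (p m + q m)"
      using c[of m] dn_scaleR[of "c m" "p m + q m"] by (simp add: P_def Q_def scaleR_add_right)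
    also have "\<dots> < c m * (dn (p m) + \<theta>/2 * dn (q m) - e * (dn (p m) + dn (q m)))"
      using bad c by (intro mult_strict_left_mono)
    also have "\<dots> = dn (P m) + \<theta>/2 * dn (Q m) - e * (dn (P m) + dn (Q m))"
      using c[of m] by (simp add: P_def Q_def dn_scaleR algebra_simps)
    finally show ?thesis using sum1[of m] by simp
  qed
  have "norm (P m) \<le> 2" for m using norm_le_dn[of "P m"] sum1[of m] dn_nonneg[of "Q m"] by linarith
  then obtain l r where l: "strict_mono (r :: nat \<Rightarrow> nat)" "(P \<circ> r) \<longlonglongrightarrow> l"
    using span_finite_bounded_seq[of "\<phi> ` {..<k}" P 2] P by (auto simp: F_def)
  obtain n0 where n0: "\<And>n. n \<ge> n0 \<Longrightarrow> norm ((P \<circ> r) n - l) < e/4" using LIMSEQ_D[OF l(2), of "e/4"] e by auto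
  have "(\<lambda>n. blinfun_apply (Q (r (n + n0))) x) \<longlonglongrightarrow> 0" for x
  proof (rule pointwise_null_if_dense)
    show "dn (Q (r (n + n0))) \<le> 1" for n using sum1[of "r (n + n0)"] dn_nonneg[of "P (r (n + n0))"] by linarith
    show "(\<lambda>n. blinfun_apply (Q (r (n + n0))) (xs i)) \<longlonglongrightarrow> 0" for i
    proof (rule tendsto_eventually, unfold eventually_sequentially, intro exI allI impI)
      fix n assume "Suc i \<le> n"
      then have "i < r (n + n0)" using seq_suble[OF l(1), of "n + n0"] by simp
      then show "blinfun_apply (Q (r (n + n0))) (xs i) = 0" using Q[of "r (n + n0)"] xs_in_E by (auto simp: annE_def)
    qed
  qed
  then obtain n where "dn l + \<theta>/2 * dn (Q (r (n + n0))) - e/4 \<le> dn (l + Q (r (n + n0)))"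
    using dn_add_weakstar_null[of "\<lambda>n. Q (r (n + n0))" "e/4" l] e by auto
  moreover define m where "m = r (n + n0)"
  ultimately have 1: "dn l + \<theta>/2 * dn (Q m) - e/4 \<le> dn (l + Q m)" by simp
  have d: "dn (P m - l) < e/4" using n0[of "n + n0"] dn_le_norm[of "P m - l"] by (simp add: m_def)
  have "dn (P m) \<le> dn (P m - l) + dn l" using dn_triangle[of "P m - l" l] by simp
  moreover have "dn (l + Q m) \<le> dn (P m + Q m) + dn (P m - l)"
    using dn_diff[of "P m + Q m" "P m - l"] by (simp add: algebra_simps)
  ultimately show False using 1 d BAD[of m] e by linarith
qed

section \<open>Norms of restrictions and the splitting of functionals\<close>

definition dE :: "nat \<Rightarrow> ('a \<Rightarrow>\<^sub>L real) \<Rightarrow> real" where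
  "dE m f = (SUP u\<in>{u\<in>E m. N u \<le> 1}. blinfun_apply f u)"

lemma dE_upper: "u \<in> E m \<Longrightarrow> N u \<le> 1 \<Longrightarrow> blinfun_apply f u \<le> dE m f"
  unfolding dE_def by (rule cSUP_upper) (use dn_upper in \<open>auto simp: bdd_above_def\<close>)

lemma dE_least: "(\<And>u. u \<in> E m \<Longrightarrow> N u \<le> 1 \<Longrightarrow> blinfun_apply f u \<le> c) \<Longrightarrow> dE m f \<le> c"
  unfolding dE_def using subspace_0[OF subspace_E, of m] by (intro cSUP_least) (auto intro!: exI[of _ 0])

lemma dE_nonneg: "0 \<le> dE m f"
  using dE_upper[of 0 m f] by (simp add: subspace_0)

lemma dE_le_dn: "dE m f \<le> dn f"
  by (rule dE_least) (rule dn_upper)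

text \<open>
  If enlarging \<open>E m\<close> to \<open>E m'\<close> hardly increases the norm of the restriction of \<open>f\<close>, then, because
  vectors annihilated by \<open>F k\<close> can be added for free, \<open>f\<close> is small on the vectors of \<open>E m'\<close> that
  \<open>F k\<close> annihilates. Hahn-Banach turns this smallness into a splitting of \<open>f\<close>.
\<close>

lemma functional_splits:
  assumes c0: "\<And>u y. u \<in> E m \<Longrightarrow> N u \<le> 1 \<Longrightarrow> N y \<le> \<theta> \<Longrightarrow> (\<forall>i<k. blinfun_apply (\<phi> i) y = 0) \<Longrightarrow> N (u + y) \<le> 1 + e"
    and mm': "m \<le> m'" and e: "0 < e" "e \<le> 1" and f: "dn f \<le> 1" and flat: "dE m' f \<le> dE m f + e"
  shows "\<exists>p\<in>F k. \<exists>q\<in>annE m'. \<exists>r. f = p + q + r \<and> dn r \<le> 3 * e / \<theta>"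
proof -
  define V where "V = E m' \<inter> {v. \<forall>i<k. blinfun_apply (\<phi> i) v = 0}"
  have V: "subspace V"
    using subspace_E[of m'] by (auto simp: V_def subspace_def blinfun.add_right blinfun.scaleR_right)
  have fV: "blinfun_apply f v \<le> 3 * e / \<theta> * N v" if v: "v \<in> V" for v
  proof (cases "v = 0")
    case False
    then have pv: "N v > 0" using N_nonneg[of v] N_eq_0_iff[of v] by linarith
    \<comment> \<open>The largest multiple of \<open>v\<close> that \<open>c0\<close> allows to be
      added to every \<open>u\<close> in the unit ball of \<open>E m\<close>.\<close>
    define y where "y = (\<theta> / N v) *\<^sub>R v"
    have yV: "y \<in> V" unfolding y_def by (rule subspace_scale[OF V v])
    have Ny: "N y \<le> \<theta>" using pv theta by (simp add: y_def N_scaleR)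
    have "blinfun_apply f u \<le> (1 + e) * dE m' f - blinfun_apply f y" if u: "u \<in> E m" "N u \<le> 1" for u
    proof -
      have "N (u + y) \<le> 1 + e" by (rule c0[OF u Ny]) (use yV in \<open>simp add: V_def\<close>)
      moreover have "N ((1 / (1 + e)) *\<^sub>R (u + y)) = N (u + y) / (1 + e)" using e by (simp only: N_scaleR) simp
      ultimately have "N ((1 / (1 + e)) *\<^sub>R (u + y)) \<le> 1" using e by simp
      moreover have "(1 / (1 + e)) *\<^sub>R (u + y) \<in> E m'"
        using u(1) E_mono[OF mm'] yV by (intro subspace_scale subspace_add) (auto simp: V_def)
      ultimately have "blinfun_apply f ((1 / (1 + e)) *\<^sub>R (u + y)) \<le> dE m' f" by (intro dE_upper)
      moreover have "blinfun_apply f ((1 / (1 + e)) *\<^sub>R (u + y)) = (blinfun_apply f u + blinfun_apply f y) / (1 + e)"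
        by (simp only: blinfun.scaleR_right blinfun.add_right) simp
      ultimately have "(blinfun_apply f u + blinfun_apply f y) / (1 + e) \<le> dE m' f" by simp
      then show ?thesis using e by (simp only: divide_le_eq) (simp add: mult.commute)
    qed
    then have "dE m f \<le> (1 + e) * dE m' f - blinfun_apply f y" by (rule dE_least)
    moreover have "(1 + e) * dE m' f \<le> (1 + e) * (dE m f + e)" using flat e by (intro mult_left_mono) auto
    moreover have "e * dE m f \<le> e * 1" using e f dE_le_dn[of m f] by (intro mult_left_mono) auto
    moreover have "e * e \<le> e * 1" using e by (intro mult_left_mono) auto
    \<comment> \<open>One \<open>e\<close> comes from flatness, one from \<open>e * dE m f\<close>
      and one from \<open>e * e\<close>.\<close>
    ultimately have "blinfun_apply f y \<le> 3 * e" by (simp add: algebra_simps)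
    then have "\<theta> / N v * blinfun_apply f v \<le> 3 * e" by (simp add: y_def blinfun.scaleR_right)
    then show ?thesis using pv theta by (simp add: field_simps)
  qed simp
  define C where "C = 3 * e / \<theta>"
  have C: "C \<ge> 0" using e theta by (simp add: C_def)
  have "\<exists>g. linear g \<and> (\<forall>x\<in>V. g x = blinfun_apply f x) \<and> (\<forall>x. g x \<le> C * N x)"
  proof (rule hahn_banach_seminorm[OF _ _ V])
    show "C * N (x + y) \<le> C * N x + C * N y" for x y
      using mult_left_mono[OF N_triangle[of x y] C] by (simp add: distrib_left)
    show "blinfun_apply f x \<le> C * N x" if "x \<in> V" for x using fV[OF that] by (simp add: C_def)
  qed (simp_all add: N_scaleR bounded_linear.linear[OF blinfun.bounded_linear_right])
  then obtain g where g: "linear g" "\<And>x. x \<in> V \<Longrightarrow> g x = blinfun_apply f x" "\<And>x. g x \<le> C * N x" by blast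
  have "bounded_linear g"
  proof (rule bounded_linear_intro)
    fix x
    have "\<bar>g x\<bar> \<le> C * N x" using g(3)[of x] g(3)[of "- x"] by (simp add: linear_neg[OF g(1)] abs_le_iff)
    also have "\<dots> \<le> C * (2 * norm x)" by (intro mult_left_mono N_le_norm C)
    finally show "norm (g x) \<le> norm x * (2 * C)" by (simp add: algebra_simps)
  qed (simp_all add: linear_add[OF g(1)] linear_scale[OF g(1)])
  define r where "r = Blinfun g"
  have r: "blinfun_apply r = g" unfolding r_def by (rule bounded_linear_Blinfun_apply) fact
  have "dn r \<le> C"
  proof (rule dn_least)
    fix x assume "N x \<le> 1"
    then have "C * N x \<le> C * 1" using C by (intro mult_left_mono) auto
    then show "blinfun_apply r x \<le> C" using g(3)[of x] by (simp add: r)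
  qed
  \<comment> \<open>\<open>f - r\<close> vanishes on \<open>V\<close>, that is, on the vectors of
    \<open>E m'\<close> killed by the first \<open>k\<close> functionals, so on \<open>E m'\<close>
    it is a combination of these.\<close>
  moreover obtain p where p: "p \<in> F k" "\<And>v. v \<in> E m' \<Longrightarrow> blinfun_apply (f - r) v = blinfun_apply p v"
    using vanish_on_kernel_imp_span[of "E m'" k \<phi> "f - r"] g(2)
    by (auto simp: F_def V_def blinfun.diff_left r)
  moreover have "f - r - p \<in> annE m'" using p(2) by (simp add: annE_def blinfun.diff_left)
  moreover have "f = p + (f - r - p) + r" by simp
  ultimately show ?thesis unfolding C_def by blast
qed

text \<open>
  The norms \<open>dE (M i) f\<close> increase in \<open>i\<close> and are at most 1, so along sufficiently many steps one
  increment is at most \<open>e\<close>; there \<open>f\<close> splits.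
\<close>

lemma functional_splits_in_block:
  assumes e: "0 < e" "e \<le> 1"
  shows "\<exists>m'>m. \<exists>k. \<forall>f. dn f \<le> 1 \<longrightarrow> (\<exists>p\<in>F k. \<exists>q\<in>annE m. \<exists>r. f = p + q + r \<and> dn r \<le> 3 * e / \<theta> \<and>
    (\<forall>q'\<in>annE m'. dn p + \<theta>/2 * dn (q - q') - e * (dn p + dn (q - q')) \<le> dn (p + (q - q'))))"
proof -
  obtain kf where kf: "\<And>m u y. u \<in> E m \<Longrightarrow> N u \<le> 1 \<Longrightarrow> N y \<le> \<theta> \<Longrightarrow>
      (\<forall>i<kf m. blinfun_apply (\<phi> i) y = 0) \<Longrightarrow> N (u + y) \<le> 1 + e"
    using asymptotic_c0_uniform[OF e(1)] by metis
  obtain mf where mf: "\<And>k p q. p \<in> F k \<Longrightarrow> q \<in> annE (mf k) \<Longrightarrow>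
      dn p + \<theta>/2 * dn q - e * (dn p + dn q) \<le> dn (p + q)"
    using dual_asymptotic_l1_uniform[OF e(1)] by metis
  \<comment> \<open>Going at least as far as \<open>mf (kf (M i))\<close> ensures that when
    \<open>f\<close> splits at step \<open>i\<close>, with first part in
    \<open>F (kf (M i))\<close>, the dual estimate applies to the two parts.\<close>
  define M where "M i = ((\<lambda>m. max m (mf (kf m))) ^^ i) m" for i
  have M0: "M 0 = m" and MS: "M (Suc i) = max (M i) (mf (kf (M i)))" for i by (simp_all add: M_def)
  have Mmono: "i \<le> j \<Longrightarrow> M i \<le> M j" for i j by (rule lift_Suc_mono_le[of M]) (simp add: MS)
  obtain n :: nat where n: "1 / e < real n" using reals_Archimedean2 by blast
  then have n1: "1 < real n * e" using e by (simp add: field_simps)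
  \<comment> \<open>Just a common upper bound for the \<open>kf (M i)\<close>, because the position
    of the flat step depends on \<open>f\<close>.\<close>
  define K where "K = (\<Sum>i<n. kf (M i))"
  have kK: "kf (M i) \<le> K" if "i < n" for i unfolding K_def using that by (intro member_le_sum) auto
  show ?thesis
  \<comment> \<open>\<open>M\<close> may be constant, so \<open>Suc\<close> provides the strict
    increase.\<close>
  proof (rule exI[of _ "Suc (M n)"], rule conjI, goal_cases)
    case 1
    show ?case using Mmono[of 0 n] by (simp add: M0)
  next
    case 2
    show ?case
    proof (rule exI[of _ K], intro allI impI)
      fix f assume f: "dn f \<le> 1"
      have "\<exists>i<n. dE (M (Suc i)) f \<le> dE (M i) f + e"
      proof (rule ccontr)
        assume "\<not> ?thesis"
        then have "(\<Sum>i<n. e) \<le> (\<Sum>i<n. dE (M (Suc i)) f - dE (M i) f)" by (intro sum_mono) force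
        also have "\<dots> = dE (M n) f - dE (M 0) f" by (rule sum_lessThan_telescope)
        also have "\<dots> \<le> 1" using dE_le_dn[of "M n" f] dE_nonneg[of "M 0" f] f by simp
        finally show False using n1 by simp
      qed
      then obtain i where i: "i < n" "dE (M (Suc i)) f \<le> dE (M i) f + e" by blast
      have "\<exists>p\<in>F (kf (M i)). \<exists>q\<in>annE (M (Suc i)). \<exists>r. f = p + q + r \<and> dn r \<le> 3 * e / \<theta>"
        by (rule functional_splits[OF _ Mmono e f i(2)]) (auto intro: kf)
      then obtain p q r where pqr: "p \<in> F (kf (M i))" "q \<in> annE (M (Suc i))" "f = p + q + r" "dn r \<le> 3 * e / \<theta>"
        by blast
      have "p \<in> F K" using pqr(1) F_mono[OF kK[OF i(1)]] by blast
      moreover have "q \<in> annE m" using pqr(2) annE_antimono[of m "M (Suc i)"] Mmono[of 0 "Suc i"] by (auto simp: M0)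
      \<comment> \<open>\<open>q'\<close> stands for the annihilating part obtained in the next
        block; the pieces of the telescoping sum are such differences \<open>q - q'\<close>.\<close>
      moreover have "\<forall>q'\<in>annE (Suc (M n)). dn p + \<theta>/2 * dn (q - q') - e * (dn p + dn (q - q')) \<le> dn (p + (q - q'))"
      proof
        fix q' assume "q' \<in> annE (Suc (M n))"
        then have "q' \<in> annE (M (Suc i))" using annE_antimono[of "M (Suc i)" "Suc (M n)"] Mmono[of "Suc i" n] i(1) by auto
        then have "q - q' \<in> annE (M (Suc i))" using pqr(2) by (intro subspace_diff) auto
        then have "q - q' \<in> annE (mf (kf (M i)))" using annE_antimono[of "mf (kf (M i))" "M (Suc i)"] by (auto simp: MS)
        then show "dn p + \<theta>/2 * dn (q - q') - e * (dn p + dn (q - q')) \<le> dn (p + (q - q'))"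
          by (rule mf[OF pqr(1)])
      qed
      ultimately show "\<exists>p\<in>F K. \<exists>q\<in>annE m. \<exists>r. f = p + q + r \<and> dn r \<le> 3 * e / \<theta> \<and>
        (\<forall>q'\<in>annE (Suc (M n)). dn p + \<theta>/2 * dn (q - q') - e * (dn p + dn (q - q')) \<le> dn (p + (q - q')))"
        using pqr(3,4) by blast
    qed
  qed
qed

text \<open>Each block splits \<open>f\<close> as \<open>P j + Q j + R j\<close>, and the pieces are
  \<open>s j = Q j - Q (Suc j)\<close>, which up to errors is \<open>P (Suc j) - P j\<close>. So
  \<open>P j + s j\<close> is nearly \<open>P (Suc j)\<close>, and the dual estimate bounds
  \<theta>/2 * \<open>dn (s j)\<close> by the increment of \<open>dn (P j)\<close> plus an error.
  These increments telescope and the \<open>P j\<close> are bounded.\<close>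

lemma telescoping_decomposition:
  assumes \<eta>: "0 < \<eta>" "\<eta> \<le> 1"
  shows "\<exists>M K. M 0 = 0 \<and> strict_mono M \<and> (\<forall>f. dn f \<le> 1 \<longrightarrow> (\<exists>s.
    (\<forall>j. s j \<in> annE (M (j - 1))) \<and> (\<forall>j. \<exists>a\<in>F (K (Suc j)). dn (s j - a) \<le> (\<eta> / 2 ^ j)\<^sup>2) \<and>
    (\<forall>J. (\<Sum>j<J. dn (s j)) \<le> 36 / \<theta>) \<and> (\<forall>J. f - (\<Sum>j<J. s j) \<in> annE (M (J - 1)))))"
proof -
  \<comment> \<open>Squares, because a piece will later be divided by its norm; if this norm exceeds
    \<eta>/2^j, the error stays below \<eta>/2^j.\<close>
  define D where "D j = (\<eta> / 2 ^ j)\<^sup>2" for j :: nat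
  have DS: "D (Suc j) = D j / 4" for j by (simp add: D_def power2_eq_square)
  have Dpos: "0 < D j" for j using \<eta> by (simp add: D_def)
  have D0: "D 0 \<le> 1" using \<eta> by (simp add: D_def power_le_one)
  have D1: "D j \<le> 1" for j
    by (induction j) (use D0 Dpos in \<open>auto simp: DS intro: order_trans[rotated]\<close>)
  have Dsum: "(\<Sum>j<J. D j) \<le> 4/3" for J
  proof -
    have "(\<Sum>j<J. D j) = 4/3 * (D 0 - D J)" by (induction J) (simp_all add: DS)
    then show ?thesis using D0 Dpos[of J] by simp
  qed
  \<comment> \<open>Tuned to make the splitting error 3 * \<epsilon>/\<theta> equal to
    \<open>D j / 5\<close>; the factor \<theta> also compensates for norms of order
    1/\<theta>.\<close>
  define \<epsilon> where "\<epsilon> j = \<theta> * D j / 15" for j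
  have \<epsilon>: "0 < \<epsilon> j" "\<epsilon> j \<le> 1" for j
  proof -
    show "0 < \<epsilon> j" using theta Dpos by (simp add: \<epsilon>_def)
    have "\<theta> * D j \<le> 1 * 1" using theta Dpos[of j] D1[of j] by (intro mult_mono) auto
    then show "\<epsilon> j \<le> 1" by (simp add: \<epsilon>_def)
  qed
  define splits where "splits m j m' k f p q r \<longleftrightarrow> p \<in> F k \<and> q \<in> annE m \<and> f = p + q + r \<and> dn r \<le> D j / 5 \<and>
    (\<forall>q'\<in>annE m'. dn p + \<theta>/2 * dn (q - q') - \<epsilon> j * (dn p + dn (q - q')) \<le> dn (p + (q - q')))" for m j m' k f p q r
  have "\<exists>m' k. m < m' \<and> (\<forall>f. dn f \<le> 1 \<longrightarrow> (\<exists>p q r. splits m j m' k f p q r))" for m j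
  proof -
    have "3 * \<epsilon> j / \<theta> = D j / 5" using theta by (simp add: \<epsilon>_def)
    then show ?thesis using functional_splits_in_block[OF \<epsilon>[of j], of m] unfolding splits_def by (simp only:) blast
  qed
  then obtain bm bk where b: "\<And>m j. m < bm m j"
    "\<And>m j f. dn f \<le> 1 \<Longrightarrow> \<exists>p q r. splits m j (bm m j) (bk m j) f p q r" by metis
  define M where "M = rec_nat 0 (\<lambda>j m. bm m j)"
  \<comment> \<open>The maximum puts \<open>P j\<close> and \<open>P (Suc j)\<close> into the same
    \<open>F (K (Suc j))\<close>.\<close>
  define K where "K = rec_nat 0 (\<lambda>j k. max k (bk (M j) j))"
  have M0: "M 0 = 0" and MS: "M (Suc j) = bm (M j) j" for j by (simp_all add: M_def)
  have KS: "K (Suc j) = max (K j) (bk (M j) j)" for j by (simp add: K_def)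
  have Msm: "strict_mono M" using b(1) by (simp add: strict_mono_Suc_iff MS)
  show ?thesis
  proof (rule exI[of _ M], rule exI[of _ K], intro conjI allI impI)
    show "M 0 = 0" "strict_mono M" by fact+
    fix f assume f: "dn f \<le> 1"
    have "\<forall>j. \<exists>p q r. splits (M j) j (M (Suc j)) (bk (M j) j) f p q r" using b(2)[OF f] MS by simp
    then obtain p q r where pqr: "\<And>j. splits (M j) j (M (Suc j)) (bk (M j) j) f (p j) (q j) (r j)" by metis
    \<comment> \<open>Number 0 is the trivial splitting f = 0 + f + 0 that starts the telescoping;
      block \<open>i\<close> therefore gives number \<open>Suc i\<close>.\<close>
    define P where "P j = (case j of 0 \<Rightarrow> 0 | Suc i \<Rightarrow> p i)" for j
    define Q where "Q j = (case j of 0 \<Rightarrow> f | Suc i \<Rightarrow> q i)" for j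
    define R where "R j = (case j of 0 \<Rightarrow> 0 | Suc i \<Rightarrow> r i)" for j
    have f_eq: "f = P j + Q j + R j" for j
      using pqr[of "j - 1"] by (cases j) (simp_all add: P_def Q_def R_def splits_def)
    have PF: "P (Suc j) \<in> F (K (Suc j))" "P j \<in> F (K (Suc j))" for j
    proof -
      show 1: "P (Suc j) \<in> F (K (Suc j))" for j
        using pqr[of j] F_mono[of "bk (M j) j" "K (Suc j)"] by (auto simp: P_def splits_def KS)
      show "P j \<in> F (K (Suc j))"
        using 1[of "j - 1"] F_mono[of "K j" "K (Suc j)"] by (cases j) (auto simp: P_def KS subspace_0)
    qed
    \<comment> \<open>At \<open>j = 0\<close> truncated subtraction gives \<open>M 0 = 0\<close>,
      and \<open>annE 0\<close> is the whole dual.\<close>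
    have QM: "Q j \<in> annE (M (j - 1))" for j
      using pqr[of "j - 1"] by (cases j) (simp_all add: Q_def splits_def M0)
    have RD: "dn (R (Suc j)) \<le> D j / 5" "dn (R j) \<le> 4 * D j / 5" for j
    proof -
      show 1: "dn (R (Suc j)) \<le> D j / 5" for j using pqr[of j] by (simp add: R_def splits_def)
      show "dn (R j) \<le> 4 * D j / 5"
        using 1[of "j - 1"] Dpos[of j] DS[of "j - 1"] by (cases j) (simp_all add: R_def)
    qed
    \<comment> \<open>For positive \<open>j\<close> this is \<open>\<epsilon> (j - 1)\<close>,
      written in terms of \<open>D j\<close>.\<close>
    define e where "e j = 4 * (\<theta> * D j) / 15" for j
    have lower: "dn (P j) + \<theta>/2 * dn (Q j - q') - e j * (dn (P j) + dn (Q j - q')) \<le> dn (P j + (Q j - q'))"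
      if "q' \<in> annE (M j)" for j q'
    proof (cases j)
      case 0
      have "\<theta>/2 * dn (Q j - q') \<le> 1 * dn (Q j - q')" using theta by (intro mult_right_mono) auto
      moreover have "0 \<le> e j * dn (Q j - q')" using theta Dpos[of j] by (simp add: e_def)
      ultimately show ?thesis by (simp add: 0 P_def)
    next
      case (Suc i)
      have "e j = \<epsilon> i" by (simp add: e_def \<epsilon>_def Suc DS)
      then show ?thesis using pqr[of i] that by (simp add: splits_def Suc P_def Q_def)
    qed
    \<comment> \<open>Taking \<open>q' = 0\<close> bounds both parts, but \<open>Q j\<close> only up
      to 1/\<theta>, the price of the factor in the dual estimate.\<close>
    have PQ: "dn (P j) \<le> 4" "\<theta> * dn (Q j) \<le> 8" for j
    proof -
      have "0 \<in> annE (M j)" by (simp add: subspace_0)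
      then have "dn (P j) + \<theta>/2 * dn (Q j) - e j * (dn (P j) + dn (Q j)) \<le> dn (P j + Q j)"
        using lower[of 0 j] by simp
      moreover have "P j + Q j = f - R j" using f_eq[of j] by (simp add: algebra_simps)
      then have "dn (P j + Q j) \<le> 9/5" using dn_diff[of f "R j"] f RD(2)[of j] D1[of j] by simp
      moreover have "e j \<le> 4/15 * \<theta>" "e j \<le> 4/15"
      proof -
        have "\<theta> * D j \<le> \<theta> * 1" using theta D1 by (intro mult_left_mono) auto
        then show "e j \<le> 4/15 * \<theta>" by (simp add: e_def)
        then show "e j \<le> 4/15" using theta by simp
      qed
      then have "e j * dn (P j) \<le> 4/15 * dn (P j)" "e j * dn (Q j) \<le> 4/15 * \<theta> * dn (Q j)"
        by (intro mult_right_mono; simp)+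
      moreover have "0 \<le> \<theta> * dn (Q j)" using theta by simp
      ultimately show "dn (P j) \<le> 4" "\<theta> * dn (Q j) \<le> 8"
        using dn_nonneg[of "P j"] unfolding distrib_left by linarith+
    qed
    define s where "s j = Q j - Q (Suc j)" for j
    have s_eq: "s j = P (Suc j) - P j + (R (Suc j) - R j)" for j
      using f_eq[of j] f_eq[of "Suc j"] by (simp add: s_def algebra_simps)
    have step: "\<theta>/2 * dn (s j) \<le> dn (P (Suc j)) - dn (P j) + 7 * D j" for j
    proof -
      have "dn (P j) + \<theta>/2 * dn (s j) - e j * (dn (P j) + dn (s j)) \<le> dn (P j + s j)"
        using lower[of "Q (Suc j)" j] QM[of "Suc j"] by (simp add: s_def)
      moreover have "dn (P j + s j) \<le> dn (P (Suc j)) + D j"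
      proof -
        have "P j + s j = P (Suc j) + (R (Suc j) - R j)" by (simp add: s_eq)
        then show ?thesis
          using dn_triangle[of "P (Suc j)" "R (Suc j) - R j"] dn_diff[of "R (Suc j)" "R j"] RD[of j] by simp
      qed
      moreover have "e j * (dn (P j) + dn (s j)) \<le> 6 * D j"
      proof -
        have "\<theta> * dn (s j) \<le> \<theta> * dn (Q j) + \<theta> * dn (Q (Suc j))"
          using mult_left_mono[OF dn_diff[of "Q j" "Q (Suc j)"], of \<theta>] theta by (simp add: s_def distrib_left)
        then have "\<theta> * dn (s j) \<le> 16" using PQ(2)[of j] PQ(2)[of "Suc j"] by simp
        moreover have "\<theta> * dn (P j) \<le> 1 * 4" using theta PQ(1) by (intro mult_mono) auto
        ultimately have "4/15 * D j * (\<theta> * dn (P j) + \<theta> * dn (s j)) \<le> 4/15 * D j * 20"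
          using Dpos[of j] by (intro mult_left_mono) auto
        also have "\<dots> \<le> 6 * D j" using Dpos[of j] by simp
        also have "4/15 * D j * (\<theta> * dn (P j) + \<theta> * dn (s j)) = e j * (dn (P j) + dn (s j))"
          by (simp add: e_def algebra_simps)
        finally show ?thesis .
      qed
      ultimately show ?thesis by linarith
    qed
    show "\<exists>s. (\<forall>j. s j \<in> annE (M (j - 1))) \<and> (\<forall>j. \<exists>a\<in>F (K (Suc j)). dn (s j - a) \<le> (\<eta> / 2 ^ j)\<^sup>2) \<and>
      (\<forall>J. (\<Sum>j<J. dn (s j)) \<le> 36 / \<theta>) \<and> (\<forall>J. f - (\<Sum>j<J. s j) \<in> annE (M (J - 1)))"
    proof (intro exI[of _ s] conjI allI)
      show "s j \<in> annE (M (j - 1))" for j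
      proof -
        have "M (j - 1) \<le> M j" using Msm by (simp add: strict_mono_less_eq)
        then have "Q (Suc j) \<in> annE (M (j - 1))" using QM[of "Suc j"] annE_antimono by auto
        then show ?thesis unfolding s_def using QM by (intro subspace_diff) auto
      qed
      show "\<exists>a\<in>F (K (Suc j)). dn (s j - a) \<le> (\<eta> / 2 ^ j)\<^sup>2" for j
      proof
        show "P (Suc j) - P j \<in> F (K (Suc j))" by (intro subspace_diff PF) simp
        show "dn (s j - (P (Suc j) - P j)) \<le> (\<eta> / 2 ^ j)\<^sup>2"
          using dn_diff[of "R (Suc j)" "R j"] RD[of j] by (simp add: s_eq D_def)
      qed
      show "(\<Sum>j<J. dn (s j)) \<le> 36 / \<theta>" for J
      proof -
        have "\<theta>/2 * (\<Sum>j<J. dn (s j)) \<le> (\<Sum>j<J. dn (P (Suc j)) - dn (P j) + 7 * D j)"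
          unfolding sum_distrib_left by (intro sum_mono step)
        also have "\<dots> = dn (P J) - dn (P 0) + 7 * (\<Sum>j<J. D j)"
          using sum_lessThan_telescope[of "\<lambda>j. dn (P j)" J] by (simp add: sum.distrib sum_distrib_left)
        \<comment> \<open>\<open>dn (P J)\<close> is at most 4, and 7 * 4/3 is below 14.\<close>
        also have "\<dots> \<le> 18" using PQ(1)[of J] Dsum[of J] dn_nonneg[of "P 0"] by linarith
        finally show ?thesis using theta by (simp add: field_simps)
      qed
      have "(\<Sum>j<J. s j) = f - Q J" for J
        unfolding s_def by (subst sum_lessThan_telescope') (simp add: Q_def)
      then show "f - (\<Sum>j<J. s j) \<in> annE (M (J - 1))" for J using QM[of J] by simp
    qed
  qed
qed

text \<open>Elements of \<open>F k\<close> need not lie in \<open>A\<close>, but the net must. So a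
  finite net of a ball of \<open>F k\<close>, compact by finite dimension, is moved into the set:
  the way from \<open>q\<close> through \<open>a\<close> to a centre has length at most 2 * d, and
  the point chosen for that centre is at most 2 * d away from it.\<close>

lemma finite_net_near_F:
  assumes d: "d > 0"
  shows "\<exists>T. finite T \<and> T \<subseteq> {q\<in>A. dn q \<le> 1 \<and> (\<exists>a\<in>F k. dn (q - a) \<le> d)} \<and>
    (\<forall>q\<in>A. dn q \<le> 1 \<longrightarrow> (\<exists>a\<in>F k. dn (q - a) \<le> d) \<longrightarrow> (\<exists>t\<in>T. dn (q - t) \<le> 4 * d))"
proof -
  define S where "S = {q\<in>A. dn q \<le> 1 \<and> (\<exists>a\<in>F k. dn (q - a) \<le> d)}"
  define C where "C = {a\<in>F k. norm a \<le> 2 * (1 + d)}"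
  have "seq_compact C"
  proof (rule seq_compactI)
    fix a :: "nat \<Rightarrow> _" assume a: "\<forall>n. a n \<in> C"
    then obtain l r where l: "l \<in> F k" "strict_mono (r :: nat \<Rightarrow> nat)" "(a \<circ> r) \<longlonglongrightarrow> l"
      using span_finite_bounded_seq[of "\<phi> ` {..<k}" a "2 * (1 + d)"] by (auto simp: C_def F_def)
    have "norm l \<le> 2 * (1 + d)"
      by (rule LIMSEQ_le_const2[OF tendsto_norm[OF l(3)]]) (use a in \<open>auto simp: C_def\<close>)
    then show "\<exists>l\<in>C. \<exists>r. strict_mono (r :: nat \<Rightarrow> nat) \<and> (a \<circ> r) \<longlonglongrightarrow> l" using l by (auto simp: C_def)
  qed
  then obtain c where c: "finite c" "C \<subseteq> (\<Union>x\<in>c. ball x d)"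
    using seq_compact_imp_totally_bounded d by metis
  \<comment> \<open>Centres with no point of \<open>S\<close> nearby get an arbitrary value;
    intersecting with \<open>S\<close> in the definition of \<open>T\<close> keeps the net inside
    \<open>S\<close> nevertheless.\<close>
  define pick where "pick x = (SOME q. q \<in> S \<and> dn (q - x) \<le> 2 * d)" for x
  have pick: "pick x \<in> S \<and> dn (pick x - x) \<le> 2 * d" if "q \<in> S" "dn (q - x) \<le> 2 * d" for q x
    unfolding pick_def by (rule someI[of _ q]) (use that in auto)
  define T where "T = pick ` c \<inter> S"
  have "\<exists>t\<in>T. dn (q - t) \<le> 4 * d" if q: "q \<in> S" for q
  proof -
    obtain a where a: "a \<in> F k" "dn (q - a) \<le> d" using q by (auto simp: S_def)
    have "dn a \<le> dn q + dn (q - a)" using dn_diff[of q "q - a"] by simp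
    then have "dn a \<le> 1 + d" using a q by (simp add: S_def)
    then have "a \<in> C" using a norm_le_dn[of a] by (simp add: C_def)
    then obtain x where x: "x \<in> c" "dist x a < d" using c(2) by auto
    have "dn (q - x) \<le> dn (q - a) + dn (a - x)" by (rule dn_diff_triangle)
    also have "dn (a - x) \<le> d" using dn_le_norm[of "a - x"] x(2) by (simp add: dist_norm norm_minus_commute)
    finally have qx: "dn (q - x) \<le> 2 * d" using a(2) by simp
    from pick[OF q qx] have t: "pick x \<in> T" "dn (pick x - x) \<le> 2 * d" using x(1) by (auto simp: T_def)
    have "dn (q - pick x) \<le> dn (q - x) + dn (x - pick x)" by (rule dn_diff_triangle)
    then show ?thesis using t qx dn_minus_commute[of x "pick x"] by (intro bexI[of _ "pick x"]) auto
  qed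
  moreover have "finite T" "T \<subseteq> S" using c(1) by (auto simp: T_def)
  ultimately show ?thesis unfolding S_def by blast
qed

section \<open>The norming sequence and the embedding into c0\<close>

lemma norming_functional: "\<exists>f. dn f \<le> 1 \<and> blinfun_apply f x = N x"
proof (cases "x = 0")
  case True
  then show ?thesis by (intro exI[of _ 0]) simp
next
  case False
  \<comment> \<open>\<open>hahn_banach_seminorm\<close> starts from a map that is linear everywhere;
    any algebraic extension will do, since domination is asked on \<open>span {x}\<close>
    only.\<close>
  obtain f0 :: "'a \<Rightarrow> real" where f0: "linear f0" "f0 x = N x"
    using linear_independent_extend[of "{x}" "\<lambda>_. N x"] False by auto
  have "\<exists>g. linear g \<and> (\<forall>v\<in>span {x}. g v = f0 v) \<and> (\<forall>v. g v \<le> N v)"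
  proof (rule hahn_banach_seminorm[OF N_triangle N_scaleR subspace_span f0(1)])
    fix v assume "v \<in> span {x}"
    then obtain c where "v = c *\<^sub>R x" by (auto simp: span_singleton)
    then show "f0 v \<le> N v" using f0 by (simp add: linear_scale N_scaleR mult_right_mono)
  qed
  then obtain g where g: "linear g" "\<forall>v\<in>span {x}. g v = f0 v" "\<And>v. g v \<le> N v" by blast
  have gx: "g x = N x" using g(2) f0(2) by (simp add: span_base)
  have "bounded_linear g"
  proof (rule bounded_linear_intro)
    fix v
    have "\<bar>g v\<bar> \<le> N v" using g(3)[of v] g(3)[of "- v"] by (simp add: linear_neg[OF g(1)] abs_le_iff)
    then show "norm (g v) \<le> norm v * 2" using N_le_norm[of v] by simp
  qed (simp_all add: linear_add[OF g(1)] linear_scale[OF g(1)])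
  then have r: "blinfun_apply (Blinfun g) = g" by (rule bounded_linear_Blinfun_apply)
  have "dn (Blinfun g) \<le> 1" by (rule dn_least) (use g(3) order_trans in \<open>auto simp: r\<close>)
  then show ?thesis using gx by (intro exI[of _ "Blinfun g"]) (simp add: r)
qed

text \<open>The lower bound is stated at the dense points, where the series of pieces is a finite
  sum. Each large piece of a norming functional is a multiple of something close to a net element,
  which gives \<open>N (xs i)\<close> at most 36/\<theta> * B plus an error of half of
  \<open>N (xs i)\<close>.\<close>

lemma norming_weakstar_null_sequence:
  obtains t :: "nat \<Rightarrow> ('a \<Rightarrow>\<^sub>L real)" where
    "\<And>n. dn (t n) \<le> 1" "\<And>x. (\<lambda>n. blinfun_apply (t n) x) \<longlonglongrightarrow> 0"
    "\<And>i B. (\<And>n. \<bar>blinfun_apply (t n) (xs i)\<bar> \<le> B) \<Longrightarrow> N (xs i) \<le> 72 / \<theta> * B"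
proof -
  \<comment> \<open>Chosen so that the total error factor 144/\<theta> * (2 * \<eta>) equals
    1/2.\<close>
  define \<eta> where "\<eta> = \<theta> / 576"
  have \<eta>: "0 < \<eta>" "\<eta> \<le> 1" using theta by (auto simp: \<eta>_def)
  define d where "d j = \<eta> / 2 ^ j" for j :: nat
  have d: "0 < d j" for j using \<eta> by (simp add: d_def)
  have dsum: "(\<Sum>j<J. d j) \<le> 2 * \<eta>" for J
  proof -
    have "(\<Sum>j<J. d j) = 2 * \<eta> - 2 * \<eta> / 2 ^ J" by (induction J) (simp_all add: d_def)
    then show ?thesis using \<eta> by simp
  qed
  define decomposes where "decomposes M K f s \<longleftrightarrow>
    (\<forall>j. s j \<in> annE (M (j - 1))) \<and> (\<forall>j. \<exists>a\<in>F (K (Suc j)). dn (s j - a) \<le> (d j)\<^sup>2) \<and>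
    (\<forall>J. (\<Sum>j<J. dn (s j)) \<le> 36 / \<theta>) \<and> (\<forall>J. f - (\<Sum>j<J. s j) \<in> annE (M (J - 1)))"
    for M K f s
  have "\<exists>M K. M 0 = 0 \<and> strict_mono M \<and> (\<forall>f. dn f \<le> 1 \<longrightarrow> (\<exists>s. decomposes M K f s))"
    unfolding decomposes_def d_def by (rule telescoping_decomposition[OF \<eta>])
  then obtain M K where M: "M 0 = 0" "strict_mono M"
    and dec: "\<forall>f. dn f \<le> 1 \<longrightarrow> (\<exists>s. decomposes M K f s)" by blast
  define net where "net j T \<longleftrightarrow> finite T \<and>
    T \<subseteq> {q\<in>annE (M (j - 1)). dn q \<le> 1 \<and> (\<exists>a\<in>F (K (Suc j)). dn (q - a) \<le> d j)} \<and>
    (\<forall>q\<in>annE (M (j - 1)). dn q \<le> 1 \<longrightarrow> (\<exists>a\<in>F (K (Suc j)). dn (q - a) \<le> d j) \<longrightarrow> (\<exists>t\<in>T. dn (q - t) \<le> 4 * d j))"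
    for j T
  have "\<forall>j. \<exists>T. net j T" unfolding net_def by (intro allI finite_net_near_F d)
  then obtain T where net: "\<And>j. net j (T j)" by metis
  have T: "finite (T j)" "T j \<subseteq> {q\<in>annE (M (j - 1)). dn q \<le> 1}" for j
    using net[of j] unfolding net_def by blast+
  have T_near: "\<exists>t\<in>T j. dn (q - t) \<le> 4 * d j"
    if "q \<in> annE (M (j - 1))" "dn q \<le> 1" "\<exists>a\<in>F (K (Suc j)). dn (q - a) \<le> d j" for j q
    using net[of j] that unfolding net_def by simp
  have "\<forall>j. \<exists>l. set l = T j" using T(1) finite_list by blast
  then obtain ts where ts: "\<And>j. set (ts j) = T j" by metis
  \<comment> \<open>All nets are listed in one sequence through the pairing of level and position;
    codes beyond the end of a list get 0, which affects neither the bound nor convergence to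
    0.\<close>
  define t where "t n = (let (j, i) = prod_decode n in if i < length (ts j) then ts j ! i else 0)" for n
  have t_cases: "t n = 0 \<or> (\<exists>j i. n = prod_encode (j, i) \<and> i < length (ts j) \<and> t n \<in> T j)" for n
  proof -
    obtain j i where ji: "prod_decode n = (j, i)" by fastforce
    then have "n = prod_encode (j, i)" by (metis prod_decode_inverse)
    then show ?thesis using ts[of j] nth_mem[of i "ts j"] by (auto simp: t_def)
  qed
  have t_onto: "\<exists>n. t n = q" if q: "q \<in> T j" for q j
  proof -
    obtain i where "i < length (ts j)" "ts j ! i = q" using q ts[of j] by (metis in_set_conv_nth)
    then show ?thesis by (intro exI[of _ "prod_encode (j, i)"]) (simp add: t_def)
  qed
  have t1: "dn (t n) \<le> 1" for n using t_cases[of n] T(2) by auto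
  have M_ge: "n \<le> M n" for n using M(2) by (rule seq_suble)
  have "(\<lambda>n. blinfun_apply (t n) (xs i)) \<longlonglongrightarrow> 0" for i
  proof (rule tendsto_eventually)
    have "{n. blinfun_apply (t n) (xs i) \<noteq> 0} \<subseteq> prod_encode ` (SIGMA j:{..Suc i}. {..<length (ts j)})"
    proof
      fix n assume n: "n \<in> {n. blinfun_apply (t n) (xs i) \<noteq> 0}"
      then obtain j k where jk: "n = prod_encode (j, k)" "k < length (ts j)" "t n \<in> T j"
        using t_cases[of n] by auto
      have "j \<le> Suc i"
      proof (rule ccontr)
        assume "\<not> ?thesis"
        then have "i < M (j - 1)" using M_ge[of "j - 1"] by linarith
        then show False using n jk(3) T(2)[of j] xs_in_E by (auto simp: annE_def)
      qed
      then show "n \<in> prod_encode ` (SIGMA j:{..Suc i}. {..<length (ts j)})" using jk by auto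
    qed
    then have "finite {n. blinfun_apply (t n) (xs i) \<noteq> 0}" by (rule finite_subset) auto
    then show "\<forall>\<^sub>F n in sequentially. blinfun_apply (t n) (xs i) = 0"
      by (simp add: cofinite_eq_sequentially[symmetric] eventually_cofinite)
  qed
  then have t0: "(\<lambda>n. blinfun_apply (t n) x) \<longlonglongrightarrow> 0" for x
    by (rule pointwise_null_if_dense[OF t1])
  have "N (xs i) \<le> 72 / \<theta> * B" if B: "\<And>n. \<bar>blinfun_apply (t n) (xs i)\<bar> \<le> B" for i B
  proof -
    let ?x = "xs i"
    have B0: "B \<ge> 0" using B[of 0] by linarith
    obtain f where f: "dn f \<le> 1" "blinfun_apply f ?x = N ?x" using norming_functional by blast
    obtain s where s: "\<And>j. s j \<in> annE (M (j - 1))" "\<And>j. \<exists>a\<in>F (K (Suc j)). dn (s j - a) \<le> (d j)\<^sup>2"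
      "\<And>J. (\<Sum>j<J. dn (s j)) \<le> 36 / \<theta>" "\<And>J. f - (\<Sum>j<J. s j) \<in> annE (M (J - 1))"
      using dec f(1) unfolding decomposes_def by blast
    \<comment> \<open>Here \<open>J - 1\<close> is \<open>Suc i\<close> and \<open>M (Suc i)\<close>
      exceeds \<open>i\<close>, so the remainder annihilates \<open>xs i\<close>.\<close>
    define J where "J = Suc (Suc i)"
    have "?x \<in> E (M (J - 1))" using M_ge[of "Suc i"] by (intro xs_in_E) (simp add: J_def)
    then have "blinfun_apply (f - (\<Sum>j<J. s j)) ?x = 0" using s(4)[of J] by (simp add: annE_def)
    then have N_eq: "N ?x = (\<Sum>j<J. blinfun_apply (s j) ?x)"
      using f(2) by (simp add: blinfun.diff_left blinfun.sum_left)
    have sb: "dn (s j) \<le> 36 / \<theta>" for j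
      using s(3)[of "Suc j"] sum_nonneg[of "{..<j}" "\<lambda>j. dn (s j)"] by simp
    \<comment> \<open>A piece of norm at most \<open>d j\<close> counts as error altogether. A
      larger one is normalised, compared with the net at cost 4 * \<open>d j\<close>, and scaled
      back by at most 36/\<theta>, whence 144/\<theta>.\<close>
    have each: "blinfun_apply (s j) ?x \<le> dn (s j) * B + 144 / \<theta> * d j * N ?x" for j
    proof (cases "dn (s j) \<le> d j")
      case True
      have "blinfun_apply (s j) ?x \<le> dn (s j) * N ?x" by (rule dn_apply)
      also have "\<dots> \<le> d j * N ?x" using True by (intro mult_right_mono) auto
      also have "\<dots> \<le> 144 / \<theta> * d j * N ?x"
      proof -
        have "1 \<le> 144 / \<theta>" using theta by (simp add: field_simps)
        then have "1 * (d j * N ?x) \<le> 144 / \<theta> * (d j * N ?x)" using d[of j] by (intro mult_right_mono) auto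
        then show ?thesis by (simp add: mult.assoc)
      qed
      finally show ?thesis using mult_nonneg_nonneg[OF dn_nonneg B0, of "s j"] by simp
    next
      case False
      define c where "c = dn (s j)"
      have c: "c > d j" "c > 0" using False d[of j] by (auto simp: c_def)
      define q where "q = (1 / c) *\<^sub>R s j"
      have "dn q \<le> 1" using c by (simp add: q_def dn_scaleR c_def[symmetric])
      moreover have "q \<in> annE (M (j - 1))" unfolding q_def by (intro subspace_scale s) simp
      moreover have "\<exists>a\<in>F (K (Suc j)). dn (q - a) \<le> d j"
      proof -
        obtain a where a: "a \<in> F (K (Suc j))" "dn (s j - a) \<le> (d j)\<^sup>2" using s(2) by blast
        have "dn (q - (1 / c) *\<^sub>R a) = dn (s j - a) / c"
          using c dn_scaleR[of "1 / c" "s j - a"] by (simp add: q_def scaleR_diff_right)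
        also have "\<dots> \<le> (d j)\<^sup>2 / c" using a(2) c by (intro divide_right_mono) auto
        also have "\<dots> \<le> (d j)\<^sup>2 / d j" using c d[of j] by (intro divide_left_mono) auto
        also have "\<dots> = d j" by (simp add: power2_eq_square)
        finally show ?thesis using subspace_scale[OF subspace_F a(1)] by blast
      qed
      ultimately obtain u where u: "u \<in> T j" "dn (q - u) \<le> 4 * d j" using T_near by blast
      obtain n where n: "t n = u" using t_onto[OF u(1)] by blast
      have "blinfun_apply q ?x = blinfun_apply u ?x + blinfun_apply (q - u) ?x" by (simp add: blinfun.diff_left)
      also have "\<dots> \<le> B + 4 * d j * N ?x"
      proof (rule add_mono)
        show "blinfun_apply u ?x \<le> B" using B[of n] n by simp
        have "blinfun_apply (q - u) ?x \<le> dn (q - u) * N ?x" by (rule dn_apply)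
        also have "\<dots> \<le> 4 * d j * N ?x" using u(2) by (intro mult_right_mono) auto
        finally show "blinfun_apply (q - u) ?x \<le> 4 * d j * N ?x" .
      qed
      finally have "c * blinfun_apply q ?x \<le> c * (B + 4 * d j * N ?x)" using c by (intro mult_left_mono) auto
      moreover have "c * blinfun_apply q ?x = blinfun_apply (s j) ?x" using c by (simp add: q_def blinfun.scaleR_left)
      moreover have "c * (4 * d j * N ?x) \<le> 36 / \<theta> * (4 * d j * N ?x)"
        using sb[of j] d[of j] by (intro mult_right_mono) (auto simp: c_def)
      ultimately show ?thesis by (simp add: c_def distrib_left)
    qed
    have "N ?x \<le> (\<Sum>j<J. dn (s j) * B + 144 / \<theta> * d j * N ?x)" unfolding N_eq by (intro sum_mono each[unfolded N_eq])
    also have "\<dots> = (\<Sum>j<J. dn (s j)) * B + 144 / \<theta> * N ?x * (\<Sum>j<J. d j)"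
      by (simp add: sum.distrib sum_distrib_left sum_distrib_right sum_divide_distrib mult.assoc mult.commute mult.left_commute)
    also have "\<dots> \<le> 36 / \<theta> * B + 144 / \<theta> * N ?x * (2 * \<eta>)"
      using s(3) B0 dsum theta by (intro add_mono mult_left_mono mult_right_mono) auto
    also have "144 / \<theta> * N ?x * (2 * \<eta>) = N ?x / 2" using theta by (simp add: \<eta>_def)
    finally show ?thesis by simp
  qed
  then show thesis using that t1 t0 by blast
qed

lemma embeds_into_c0:
  "\<exists>T :: 'a \<Rightarrow> (nat \<Rightarrow>\<^sub>C real). \<exists>c>0. bounded_linear T \<and> range T \<subseteq> c0 \<and> (\<forall>x. c * norm x \<le> norm (T x))"
proof -
  obtain t :: "nat \<Rightarrow> ('a \<Rightarrow>\<^sub>L real)" where t: "\<And>n. dn (t n) \<le> 1" "\<And>x. (\<lambda>n. blinfun_apply (t n) x) \<longlonglongrightarrow> 0"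
    "\<And>i B. (\<And>n. \<bar>blinfun_apply (t n) (xs i)\<bar> \<le> B) \<Longrightarrow> N (xs i) \<le> 72 / \<theta> * B"
    using norming_weakstar_null_sequence by blast
  have tb: "\<bar>blinfun_apply (t n) x\<bar> \<le> 2 * norm x" for n x
  proof -
    have "\<bar>blinfun_apply (t n) x\<bar> \<le> dn (t n) * N x" by (rule dn_abs_apply)
    also have "\<dots> \<le> 1 * N x" using t(1) by (intro mult_right_mono) auto
    finally show ?thesis using N_le_norm[of x] by simp
  qed
  define T where "T x = Bcontfun (\<lambda>n. blinfun_apply (t n) x)" for x
  have T: "apply_bcontfun (T x) n = blinfun_apply (t n) x" for x n
  proof -
    have "(\<lambda>n. blinfun_apply (t n) x) \<in> bcontfun"
      using tb by (auto simp: bcontfun_def bounded_iff intro!: exI[of _ "2 * norm x"])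
    then show ?thesis by (simp add: T_def Bcontfun_inverse)
  qed
  have bl: "bounded_linear T"
  proof (rule bounded_linear_intro)
    show "T (x + y) = T x + T y" for x y
      by (rule bcontfun_eqI) (simp add: T plus_bcontfun.rep_eq blinfun.add_right)
    show "T (r *\<^sub>R x) = r *\<^sub>R T x" for r x
      by (rule bcontfun_eqI) (simp add: T scaleR_bcontfun.rep_eq blinfun.scaleR_right)
    show "norm (T x) \<le> norm x * 2" for x
      by (rule norm_bound) (use tb[of _ x] in \<open>simp add: T mult.commute\<close>)
  qed
  interpret T: bounded_linear T by fact
  define c where "c = \<theta> / 72"
  have c: "c > 0" using theta by (simp add: c_def)
  have "c * norm x \<le> norm (T x)" for x
  proof -
    \<comment> \<open>The lower bound is known on the dense sequence only and extends by continuity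
      of both sides.\<close>
    have "closed {x. c * norm x \<le> norm (T x)}"
      by (intro closed_Collect_le continuous_intros T.continuous_on)
    moreover have "range xs \<subseteq> {x. c * norm x \<le> norm (T x)}"
    proof (intro image_subsetI CollectI)
      fix i
      have "\<bar>blinfun_apply (t n) (xs i)\<bar> \<le> norm (T (xs i))" for n
        using norm_bounded[of "T (xs i)" n] by (simp add: T)
      then have "N (xs i) \<le> 72 / \<theta> * norm (T (xs i))" by (rule t(3))
      then have "norm (xs i) \<le> 72 / \<theta> * norm (T (xs i))" using norm_le_N[of "xs i"] by simp
      then show "c * norm (xs i) \<le> norm (T (xs i))" using theta by (simp add: c_def field_simps)
    qed
    ultimately have "closure (range xs) \<subseteq> {x. c * norm x \<le> norm (T x)}" by (rule closure_minimal[rotated])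
    then show ?thesis using xs_dense by auto
  qed
  moreover have "apply_bcontfun (T x) = (\<lambda>n. blinfun_apply (t n) x)" for x by (rule ext) (rule T)
  then have "range T \<subseteq> c0" using t(2) by (auto simp: c0_def)
  ultimately show ?thesis using bl c by blast
qed

end

theorem theorem3p2:
  assumes separable: "\<exists>D :: 'a::banach set. countable D \<and> closure D = UNIV"
    and no_ell1: "\<not> (\<exists>Y :: 'a set. closed_subspace Y \<and>
                    linearly_homeomorphic Y (UNIV :: ell1 set))"
    and btp: "bounded_tree_property TYPE('a)"
  shows "\<exists>Z :: (nat \<Rightarrow>\<^sub>C real) set. closed_subspace Z \<and> Z \<subseteq> c0 \<and>
           linearly_homeomorphic (UNIV :: 'a set) Z"
proof -
  obtain N :: "'a \<Rightarrow> real" and \<theta> :: real where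
    N: "\<And>x y. N (x + y) \<le> N x + N y" "\<And>c x. N (c *\<^sub>R x) = \<bar>c\<bar> * N x"
    "\<And>x. norm x \<le> N x" "\<And>x. N x \<le> 2 * norm x" "0 < \<theta>" "\<theta> \<le> 1"
    "\<And>x y. N x < 1 \<Longrightarrow> weakly_null y \<Longrightarrow> (\<And>n. N (y n) \<le> \<theta>) \<Longrightarrow> \<exists>n. N (x + y n) \<le> 1"
    using bounded_tree_property_renorming[OF btp] by blast
  obtain D :: "'a set" where D: "countable D" "closure D = UNIV" using separable by blast
  then have "D \<noteq> {}" by auto
  define xs where "xs = from_nat_into D"
  have xs_dense: "closure (range xs) = UNIV" using D range_from_nat_into[OF \<open>D \<noteq> {}\<close>] by (simp add: xs_def)
  interpret asymptotic_c0_norm N \<theta> xs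
  proof (rule asymptotic_c0_norm.intro)
    show "\<exists>r. strict_mono (r :: nat \<Rightarrow> nat) \<and> (\<forall>\<phi> :: 'a \<Rightarrow>\<^sub>L real. convergent (\<lambda>n. blinfun_apply \<phi> (y (r n))))"
      if "\<And>n. norm (y n) \<le> B" for y and B
      by (rule weakly_cauchy_subsequence[OF no_ell1 that])
    show "\<exists>n. N (x + y n) \<le> 1" if "N x < 1" "weakly_null y" "\<And>n. N (y n) \<le> \<theta>" for x y
      by (rule N(7)[OF that])
  qed (use N(1-6) xs_dense in simp_all)
  obtain \<phi> :: "nat \<Rightarrow> 'a \<Rightarrow>\<^sub>L real" where \<phi>: "\<forall>f. \<forall>e>0. \<exists>i. dn (f - \<phi> i) < e"
    using dual_separable by blast
  interpret asymptotic_c0_frame N \<theta> xs \<phi> by unfold_locales (use \<phi> in simp)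
  obtain T :: "'a \<Rightarrow> (nat \<Rightarrow>\<^sub>C real)" and c where
    T: "c > 0" "bounded_linear T" "range T \<subseteq> c0" "\<And>x. c * norm x \<le> norm (T x)"
    using embeds_into_c0 by blast
  \<comment> \<open>An operator bounded below on a complete space has complete, hence closed,
    range.\<close>
  have "complete (range T)"
    using complete_isometric_image[OF T(1) subspace_UNIV T(2)] T(4) complete_UNIV by blast
  moreover have "subspace (range T)"
    using linear_subspace_image[OF bounded_linear.linear[OF T(2)] subspace_UNIV] .
  ultimately show ?thesis
    using bounded_below_linear_homeomorphic(1)[OF T(2,1,4)] T(3) complete_imp_closed
    by (auto simp: closed_subspace_def)
qed

end
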